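(* Let $\{Q_l\}_{l\in\mathbb Z}$ be a system of transition probabilities from $\boldsymbol{\mathcal K}$ to $\mathcal K$ satisfying Hypotheses (SF) and (RZ) (stated in the context). Then there exists a random process $\{\hat\xi_s\in\mathcal K\}_{s\in\mathbb Z}$, unique in distribution, such that for each $k\in\mathbb Z$ its regular conditional distribution $\mathbb P(\hat\xi_{k+1}\in\cdot\mid\hat{\boldsymbol\xi}_k)$ equals $Q_k(\hat{\boldsymbol\xi}_k;\cdot)$, where $\hat{\boldsymbol\xi}_k=(\dots,\hat\xi_{k-1},\hat\xi_k)\in\boldsymbol{\mathcal K}$. This process is feebly exponentially mixing in the following sense: there are $\gamma>0$ and constants $C_s>0$ ($s\ge1$) such that (1) for any $\tau\in\mathbb Z$, $k\ge0$, $s\ge1$ and any vector $\hat{\boldsymbol\eta}_\tau\in\boldsymbol{\mathcal K}$, $$\big\|\mathcal D\big((\hat\xi_{\tau+k+1},\dots,\hat\xi_{\tau+k+s})\mid\hat{\boldsymbol\xi}_\tau=\hat{\boldsymbol\eta}_\tau\big)-\mathcal D(\hat\xi_{\tau+k+1},\dots,\hat\xi_{\tau+k+s})\big\|_L^*\le C_se^{-\gamma k};$$ (2) for any $\tau\in\mathbb Z$, $k\ge0$ and $N,s\ge1$, $$\big|\mathbb E\,f(\hat\xi_{\tau-N+1},\dots,\hat\xi_\tau)\,g(\hat\xi_{\tau+k+1},\dots,\hat\xi_{\tau+k+s})-\mathbb E\,f(\hat\xi_{\tau-N+1},\dots,\hat\xi_\tau)\,\mathbb E\,g(\hat\xi_{\tau+k+1},\dots,\hat\xi_{\tau+k+s})\big|\le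 C_se^{-\gamma k},$$ for every measurable function $f$ on $\mathcal K^N$ with $|f|\le1$ and every Lipschitz function $g$ on $\mathcal K^s$ with $|g|\le1$ and $\mathrm{Lip}(g)\le1$.
   Context: $E$ is a separable Hilbert space, $\mathcal K\subset E$ is a compact set containing $0$, $\boldsymbol{\mathcal K}=\mathcal K^{\mathbb Z_-}=\{(\dots,\xi_{-1},\xi_0):\xi_k\in\mathcal K\}$ is given the metric $d(\boldsymbol\xi,\boldsymbol\xi')=\sum_{k\le0}\alpha^{|k|}\|\xi_k-\xi'_k\|_E$, with $\alpha\in(0,1)$ fixed. A transition probability from $\boldsymbol{\mathcal K}$ to $\mathcal K$ is a measurable map $\boldsymbol\xi\mapsto Q(\boldsymbol\xi;\cdot)\in\mathcal P(\mathcal K)$, where $\mathcal P(\mathcal K)$ is the set of Borel probability measures. $\mathcal D(\cdot)$ denotes the law. $\|\mu-\nu\|_{var}=\sup_\Gamma|\mu(\Gamma)-\nu(\Gamma)|$; $\|\mu-\nu\|_L^*=\sup|\langle f,\mu\rangle-\langle f,\nu\rangle|$ over functions $f$ with $\|f\|_\infty+\mathrm{Lip}(f)\le1$. Products $\mathcal K^s$ carry a standard product metric. (SF) There is $C>0$ with $\|Q_l(\boldsymbol\xi;\cdot)-Q_l(\boldsymbol\xi';\cdot)\|_{var}\le C\,d(\boldsymbol\xi,\boldsymbol\xi')$ for all $\boldsymbol\xi,\boldsymbol\xi'\in\boldsymbol{\mathcal K}$ and $l\in\mathbb Z$. For $l\in\mathbb Z$ and $\boldsymbol\xi\in\boldsymbol{\mathcal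 K}$ let $\mathbb P_{l,\boldsymbol\xi}$ be the law of the sequence $(y_1,y_2,\dots)$ in $\mathcal K$ such that $y_1\sim Q_l(\boldsymbol\xi;\cdot)$ and, given $y_1,\dots,y_j$, $y_{j+1}\sim Q_{l+j}((\boldsymbol\xi,y_1,\dots,y_j);\cdot)$. The conditional law $\mathcal D((\hat\xi_{\tau+k+1},\dots,\hat\xi_{\tau+k+s})\mid\hat{\boldsymbol\xi}_\tau=\hat{\boldsymbol\eta}_\tau)$ in (1) is understood, for every $\hat{\boldsymbol\eta}_\tau\in\boldsymbol{\mathcal K}$, as the law of $(y_{k+1},\dots,y_{k+s})$ under $\mathbb P_{\tau,\hat{\boldsymbol\eta}_\tau}$. (RZ) For any $n\in\mathbb N$ and $\delta>0$ there is an integer $s\ge0$ such that $\inf_{l\in\mathbb Z}\inf_{\boldsymbol\xi\in\boldsymbol{\mathcal K}}\mathbb P_{l,\boldsymbol\xi}\{\|y_j\|_E<\delta,\ j=s+1,\dots,s+n\}>0$. *)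

theory Defs
  imports "HOL-Probability.Probability"
begin

definition state_space :: "'e::topological_space set \<Rightarrow> 'e measure" where
  "state_space K = restrict_space borel K"

text \<open>
  A history \<open>\<xi> = (\<dots>, \<xi>\<^sub>-\<^sub>1, \<xi>\<^sub>0)\<close> is encoded as a function \<open>x :: nat \<Rightarrow> 'e\<close> with
  \<open>x i = \<xi>\<^sub>-\<^sub>i\<close>; so \<open>x 0\<close> is the most recent state.  As \<open>K\<close> is compact, the product
  sigma-algebra below is the Borel sigma-algebra of the metric \<open>hist_dist\<close>.
\<close>

definition hist_space :: "'e::topological_space set \<Rightarrow> (nat \<Rightarrow> 'e) measure" where
  "hist_space K = PiM UNIV (\<lambda>_. state_space K)"

abbreviation histories :: "'e::topological_space set \<Rightarrow> (nat \<Rightarrow> 'e) set" where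
  "histories K \<equiv> (UNIV \<rightarrow> K)"

definition hist_dist ::
  "real \<Rightarrow> (nat \<Rightarrow> 'e::real_normed_vector) \<Rightarrow> (nat \<Rightarrow> 'e) \<Rightarrow> real" where
  "hist_dist \<alpha> x y = (\<Sum>i. \<alpha> ^ i * norm (x i - y i))"

definition transition_probability ::
  "'e::topological_space set \<Rightarrow> ((nat \<Rightarrow> 'e) \<Rightarrow> 'e measure) \<Rightarrow> bool" where
  "transition_probability K q \<longleftrightarrow> q \<in> hist_space K \<rightarrow>\<^sub>M prob_algebra (state_space K)"

definition var_dist :: "'a measure \<Rightarrow> 'a measure \<Rightarrow> real" where
  "var_dist \<mu> \<nu> = (SUP \<Gamma>\<in>sets \<mu>. \<bar>measure \<mu> \<Gamma> - measure \<nu> \<Gamma>\<bar>)"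

definition SF ::
  "'e::real_normed_vector set \<Rightarrow> real \<Rightarrow> (int \<Rightarrow> (nat \<Rightarrow> 'e) \<Rightarrow> 'e measure) \<Rightarrow> bool" where
  "SF K \<alpha> Q \<longleftrightarrow> (\<exists>C>0. \<forall>x\<in>histories K. \<forall>x'\<in>histories K. \<forall>l.
      var_dist (Q l x) (Q l x') \<le> C * hist_dist \<alpha> x x')"


text \<open>
  Future trajectories \<open>(y\<^sub>1, y\<^sub>2, \<dots>)\<close> are encoded as \<open>y :: nat \<Rightarrow> 'e\<close> with \<open>y i\<close> standing for
  \<open>y\<^sub>i\<^sub>+\<^sub>1\<close>.  Then \<open>extend_hist x j y\<close> is the history \<open>(\<xi>, y\<^sub>1, \<dots>, y\<^sub>j)\<close>.
\<close>

definition extend_hist :: "(nat \<Rightarrow> 'e) \<Rightarrow> nat \<Rightarrow> (nat \<Rightarrow> 'e) \<Rightarrow> (nat \<Rightarrow> 'e)" where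
  "extend_hist x j y = (\<lambda>i. if i < j then y (j - 1 - i) else x (i - j))"

definition step_kernel :: "(int \<Rightarrow> (nat \<Rightarrow> 'e) \<Rightarrow> 'e measure) \<Rightarrow> int \<Rightarrow> (nat \<Rightarrow> 'e)
    \<Rightarrow> nat \<Rightarrow> (nat \<Rightarrow> 'e) \<Rightarrow> 'e measure" where
  "step_kernel Q l x = (\<lambda>j y. Q (l + int j) (extend_hist x j y))"

text \<open>The measure \<open>\<P>\<^sub>l\<^sub>,\<^sub>\<xi>\<close>: the Ionescu-Tulcea measure of the kernels \<open>step_kernel Q l x\<close>.\<close>

definition future_law :: "'e::topological_space set \<Rightarrow> (int \<Rightarrow> (nat \<Rightarrow> 'e) \<Rightarrow> 'e measure)
    \<Rightarrow> int \<Rightarrow> (nat \<Rightarrow> 'e) \<Rightarrow> (nat \<Rightarrow> 'e) measure" where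
  "future_law K Q l x =
     projective_family.lim UNIV
       (Ionescu_Tulcea.CI (step_kernel Q l x) (\<lambda>_. state_space K)) (\<lambda>_. state_space K)"

lemma space_state_space [simp]: "space (state_space K) = K"
  by (simp add: state_space_def space_restrict_space)

lemma space_hist_space: "space (hist_space K) = histories K"
  by (auto simp: hist_space_def space_PiM)

text \<open>The hypotheses of the Ionescu-Tulcea theorem hold for the kernels used in \<open>future_law\<close>.\<close>

lemma Ionescu_Tulcea_step_kernel:
  assumes Q: "\<And>l. transition_probability K (Q l)" and x: "x \<in> histories K"
  shows "Ionescu_Tulcea (step_kernel Q l x) (\<lambda>_. state_space K)"
proof -
  have ext: "extend_hist x j \<in> PiM {0..<j} (\<lambda>_. state_space K) \<rightarrow>\<^sub>M hist_space K" for j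
    unfolding extend_hist_def hist_space_def
  proof (intro measurable_PiM_single')
    show "(\<lambda>y. if i < j then y (j - 1 - i) else x (i - j))
        \<in> PiM {0..<j} (\<lambda>_. state_space K) \<rightarrow>\<^sub>M state_space K" for i
      using x by (cases "i < j") (auto intro!: measurable_component_singleton measurable_const simp: Pi_iff)
  qed (use x in \<open>auto simp: space_PiM PiE_iff Pi_iff\<close>)
  have ker: "step_kernel Q l x j
      \<in> PiM {0..<j} (\<lambda>_. state_space K) \<rightarrow>\<^sub>M prob_algebra (state_space K)" for j
    unfolding step_kernel_def
    using measurable_compose[OF ext Q[unfolded transition_probability_def]] .
  have "prob_space (step_kernel Q l x j y)"
    if "y \<in> space (PiM {0..<j} (\<lambda>_. state_space K))" for j y
    using measurable_space[OF ker that] by (simp add: space_prob_algebra)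
  with measurable_prob_algebraD[OF ker] show ?thesis
    by (simp add: Ionescu_Tulcea_def)
qed

definition RZ :: "'e::real_normed_vector set \<Rightarrow> (int \<Rightarrow> (nat \<Rightarrow> 'e) \<Rightarrow> 'e measure) \<Rightarrow> bool" where
  "RZ K Q \<longleftrightarrow> (\<forall>(n::nat) \<delta>. \<delta> > 0 \<longrightarrow> (\<exists>s::nat.
      (INF l. INF x\<in>histories K. measure (future_law K Q l x)
        {y \<in> space (future_law K Q l x). \<forall>j\<in>{s+1..s+n}. norm (y (j - 1)) < \<delta>}) > 0))"


definition prod_space :: "'e::topological_space set \<Rightarrow> nat \<Rightarrow> (nat \<Rightarrow> 'e) measure" where
  "prod_space K s = PiM {..<s} (\<lambda>_. state_space K)"

text \<open>
  The metric on \<open>K\<^sup>s\<close> is the sum of the coordinate distances.  It dominates the maximum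
  and Euclidean metrics, so it admits the most functions of Lipschitz constant at most 1.
\<close>

definition product_metric :: "nat \<Rightarrow> (nat \<Rightarrow> 'e::real_normed_vector) \<Rightarrow> (nat \<Rightarrow> 'e) \<Rightarrow> real" where
  "product_metric s u v = (\<Sum>i<s. norm (u i - v i))"

definition sup_norm :: "'a set \<Rightarrow> ('a \<Rightarrow> real) \<Rightarrow> ennreal" where
  "sup_norm X f = (SUP u\<in>X. ennreal \<bar>f u\<bar>)"

text \<open>The pairs with \<open>u = v\<close> contribute \<open>0 / 0 = 0\<close>.\<close>

definition Lip :: "'a set \<Rightarrow> ('a \<Rightarrow> 'a \<Rightarrow> real) \<Rightarrow> ('a \<Rightarrow> real) \<Rightarrow> ennreal" where
  "Lip X d f = (SUP u\<in>X. SUP v\<in>X. ennreal (\<bar>f u - f v\<bar> / d u v))"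

definition dual_Lip_dist ::
  "('a \<Rightarrow> 'a \<Rightarrow> real) \<Rightarrow> 'a measure \<Rightarrow> 'a measure \<Rightarrow> real" where
  "dual_Lip_dist d \<mu> \<nu> =
     (SUP f\<in>{f. sup_norm (space \<mu>) f + Lip (space \<mu>) d f \<le> 1}.
        \<bar>integral\<^sup>L \<mu> f - integral\<^sup>L \<nu> f\<bar>)"


definition history :: "(int \<Rightarrow> 'w \<Rightarrow> 'e) \<Rightarrow> int \<Rightarrow> 'w \<Rightarrow> (nat \<Rightarrow> 'e)" where
  "history \<xi> k w = (\<lambda>i. \<xi> (k - int i) w)"

text \<open>\<open>block \<xi> a s\<close> is the random vector \<open>(\<xi>\<^sub>a, \<dots>, \<xi>\<^sub>a\<^sub>+\<^sub>s\<^sub>-\<^sub>1)\<close> with values in \<open>K\<^sup>s\<close>.\<close>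

definition block :: "(int \<Rightarrow> 'w \<Rightarrow> 'e) \<Rightarrow> int \<Rightarrow> nat \<Rightarrow> 'w \<Rightarrow> (nat \<Rightarrow> 'e)" where
  "block \<xi> a s w = (\<lambda>i\<in>{..<s}. \<xi> (a + int i) w)"

definition random_process ::
  "'e::topological_space set \<Rightarrow> 'w measure \<Rightarrow> (int \<Rightarrow> 'w \<Rightarrow> 'e) \<Rightarrow> bool" where
  "random_process K M \<xi> \<longleftrightarrow> prob_space M \<and> (\<forall>k. \<xi> k \<in> M \<rightarrow>\<^sub>M state_space K)"

definition process_law ::
  "'e::topological_space set \<Rightarrow> 'w measure \<Rightarrow> (int \<Rightarrow> 'w \<Rightarrow> 'e) \<Rightarrow> (int \<Rightarrow> 'e) measure" where
  "process_law K M \<xi> = distr M (PiM UNIV (\<lambda>_. state_space K)) (\<lambda>w k. \<xi> k w)"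

text \<open>
  The regular conditional distribution of \<open>\<xi>\<^sub>k\<^sub>+\<^sub>1\<close> given the history up to time \<open>k\<close> is
  \<open>Q\<^sub>k\<close> evaluated at this history, for every \<open>k\<close>.
\<close>

definition has_transitions :: "'e::topological_space set \<Rightarrow> (int \<Rightarrow> (nat \<Rightarrow> 'e) \<Rightarrow> 'e measure)
    \<Rightarrow> 'w measure \<Rightarrow> (int \<Rightarrow> 'w \<Rightarrow> 'e) \<Rightarrow> bool" where
  "has_transitions K Q M \<xi> \<longleftrightarrow> (\<forall>k. \<forall>\<Gamma>\<in>sets (state_space K).
     AE w in M.
       real_cond_exp M (vimage_algebra (space M) (history \<xi> k) (hist_space K))
         (\<lambda>w. indicator \<Gamma> (\<xi> (k + 1) w)) w
       = measure (Q k (history \<xi> k w)) \<Gamma>)"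

text \<open>
  \<open>D((\<xi>\<^sub>\<tau>\<^sub>+\<^sub>k\<^sub>+\<^sub>1, \<dots>, \<xi>\<^sub>\<tau>\<^sub>+\<^sub>k\<^sub>+\<^sub>s) | history at \<tau> = x)\<close>, as the law of
  \<open>(y\<^sub>k\<^sub>+\<^sub>1, \<dots>, y\<^sub>k\<^sub>+\<^sub>s)\<close> under \<open>future_law K Q \<tau> x\<close>.
\<close>

definition cond_block_law :: "'e::topological_space set \<Rightarrow> (int \<Rightarrow> (nat \<Rightarrow> 'e) \<Rightarrow> 'e measure)
    \<Rightarrow> int \<Rightarrow> (nat \<Rightarrow> 'e) \<Rightarrow> nat \<Rightarrow> nat \<Rightarrow> (nat \<Rightarrow> 'e) measure" where
  "cond_block_law K Q \<tau> x k s =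
     distr (future_law K Q \<tau> x) (prod_space K s) (\<lambda>y. \<lambda>i\<in>{..<s}. y (k + i))"

definition block_law :: "'e::topological_space set \<Rightarrow> 'w measure \<Rightarrow> (int \<Rightarrow> 'w \<Rightarrow> 'e)
    \<Rightarrow> int \<Rightarrow> nat \<Rightarrow> (nat \<Rightarrow> 'e) measure" where
  "block_law K M \<xi> a s = distr M (prod_space K s) (block \<xi> a s)"

end

theory Submission
  imports Defs
begin

text \<open>
  Let \<open>osc\<close> and \<open>Lip\<close> denote the oscillation and the Lipschitz constant of a function of the
  history, and \<open>P\<close> the transition operator \<open>P h (\<xi>) = \<integral> h (\<xi>, y) Q (\<xi>; dy)\<close>.  Shifting the history contracts the
  metric by \<open>\<alpha>\<close>, so (SF) yields \<open>Lip (P h) \<le> \<alpha> Lip h + C osc h\<close>.  By (RZ), two independent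
  trajectories come simultaneously close to the constant history \<open>0\<close> with probability bounded below by some \<open>q > 0\<close>,
  whence \<open>osc (P\<^sup>m h) \<le> (1 - q) osc h + q \<epsilon> Lip h\<close>, where \<open>\<epsilon>\<close> can be fixed before \<open>q\<close> is known.
  The two bounds make \<open>osc + \<beta> Lip\<close> contract for a suitable \<open>\<beta>\<close>, hence the dependence on the
  initial history is forgotten exponentially fast, uniformly in time.  The process is the limit of
  the processes started at time \<open>-n\<close> from the history \<open>0\<close>: since \<open>P\<^sup>s\<close> makes every bounded function
  of the last \<open>s\<close> states Lipschitz, their finite-dimensional laws converge in variation, and
  Kolmogorov's theorem assembles the limits.  Uniqueness and mixing follow by conditioning on a
  remote history.
\<close>

text \<open>The two inequalities feed each other: (SF) turns oscillation into Lipschitz constant,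
  and closeness to 0 turns Lipschitz constant into oscillation. Repeated use of (SF) costs only
  \<open>L0 = C / (1 - \<alpha>)\<close>, whatever the number of steps. In osc + beta Lip one wants
  beta \<open>L0\<close> smaller than q and q epsilon smaller than beta, so only the product epsilon
  \<open>L0\<close> has to be small. This frees epsilon from q and allows the order: epsilon, then
  radius and window of the neighbourhood of 0, then m and q from (RZ). The variation distance in
  (SF) matters twice. It controls integrals of all bounded measurable functions by their
  oscillation, so indicators of cylinder events are admissible test functions; and it gives
  convergence uniform over the events of finitely many times, so the limits are countably additive
  without a tightness argument. For the limit process, the transition identity is an obstacle: even
  if h depends on finitely many states, P h depends on the whole past. The exponential weights of
  the metric make the remote past negligible, so the limit extends to such functions.\<close>

subsection \<open>Integrals and the variation distance\<close>

text \<open>Layer-cake approximation: f is within 1/m of the average of the indicators of m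
  superlevel sets, and on each of these sets the measures differ by at most v. Letting m grow gives
  the constant 1 in front of v.\<close>

lemma integral_unit_diff_le:
  fixes f :: "'a \<Rightarrow> real"
  assumes "prob_space M" "prob_space N" and sets: "sets N = sets M"
    and f[measurable]: "f \<in> borel_measurable M"
    and f01: "\<And>x. x \<in> space M \<Longrightarrow> 0 \<le> f x \<and> f x \<le> 1"
    and v: "\<And>A. A \<in> sets M \<Longrightarrow> \<bar>measure M A - measure N A\<bar> \<le> v"
  shows "\<bar>integral\<^sup>L M f - integral\<^sup>L N f\<bar> \<le> v"
proof -
  interpret M: prob_space M by fact
  interpret N: prob_space N by fact
  have space: "space N = space M" using sets by (rule sets_eq_imp_space_eq)
  have mN: "f \<in> borel_measurable N" using f sets by (simp cong: measurable_cong_sets)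
  have approx: "\<bar>integral\<^sup>L M f - integral\<^sup>L N f\<bar> \<le> v + 2 * (1 / real (Suc n))" for n
  proof -
    define m where "m = Suc n"
    define A where "A i = {x \<in> space M. real (Suc i) \<le> real m * f x}" for i
    have A[measurable]: "A i \<in> sets M" for i unfolding A_def by measurable
    have A': "A i \<in> sets N" for i using A sets by simp
    define g where "g x = (\<Sum>i<m. indicator (A i) x / real m)" for x
    have gM[measurable]: "g \<in> borel_measurable M" unfolding g_def by measurable
    have gN: "g \<in> borel_measurable N" using gM sets by (simp cong: measurable_cong_sets)
    \<comment> \<open>A point lies in exactly the first \<open>k\<close> superlevel sets, k being
      the floor of m f x; hence g x = k/m is f x rounded down to the grid.\<close>
    have g: "g x \<le> f x \<and> f x \<le> g x + 1 / real m" if x: "x \<in> space M" for x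
    proof -
      define k where "k = nat \<lfloor>real m * f x\<rfloor>"
      have nonneg: "0 \<le> real m * f x" using f01[OF x] by simp
      have "real m * f x \<le> real m * 1" using f01[OF x] by (intro mult_left_mono) auto
      then have km: "k \<le> m" unfolding k_def using nonneg by linarith
      have "(i < m \<and> x \<in> A i) = (i < k)" for i
        using km x nonneg unfolding A_def k_def by (auto simp: le_nat_floor) linarith+
      then have "{i\<in>{..<m}. x \<in> A i} = {..<k}" by auto
      then have "g x = real k / real m"
        by (simp add: g_def indicator_def sum_divide_distrib[symmetric] sum.If_cases Int_def)
      moreover have "real k \<le> real m * f x" "real m * f x \<le> real k + 1"
        unfolding k_def using nonneg by linarith+
      moreover have "real m > 0" by (simp add: m_def)
      ultimately have "real m * g x \<le> real m * f x" "real m * f x \<le> real m * (g x + 1 / real m)"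
        by (simp_all add: distrib_left)
      then show ?thesis using \<open>real m > 0\<close> by (simp only: mult_le_cancel_left_pos)
    qed
    have iM: "integral\<^sup>L M g = (\<Sum>i<m. measure M (A i) / real m)"
      unfolding g_def by (subst Bochner_Integration.integral_sum) (auto simp: M.emeasure_eq_measure)
    have iN: "integral\<^sup>L N g = (\<Sum>i<m. measure N (A i) / real m)"
      unfolding g_def using A' sets.sets_into_space[OF A]
      by (subst Bochner_Integration.integral_sum)
        (auto simp: N.emeasure_eq_measure space Int_absorb2)
    have "\<bar>integral\<^sup>L M g - integral\<^sup>L N g\<bar> \<le> (\<Sum>i<m. \<bar>measure M (A i) / real m - measure N (A i) / real m\<bar>)"
      unfolding iM iN sum_subtractf[symmetric] by (rule sum_abs)
    also have "\<dots> \<le> (\<Sum>i<m. v / real m)"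
      using v[OF A] by (intro sum_mono) (simp add: diff_divide_distrib[symmetric] divide_right_mono)
    also have "\<dots> = v" by (simp add: m_def)
    finally have 1: "\<bar>integral\<^sup>L M g - integral\<^sup>L N g\<bar> \<le> v" .
    have close: "\<bar>integral\<^sup>L P f - integral\<^sup>L P g\<bar> \<le> 1 / real m"
      if "prob_space P" and sp: "space P = space M" and fP: "f \<in> borel_measurable P" and gP: "g \<in> borel_measurable P" for P
    proof -
      interpret P: prob_space P by fact
      have bnd: "\<bar>f x\<bar> \<le> 1" "\<bar>g x\<bar> \<le> 2" if "x \<in> space P" for x
      proof -
        have x: "x \<in> space M" using that sp by simp
        have "0 \<le> g x" unfolding g_def by (intro sum_nonneg) auto
        then show "\<bar>f x\<bar> \<le> 1" "\<bar>g x\<bar> \<le> 2" using f01[OF x] g[OF x] by auto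
      qed
      have int: "integrable P f" "integrable P g"
        using bnd fP gP by (auto intro!: P.integrable_const_bound[where B=2] AE_I2 intro: order_trans)
          fastforce
      have "integral\<^sup>L P g \<le> integral\<^sup>L P f"
        using g sp by (intro integral_mono int) auto
      moreover have "integral\<^sup>L P f \<le> integral\<^sup>L P (\<lambda>x. g x + 1 / real m)"
        using g sp by (intro integral_mono int Bochner_Integration.integrable_add) auto
      moreover have "integral\<^sup>L P (\<lambda>x. g x + 1 / real m) = integral\<^sup>L P g + 1 / real m"
        using int by (simp add: P.prob_space)
      ultimately show ?thesis by linarith
    qed
    show ?thesis
      using 1 close[OF assms(1) refl f gM] close[OF assms(2) space mN gN] unfolding m_def by linarith
  qed
  have "(\<lambda>n. v + 2 * (1 / real (Suc n))) \<longlonglongrightarrow> v + 2 * 0"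
    by (intro tendsto_intros LIMSEQ_Suc[OF lim_1_over_n])
  from LIMSEQ_le_const[OF this] approx show ?thesis by auto
qed

text \<open>Subtracting the infimum changes both integrals equally, the measures being
  probabilities; what remains is rescaled to values in [0,1]. Hence the oscillation, and not the
  supremum norm, is the factor.\<close>

lemma integral_diff_le_osc:
  fixes f :: "'a \<Rightarrow> real"
  assumes "prob_space M" "prob_space N" and sets: "sets N = sets M"
    and f: "f \<in> borel_measurable M"
    and osc: "\<And>x y. x \<in> space M \<Longrightarrow> y \<in> space M \<Longrightarrow> \<bar>f x - f y\<bar> \<le> b"
    and v: "\<And>A. A \<in> sets M \<Longrightarrow> \<bar>measure M A - measure N A\<bar> \<le> v"
  shows "\<bar>integral\<^sup>L M f - integral\<^sup>L N f\<bar> \<le> b * v"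
proof -
  interpret M: prob_space M by fact
  interpret N: prob_space N by fact
  have space: "space N = space M" using sets by (rule sets_eq_imp_space_eq)
  have mN: "f \<in> borel_measurable N" using f sets by (simp cong: measurable_cong_sets)
  obtain x0 where x0: "x0 \<in> space M" using M.not_empty by auto
  have b0: "0 \<le> b" using osc[OF x0 x0] by simp
  have v0: "0 \<le> v" using v[OF sets.empty_sets] by simp
  define a where "a = (INF x\<in>space M. f x)"
  have bdd: "bdd_below (f ` space M)"
    using osc[OF _ x0] by (intro bdd_belowI2[where m="f x0 - b"]) (smt (verit))
  have a: "a \<le> f x" if "x \<in> space M" for x
    unfolding a_def using bdd that by (rule cINF_lower)
  have "f x - b \<le> a" if "x \<in> space M" for x
    unfolding a_def using osc[OF that] by (intro cINF_greatest M.not_empty) (smt (verit))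
  then have ab: "f x \<le> a + b" if "x \<in> space M" for x using that by fastforce
  have bound: "\<bar>f x\<bar> \<le> \<bar>a\<bar> + b" if "x \<in> space M" for x using a[OF that] ab[OF that] b0 by auto
  have int: "integrable M f" "integrable N f"
    using bound space f mN
    by (auto intro!: M.integrable_const_bound[where B="\<bar>a\<bar> + b"] N.integrable_const_bound[where B="\<bar>a\<bar> + b"])
  have "\<bar>integral\<^sup>L M f - integral\<^sup>L N f\<bar> \<le> b * v + e" if e: "e > 0" for e
  proof -
    \<comment> \<open>The oscillation bound \<open>b\<close> may be 0, so the division is by a
      slightly larger number; the excess contributes at most e after multiplication by v.\<close>
    define c where "c = b + e / (v + 1)"
    have c: "c > 0" "b \<le> c" unfolding c_def using b0 v0 e by (auto simp: add_nonneg_pos)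
    define g where "g x = (f x - a) / c" for x
    have "0 \<le> g x \<and> g x \<le> 1" if "x \<in> space M" for x
      using a[OF that] ab[OF that] c by (simp add: g_def)
    moreover have "g \<in> borel_measurable M" using f unfolding g_def by measurable
    ultimately have "\<bar>integral\<^sup>L M g - integral\<^sup>L N g\<bar> \<le> v"
      by (intro integral_unit_diff_le[OF assms(1-3) _ _ v])
    moreover have "integral\<^sup>L M g - integral\<^sup>L N g = (integral\<^sup>L M f - integral\<^sup>L N f) / c"
      unfolding g_def using int by (simp add: M.prob_space N.prob_space diff_divide_distrib)
    ultimately have "\<bar>integral\<^sup>L M f - integral\<^sup>L N f\<bar> \<le> c * v"
      using c by (simp add: field_simps)
    also have "c * v = b * v + e * (v / (v + 1))" by (simp add: c_def algebra_simps)
    also have "\<dots> \<le> b * v + e * 1"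
      using e v0 by (intro add_left_mono mult_left_mono) auto
    finally show ?thesis by simp
  qed
  then show ?thesis by (rule field_le_epsilon)
qed

lemma (in prob_space) integral_between:
  fixes f :: "'a \<Rightarrow> real"
  assumes "f \<in> borel_measurable M" "\<And>x. x \<in> space M \<Longrightarrow> a \<le> f x" "\<And>x. x \<in> space M \<Longrightarrow> f x \<le> b"
  shows "a \<le> integral\<^sup>L M f" "integral\<^sup>L M f \<le> b" "integrable M f"
proof -
  show int: "integrable M f"
    using assms by (intro integrable_const_bound[where B="max \<bar>a\<bar> \<bar>b\<bar>"]) (auto intro!: AE_I2, fastforce)
  show "a \<le> integral\<^sup>L M f" "integral\<^sup>L M f \<le> b"
    using assms by (auto intro!: integral_ge_const integral_le_const int)
qed

lemma (in prob_space) abs_integral_le: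
  fixes f :: "'a \<Rightarrow> real"
  assumes "f \<in> borel_measurable M" "\<And>x. x \<in> space M \<Longrightarrow> \<bar>f x\<bar> \<le> b"
  shows "\<bar>integral\<^sup>L M f\<bar> \<le> b"
proof -
  have "-b \<le> f x" "f x \<le> b" if "x \<in> space M" for x using assms(2)[OF that] by auto
  from integral_between(1,2)[OF assms(1) this] show ?thesis by auto
qed

text \<open>The bound holds for every pair of points, so v can be averaged out for fixed u, and then
  u. The functions may live on different spaces, as for the two processes in
  \<open>expectation_unique\<close>.\<close>

lemma integral_diff_le_pairwise:
  fixes f g :: "_ \<Rightarrow> real"
  assumes "prob_space M" "prob_space N"
    and f: "f \<in> borel_measurable M" and g: "g \<in> borel_measurable N"
    and fg: "\<And>u v. u \<in> space M \<Longrightarrow> v \<in> space N \<Longrightarrow> \<bar>f u - g v\<bar> \<le> b"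
  shows "\<bar>integral\<^sup>L M f - integral\<^sup>L N g\<bar> \<le> b"
proof -
  interpret M: prob_space M by fact
  interpret N: prob_space N by fact
  have "integral\<^sup>L N g - b \<le> f u \<and> f u \<le> integral\<^sup>L N g + b" if u: "u \<in> space M" for u
  proof -
    have "f u - b \<le> g v" "g v \<le> f u + b" if "v \<in> space N" for v using fg[OF u that] by auto
    from N.integral_between(1,2)[OF g this] show ?thesis by auto
  qed
  then have "integral\<^sup>L N g - b \<le> integral\<^sup>L M f" "integral\<^sup>L M f \<le> integral\<^sup>L N g + b"
    using M.integral_between(1,2)[OF f] by blast+
  then show ?thesis by auto
qed

text \<open>Doeblin's argument, with two independent samples in place of a coupling.\<close>

lemma integral_diff_le_minorized:
  fixes h :: "'a \<Rightarrow> real"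
  assumes M: "prob_space M" and N: "prob_space N" and sets: "sets N = sets M"
    and h: "h \<in> borel_measurable M"
    and B: "B \<in> sets M" "p \<le> measure M B" "p \<le> measure N B" "0 \<le> p"
    and osc: "\<And>u v. u \<in> space M \<Longrightarrow> v \<in> space M \<Longrightarrow> \<bar>h u - h v\<bar> \<le> b"
    and oscB: "\<And>u v. u \<in> B \<Longrightarrow> v \<in> B \<Longrightarrow> \<bar>h u - h v\<bar> \<le> c" and cb: "c \<le> b"
  shows "\<bar>integral\<^sup>L M h - integral\<^sup>L N h\<bar> \<le> b - (b - c) * p\<^sup>2"
proof -
  have *: "integral\<^sup>L M h - integral\<^sup>L N h \<le> b - (b - c) * p\<^sup>2"
    if M: "prob_space M" and N: "prob_space N" and sets: "sets N = sets M"
    and h: "h \<in> borel_measurable M"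
    and B: "B \<in> sets M" "p \<le> measure M B" "p \<le> measure N B"
    and osc: "\<And>u v. u \<in> space M \<Longrightarrow> v \<in> space M \<Longrightarrow> \<bar>h u - h v\<bar> \<le> b" for M N
  proof -
    interpret M: prob_space M by fact
    interpret N: prob_space N by fact
    have space: "space N = space M" using sets by (rule sets_eq_imp_space_eq)
    have hN: "h \<in> borel_measurable N" using h sets by (simp cong: measurable_cong_sets)
    obtain u0 where u0: "u0 \<in> space M" using M.not_empty by auto
    have bnd: "h u0 - b \<le> h u" "h u \<le> h u0 + b" if "u \<in> space M" for u
      using osc[OF u0 that] by auto
    have intM: "integrable M h" using M.integral_between(3)[OF h bnd] .
    have intN: "integrable N h" using N.integral_between(3)[OF hN] bnd space by metis
    have BN: "B \<in> sets N" using B sets by simp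
    \<comment> \<open>Only when both samples fall into \<open>B\<close> does the bound improve from
      b to c. Averaging over v yields one factor p here, averaging over u the second one below; b -
      c is nonnegative, so p may replace the true probabilities.\<close>
    have 1: "h u - integral\<^sup>L N h \<le> b - (b - c) * p * indicator B u" if u: "u \<in> space M" for u
    proof -
      have "integral\<^sup>L N (\<lambda>v. h u - h v) \<le> integral\<^sup>L N (\<lambda>v. b - (b - c) * indicator B u * indicator B v)"
      proof (rule integral_mono)
        fix v assume "v \<in> space N"
        then show "h u - h v \<le> b - (b - c) * indicator B u * indicator B v"
          using osc[OF u, of v] oscB[of u v] space by (auto simp: indicator_def abs_le_iff)
      qed (use BN intN in \<open>auto simp: N.emeasure_eq_measure\<close>)
      moreover have "integral\<^sup>L N (\<lambda>v. h u - h v) = h u - integral\<^sup>L N h"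
        using intN by (simp add: N.prob_space)
      moreover have "integral\<^sup>L N (\<lambda>v. b - (b - c) * indicator B u * indicator B v) = b - (b - c) * indicator B u * measure N B"
        using BN sets.sets_into_space[OF BN] by (simp add: N.prob_space N.emeasure_eq_measure Int_absorb2)
      moreover have "(b - c) * indicator B u * p \<le> (b - c) * indicator B u * measure N B"
        using B(3) cb by (intro mult_left_mono) auto
      ultimately show ?thesis by (simp add: mult_ac)
    qed
    have "integral\<^sup>L M (\<lambda>u. h u - integral\<^sup>L N h) \<le> integral\<^sup>L M (\<lambda>u. b - (b - c) * p * indicator B u)"
      using 1 B intM by (intro integral_mono) (auto simp: M.emeasure_eq_measure)
    moreover have "integral\<^sup>L M (\<lambda>u. h u - integral\<^sup>L N h) = integral\<^sup>L M h - integral\<^sup>L N h"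
      using intM by (simp add: M.prob_space)
    moreover have "integral\<^sup>L M (\<lambda>u. b - (b - c) * p * indicator B u) = b - (b - c) * p * measure M B"
      using B sets.sets_into_space[OF B(1)] by (simp add: M.prob_space M.emeasure_eq_measure Int_absorb2)
    moreover have "(b - c) * p * p \<le> (b - c) * p * measure M B"
      using B \<open>0 \<le> p\<close> cb by (intro mult_left_mono) auto
    ultimately show ?thesis by (simp add: power2_eq_square mult_ac)
  qed
  have space: "space N = space M" using sets by (rule sets_eq_imp_space_eq)
  have "integral\<^sup>L N h - integral\<^sup>L M h \<le> b - (b - c) * p\<^sup>2"
    using sets h B osc by (intro *[OF N M]) (simp_all add: space cong: measurable_cong_sets)
  moreover have "integral\<^sup>L M h - integral\<^sup>L N h \<le> b - (b - c) * p\<^sup>2"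
    using sets h B osc by (intro *[OF M N]) simp_all
  ultimately show ?thesis by auto
qed

subsection \<open>Projective limits of processes\<close>

text \<open>The Daniell-Kolmogorov theorem is only available for the class \<open>polish_space\<close>.  A type that is
  complete and second countable need not be an instance of that class, but its copy is.\<close>

typedef 'a polish_copy = "UNIV :: 'a set"
  morphisms of_copy to_copy by simp

lemma of_to_copy [simp]: "of_copy (to_copy x) = x" by (simp add: to_copy_inverse)
lemma to_of_copy [simp]: "to_copy (of_copy x) = x" by (rule of_copy_inverse)

instantiation polish_copy :: (metric_space) metric_space
begin

definition "dist x y = dist (of_copy x) (of_copy y)"
definition "uniformity = (INF e\<in>{0<..}. principal {(x :: 'a polish_copy, y). dist x y < e})"
definition "open U = (\<forall>x\<in>U. \<forall>\<^sub>F (x', y) in uniformity. x' = (x :: 'a polish_copy) \<longrightarrow> y \<in> U)"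

instance
proof
  show "dist x y = 0 \<longleftrightarrow> x = y" for x y :: "'a polish_copy"
    by (simp add: dist_polish_copy_def of_copy_inject)
  show "dist x y \<le> dist x z + dist y z" for x y z :: "'a polish_copy"
    by (simp add: dist_polish_copy_def dist_triangle2)
qed (simp_all add: uniformity_polish_copy_def open_polish_copy_def)

end

lemma continuous_on_to_copy: "continuous_on A to_copy"
  by (auto simp: continuous_on_iff dist_polish_copy_def)

lemma continuous_on_of_copy: "continuous_on A of_copy"
  by (auto simp: continuous_on_iff dist_polish_copy_def)

instance polish_copy :: (complete_space) complete_space
proof
  fix X :: "nat \<Rightarrow> 'a polish_copy" assume "Cauchy X"
  then have "Cauchy (\<lambda>n. of_copy (X n))" by (simp add: Cauchy_def dist_polish_copy_def)
  then obtain l where "(\<lambda>n. of_copy (X n)) \<longlonglongrightarrow> l" using Cauchy_convergent convergent_def by blast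
  then have "X \<longlonglongrightarrow> to_copy l" by (simp add: lim_sequentially dist_polish_copy_def)
  then show "convergent X" by (rule convergentI)
qed

instance polish_copy :: ("{metric_space, second_countable_topology}") second_countable_topology
proof
  obtain B :: "'a set set" where B: "countable B" "topological_basis B"
    using ex_countable_basis by blast
  let ?B = "(\<lambda>U. of_copy -` U) ` B"
  have "topological_basis ?B"
  proof (rule topological_basisI)
    show "open U" if "U \<in> ?B" for U
      using that topological_basis_open[OF B(2)] continuous_on_of_copy[of UNIV]
      by (auto simp: continuous_on_open_vimage)
    fix U :: "'a polish_copy set" and x assume "open U" "x \<in> U"
    then have "open (to_copy -` U)" "of_copy x \<in> to_copy -` U"
      using continuous_on_to_copy[of UNIV] by (auto simp: continuous_on_open_vimage)
    then obtain V where V: "V \<in> B" "of_copy x \<in> V" "V \<subseteq> to_copy -` U"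
      using B(2) topological_basisE by blast
    have "y \<in> U" if "of_copy y \<in> V" for y
      using subsetD[OF V(3) that] by simp
    with V show "\<exists>V\<in>?B. x \<in> V \<and> V \<subseteq> U"
      by (intro bexI[of _ "of_copy -` V"]) auto
  qed
  then have "open = generate_topology ?B" by (rule topological_basis_imp_subbasis)
  moreover have "countable ?B" using B(1) by (rule countable_image)
  ultimately show "\<exists>B::'a polish_copy set set. countable B \<and> open = generate_topology B"
    by blast
qed

instance polish_copy :: ("{complete_space, second_countable_topology}") polish_space ..

section \<open>Limits that are uniform on events of finitely many coordinates\<close>

lemma prod_emb_eq_restrict_vimage:
  "prod_emb I M J X = (\<lambda>f. restrict f J) -` X \<inter> space (PiM I M)"
  by (simp add: prod_emb_def space_PiM)

text \<open>Uniformity over the events puts the limit set function within e of a single measure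
  \<open>N n\<close> on all sets at once. Continuity at the empty set, and with it countable
  additivity, is inherited from that measure.\<close>

lemma prob_space_uniform_limit:
  fixes N :: "nat \<Rightarrow> 'a measure"
  assumes prob: "\<And>n. prob_space (N n)" and sets: "\<And>n. sets (N n) = sets M"
    and cauchy: "\<And>e. e > 0 \<Longrightarrow> \<exists>n0. \<forall>m\<ge>n0. \<forall>n\<ge>n0. \<forall>A\<in>sets M. \<bar>measure (N m) A - measure (N n) A\<bar> < e"
  obtains P where "prob_space P" "sets P = sets M"
    "\<And>A. A \<in> sets M \<Longrightarrow> (\<lambda>n. measure (N n) A) \<longlonglongrightarrow> measure P A"
proof -
  interpret N: prob_space "N n" for n by fact
  define p where "p A = lim (\<lambda>n. measure (N n) A)" for A
  have p: "(\<lambda>n. measure (N n) A) \<longlonglongrightarrow> p A" if "A \<in> sets M" for A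
  proof -
    have "Cauchy (\<lambda>n. measure (N n) A)"
      unfolding Cauchy_def dist_real_def using cauchy that by meson
    then show ?thesis unfolding p_def using Cauchy_convergent convergent_LIMSEQ_iff by blast
  qed
  have p0: "0 \<le> p A" if "A \<in> sets M" for A
    using LIMSEQ_le_const[OF p[OF that], of 0] by auto
  have uniform: "\<exists>n. \<forall>A\<in>sets M. p A \<le> measure (N n) A + e" if e: "e > 0" for e
  proof -
    obtain n0 where n0: "\<forall>m\<ge>n0. \<forall>n\<ge>n0. \<forall>A\<in>sets M. \<bar>measure (N m) A - measure (N n) A\<bar> < e"
      using cauchy e by blast
    have "p A \<le> measure (N n0) A + e" if A: "A \<in> sets M" for A
      using n0 A by (intro LIMSEQ_le_const2[OF p[OF A]] exI[of _ n0]) (force simp: abs_less_iff)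
    then show ?thesis by blast
  qed
  let ?f = "\<lambda>A. ennreal (p A)"
  have pos: "positive (sets M) ?f" by (simp add: positive_def p_def)
  have add: "additive (sets M) ?f"
    unfolding additive_def
  proof (intro ballI impI)
    fix A B assume AB: "A \<in> sets M" "B \<in> sets M" "A \<inter> B = {}"
    have "(\<lambda>n. measure (N n) (A \<union> B)) \<longlonglongrightarrow> p A + p B"
      using tendsto_add[OF p[OF AB(1)] p[OF AB(2)]] AB sets
      by (subst N.finite_measure_Union) auto
    from LIMSEQ_unique[OF p this] AB have "p (A \<union> B) = p A + p B" by auto
    then show "?f (A \<union> B) = ?f A + ?f B" using AB p0 by (simp add: ennreal_plus)
  qed
  have cont: "(\<lambda>i. ?f (A i)) \<longlonglongrightarrow> 0" if A: "range A \<subseteq> sets M" "decseq A" "(\<Inter>i. A i) = {}" for A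
  proof -
    have "(\<lambda>i. p (A i)) \<longlonglongrightarrow> 0"
    proof (rule LIMSEQ_I)
      fix r :: real assume "0 < r"
      then obtain n where n: "\<forall>A\<in>sets M. p A \<le> measure (N n) A + r / 2"
        using uniform[of "r/2"] by auto
      have "(\<lambda>i. measure (N n) (A i)) \<longlonglongrightarrow> measure (N n) (\<Inter>i. A i)"
        using A sets by (intro N.finite_Lim_measure_decseq) auto
      then have "(\<lambda>i. measure (N n) (A i)) \<longlonglongrightarrow> 0" using A(3) by simp
      from LIMSEQ_D[OF this, of "r/2"] \<open>0 < r\<close> obtain i0 where "\<forall>i\<ge>i0. measure (N n) (A i) < r / 2"
        by auto
      then have "\<forall>i\<ge>i0. norm (p (A i) - 0) < r"
        using n A(1) p0 by (smt (verit) real_norm_def field_sum_of_halves range_subsetD)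
      then show "\<exists>no. \<forall>i\<ge>no. norm (p (A i) - 0) < r" by blast
    qed
    then show ?thesis using tendsto_ennrealI by fastforce
  qed
  have ca: "countably_additive (sets M) ?f"
    by (rule sets.empty_continuous_imp_countably_additive[OF pos add _ cont]) auto
  define P where "P = measure_of (space M) (sets M) ?f"
  have setsP: "sets P = sets M" and spaceP: "space P = space M" by (simp_all add: P_def)
  have emP: "emeasure P A = ?f A" if "A \<in> sets M" for A
    using emeasure_measure_of_sigma[OF sets.sigma_algebra_axioms pos ca that] by (simp add: P_def)
  have mP: "measure P A = p A" if "A \<in> sets M" for A
    using emP[OF that] p0[OF that] by (simp add: measure_def)
  have "space (N n) = space M" for n using sets by (rule sets_eq_imp_space_eq)
  then have "(\<lambda>n. measure (N n) (space M)) \<longlonglongrightarrow> 1" using N.prob_space by simp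
  then have "p (space M) = 1" using LIMSEQ_unique p by blast
  then have "prob_space P" by (intro prob_spaceI) (simp add: spaceP emP)
  with setsP mP p that show thesis by metis
qed

text \<open>Uniformity is available only for a fixed finite \<open>J\<close>, so limits are formed
  for each finite-dimensional marginal separately. They are consistent because the marginals of each
  \<open>N n\<close> are, and the Daniell-Kolmogorov theorem glues them.\<close>

lemma uniform_limit_polish:
  fixes N :: "nat \<Rightarrow> ('i \<Rightarrow> 'a::polish_space) measure"
  assumes prob: "\<And>n. prob_space (N n)" and sets: "\<And>n. sets (N n) = sets (PiM UNIV (\<lambda>_. borel))"
    and cauchy: "\<And>J e. finite J \<Longrightarrow> e > 0 \<Longrightarrow> \<exists>n0. \<forall>m\<ge>n0. \<forall>n\<ge>n0. \<forall>A\<in>sets (PiM J (\<lambda>_. borel)).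
      \<bar>measure (N m) (prod_emb UNIV (\<lambda>_. borel) J A) - measure (N n) (prod_emb UNIV (\<lambda>_. borel) J A)\<bar> < e"
  obtains P where "prob_space P" "sets P = sets (PiM UNIV (\<lambda>_. borel))"
    "\<And>J A. finite J \<Longrightarrow> A \<in> sets (PiM J (\<lambda>_. borel)) \<Longrightarrow>
      (\<lambda>n. measure (N n) (prod_emb UNIV (\<lambda>_. borel) J A)) \<longlonglongrightarrow> measure P (prod_emb UNIV (\<lambda>_. borel) J A)"
proof -
  let ?B = "\<lambda>_. borel :: 'a measure"
  have space: "space (N n) = UNIV" for n using sets_eq_imp_space_eq[OF sets, of n] by (simp add: space_PiM)
  have restr[measurable]: "(\<lambda>f. restrict f J) \<in> N n \<rightarrow>\<^sub>M PiM J ?B" for n J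
    using measurable_restrict_subset[of J UNIV ?B] sets by (simp cong: measurable_cong_sets)
  define marg where "marg J n = distr (N n) (PiM J ?B) (\<lambda>f. restrict f J)" for J n
  have marg: "measure (marg J n) A = measure (N n) (prod_emb UNIV ?B J A)" if "A \<in> sets (PiM J ?B)" for J n A
    using that by (simp add: marg_def measure_distr prod_emb_eq_restrict_vimage space space_PiM)
  define lim_of where "lim_of J P \<longleftrightarrow> prob_space P \<and> sets P = sets (PiM J ?B) \<and>
      (\<forall>A\<in>sets (PiM J ?B). (\<lambda>n. measure (marg J n) A) \<longlonglongrightarrow> measure P A)" for J P
  have "\<exists>P. lim_of J P" if "finite J" for J
  proof -
    have "prob_space (marg J n)" for n
      unfolding marg_def by (intro prob_space.prob_space_distr prob restr)
    moreover have "sets (marg J n) = sets (PiM J ?B)" for n by (simp add: marg_def)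
    moreover have "\<exists>n0. \<forall>m\<ge>n0. \<forall>n\<ge>n0. \<forall>A\<in>sets (PiM J ?B). \<bar>measure (marg J m) A - measure (marg J n) A\<bar> < e"
      if "e > 0" for e
      using cauchy[OF \<open>finite J\<close> that] by (simp add: marg)
    ultimately show ?thesis by (rule prob_space_uniform_limit) (auto simp: lim_of_def)
  qed
  then have "\<forall>J. \<exists>P. finite J \<longrightarrow> lim_of J P" by blast
  then obtain R where "\<forall>J. finite J \<longrightarrow> lim_of J (R J)" unfolding choice_iff by blast
  then have R: "prob_space (R J)" "sets (R J) = sets (PiM J ?B)"
     "\<And>A. A \<in> sets (PiM J ?B) \<Longrightarrow> (\<lambda>n. measure (marg J n) A) \<longlonglongrightarrow> measure (R J) A" if "finite J" for J
    using that unfolding lim_of_def by blast+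
  interpret polish_projective UNIV R
  proof (rule polish_projective.intro, rule projective_family.intro)
    fix J H :: "'i set" assume JH: "J \<subseteq> H" "finite H"
    then have J: "finite J" by (rule finite_subset)
    interpret PJ: prob_space "R J" using R(1)[OF J] .
    interpret PH: prob_space "R H" using R(1)[OF JH(2)] .
    have r: "(\<lambda>f. restrict f J) \<in> R H \<rightarrow>\<^sub>M PiM J ?B"
      using measurable_restrict_subset[OF JH(1), of ?B] R(2)[OF JH(2)] by (simp cong: measurable_cong_sets)
    interpret D: prob_space "distr (R H) (PiM J ?B) (\<lambda>f. restrict f J)" by (rule PH.prob_space_distr[OF r])
    show "R J = distr (R H) (PiM J ?B) (\<lambda>f. restrict f J)"
    proof (rule measure_eqI)
      fix A assume "A \<in> sets (R J)"
      then have A: "A \<in> sets (PiM J ?B)" using R(2)[OF J] by simp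
      have A': "prod_emb H ?B J A \<in> sets (PiM H ?B)" using A JH(1) by (rule measurable_prod_emb[rotated])
      have "measure (marg H n) (prod_emb H ?B J A) = measure (marg J n) A" for n
        using JH(1) by (simp add: marg[OF A] marg[OF A'])
      then have "measure (R J) A = measure (R H) (prod_emb H ?B J A)"
        using LIMSEQ_unique[OF R(3)[OF J A]] R(3)[OF JH(2) A'] by simp
      also have "\<dots> = measure (distr (R H) (PiM J ?B) (\<lambda>f. restrict f J)) A"
        by (simp add: measure_distr[OF r A] prod_emb_eq_restrict_vimage sets_eq_imp_space_eq[OF R(2)[OF JH(2)]])
      finally show "emeasure (R J) A = emeasure (distr (R H) (PiM J ?B) (\<lambda>f. restrict f J)) A"
        by (simp add: PJ.emeasure_eq_measure D.emeasure_eq_measure)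
    qed (simp add: R(2)[OF J])
  qed (rule R(1))
  show thesis
  proof (rule that)
    show "prob_space lim" by (rule P.prob_space_axioms)
    show "sets lim = sets (PiM UNIV ?B)" by simp
    fix J :: "'i set" and A assume JA: "finite J" "A \<in> sets (PiM J ?B)"
    then show "(\<lambda>n. measure (N n) (prod_emb UNIV ?B J A)) \<longlonglongrightarrow> measure lim (prod_emb UNIV ?B J A)"
      using R(3)[OF JA] by (simp add: marg measure_lim_emb)
  qed
qed

text \<open>Transports cylinder events along a coordinatewise change of state space: from
  \<open>K\<close> into the copy by \<open>to_copy\<close>, and back by a retraction.\<close>

lemma measure_map_prod_emb:
  fixes N :: "('i \<Rightarrow> 'a) measure"
  assumes sets: "sets N = sets (PiM UNIV (\<lambda>_. S))" and f[measurable]: "f \<in> S \<rightarrow>\<^sub>M B"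
    and A: "A \<in> sets (PiM J (\<lambda>_. B))"
  defines "A' \<equiv> (\<lambda>u. \<lambda>i\<in>J. f (u i)) -` A \<inter> space (PiM J (\<lambda>_. S))"
  shows "A' \<in> sets (PiM J (\<lambda>_. S))"
    and "measure (distr N (PiM UNIV (\<lambda>_. B)) (\<lambda>w i. f (w i))) (prod_emb UNIV (\<lambda>_. B) J A)
      = measure N (prod_emb UNIV (\<lambda>_. S) J A')"
proof -
  show "A' \<in> sets (PiM J (\<lambda>_. S))"
    unfolding A'_def using A by (rule measurable_sets[rotated]) measurable
  have space: "space N = space (PiM UNIV (\<lambda>_. S))" using sets by (rule sets_eq_imp_space_eq)
  have meas: "(\<lambda>w i. f (w i)) \<in> PiM UNIV (\<lambda>_. S) \<rightarrow>\<^sub>M PiM UNIV (\<lambda>_. B)"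
    by (intro measurable_PiM_single') (auto simp: space_PiM PiE_iff intro: measurable_space[OF f])
  then have meas': "(\<lambda>w i. f (w i)) \<in> N \<rightarrow>\<^sub>M PiM UNIV (\<lambda>_. B)"
    using sets by (simp cong: measurable_cong_sets)
  have emb: "prod_emb UNIV (\<lambda>_. B) J A \<in> sets (PiM UNIV (\<lambda>_. B))"
    using A by (intro measurable_prod_emb) auto
  have "(\<lambda>w i. f (w i)) -` prod_emb UNIV (\<lambda>_. B) J A \<inter> space N = prod_emb UNIV (\<lambda>_. S) J A'"
    using measurable_space[OF f]
    by (auto simp: A'_def prod_emb_eq_restrict_vimage space space_PiM PiE_iff restrict_def cong: if_cong)
  then show "measure (distr N (PiM UNIV (\<lambda>_. B)) (\<lambda>w i. f (w i))) (prod_emb UNIV (\<lambda>_. B) J A)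
      = measure N (prod_emb UNIV (\<lambda>_. S) J A')"
    by (simp add: measure_distr[OF meas' emb])
qed

text \<open>The laws are pushed to the copy of the whole space, the limit is taken there and is
  brought back to \<open>K\<close>. Cylinder probabilities survive the round trip because the two
  maps compose to the identity on \<open>K\<close>.\<close>

lemma process_uniform_limit:
  fixes N :: "nat \<Rightarrow> ('i \<Rightarrow> 'a::{complete_space, second_countable_topology}) measure"
  assumes K: "closed K" "c \<in> K" and prob: "\<And>n. prob_space (N n)"
    and sets: "\<And>n. sets (N n) = sets (PiM UNIV (\<lambda>_. state_space K))"
    and cauchy: "\<And>J e. finite J \<Longrightarrow> e > 0 \<Longrightarrow> \<exists>n0. \<forall>m\<ge>n0. \<forall>n\<ge>n0. \<forall>A\<in>sets (PiM J (\<lambda>_. state_space K)).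
      \<bar>measure (N m) (prod_emb UNIV (\<lambda>_. state_space K) J A)
        - measure (N n) (prod_emb UNIV (\<lambda>_. state_space K) J A)\<bar> < e"
  obtains P where "prob_space P" "sets P = sets (PiM UNIV (\<lambda>_. state_space K))"
    "\<And>J A. finite J \<Longrightarrow> A \<in> sets (PiM J (\<lambda>_. state_space K)) \<Longrightarrow>
      (\<lambda>n. measure (N n) (prod_emb UNIV (\<lambda>_. state_space K) J A))
        \<longlonglongrightarrow> measure P (prod_emb UNIV (\<lambda>_. state_space K) J A)"
proof -
  let ?S = "\<lambda>_::'i. state_space K" and ?B = "\<lambda>_::'i. borel :: 'a polish_copy measure"
  \<comment> \<open>A left inverse of \<open>to_copy\<close> on \<open>K\<close>; points outside
    \<open>K\<close> go to the default value \<open>c\<close>. It is measurable because the closed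
    set \<open>K\<close> is Borel.\<close>
  define r where "r z = (if of_copy z \<in> K then of_copy z else c)" for z
  have [measurable]: "of_copy \<in> borel_measurable borel"
    by (rule borel_measurable_continuous_onI[OF continuous_on_of_copy])
  have [measurable]: "K \<in> sets borel" using K(1) by auto
  have r[measurable]: "r \<in> borel \<rightarrow>\<^sub>M state_space K"
    unfolding state_space_def r_def[abs_def] by (intro measurable_restrict_space2) (auto simp: K(2))
  have t[measurable]: "to_copy \<in> state_space K \<rightarrow>\<^sub>M borel"
    unfolding state_space_def
    by (intro measurable_restrict_space1 borel_measurable_continuous_onI[OF continuous_on_to_copy])
  define N' where "N' n = distr (N n) (PiM UNIV ?B) (\<lambda>w i. to_copy (w i))" for n
  note N' = measure_map_prod_emb[OF sets t, folded N'_def]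
  have probN': "prob_space (N' n)" for n
  proof -
    have "(\<lambda>w i. to_copy (w i)) \<in> PiM UNIV ?S \<rightarrow>\<^sub>M PiM UNIV ?B"
      by (intro measurable_PiM_single') (auto simp: space_PiM)
    then show ?thesis
      unfolding N'_def using sets by (intro prob_space.prob_space_distr prob) (simp cong: measurable_cong_sets)
  qed
  obtain P where P: "prob_space P" "sets P = sets (PiM UNIV ?B)"
    "\<And>J A. finite J \<Longrightarrow> A \<in> sets (PiM J ?B) \<Longrightarrow>
      (\<lambda>n. measure (N' n) (prod_emb UNIV ?B J A)) \<longlonglongrightarrow> measure P (prod_emb UNIV ?B J A)"
  proof (rule uniform_limit_polish[of N'])
    show "sets (N' n) = sets (PiM UNIV ?B)" for n by (simp add: N'_def)
    fix J :: "'i set" and e :: real assume "finite J" "e > 0"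
    from cauchy[OF this] obtain n0 where n0: "\<And>m n A. m \<ge> n0 \<Longrightarrow> n \<ge> n0 \<Longrightarrow> A\<in>sets (PiM J ?S) \<Longrightarrow>
      \<bar>measure (N m) (prod_emb UNIV ?S J A) - measure (N n) (prod_emb UNIV ?S J A)\<bar> < e"
      by blast
    show "\<exists>n0. \<forall>m\<ge>n0. \<forall>n\<ge>n0. \<forall>A\<in>sets (PiM J ?B).
      \<bar>measure (N' m) (prod_emb UNIV ?B J A) - measure (N' n) (prod_emb UNIV ?B J A)\<bar> < e"
      using n0 N'(1) by (intro exI[of _ n0] allI impI ballI) (simp add: N'(2))
  qed (use probN' in auto)
  interpret P: prob_space P by fact
  have lim: "(\<lambda>n. measure (N n) (prod_emb UNIV ?S J A))
        \<longlonglongrightarrow> measure (distr P (PiM UNIV ?S) (\<lambda>w i. r (w i))) (prod_emb UNIV ?S J A)"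
    if J: "finite J" and A: "A \<in> sets (PiM J ?S)" for J A
  proof -
    let ?A = "(\<lambda>u. \<lambda>i\<in>J. r (u i)) -` A \<inter> space (PiM J ?B)"
    have A': "?A \<in> sets (PiM J ?B)" by (rule measure_map_prod_emb(1)[OF P(2) r A])
    have "(\<lambda>u. \<lambda>i\<in>J. to_copy (u i)) -` ?A \<inter> space (PiM J ?S) = A"
    proof -
      have "(\<lambda>i\<in>J. r ((\<lambda>i\<in>J. to_copy (u i)) i)) = u" if "u \<in> space (PiM J ?S)" for u
        using that by (auto simp: r_def space_PiM PiE_iff extensional_def fun_eq_iff)
      then show ?thesis using sets.sets_into_space[OF A] by (auto simp: space_PiM)
    qed
    then have "measure (N' n) (prod_emb UNIV ?B J ?A) = measure (N n) (prod_emb UNIV ?S J A)" for n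
      using N'(2)[OF A'] by simp
    with P(3)[OF J A'] show ?thesis
      unfolding measure_map_prod_emb(2)[OF P(2) r A] by simp
  qed
  have "(\<lambda>w i. r (w i)) \<in> PiM UNIV ?B \<rightarrow>\<^sub>M PiM UNIV ?S"
    by (intro measurable_PiM_single') (auto simp: space_PiM PiE_iff intro: measurable_space[OF r, simplified])
  then have "prob_space (distr P (PiM UNIV ?S) (\<lambda>w i. r (w i)))"
    using P(2) by (intro P.prob_space_distr) (simp cong: measurable_cong_sets)
  then show thesis by (rule that[OF _ _ lim]) simp_all
qed

subsection \<open>Iterated kernels\<close>

locale history_kernels =
  fixes K :: "'e::{real_inner, complete_space, second_countable_topology} set"
    and \<alpha> :: real
    and Q :: "int \<Rightarrow> (nat \<Rightarrow> 'e) \<Rightarrow> 'e measure"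
  assumes compact: "compact K" and zero: "0 \<in> K"
    and \<alpha>: "0 < \<alpha>" "\<alpha> < 1"
    and trans: "\<And>l. transition_probability K (Q l)"
begin

abbreviation "S \<equiv> state_space K"
abbreviation "H \<equiv> hist_space K"

lemma measurable_Q [measurable]: "Q l \<in> H \<rightarrow>\<^sub>M prob_algebra S"
  using trans by (simp add: transition_probability_def)

lemma Q_props:
  assumes "x \<in> histories K"
  shows "prob_space (Q l x)" "sets (Q l x) = sets S" "space (Q l x) = K"
proof -
  have "Q l x \<in> space (prob_algebra S)"
    using measurable_space[OF measurable_Q] assms by (auto simp: space_hist_space)
  then show "prob_space (Q l x)" "sets (Q l x) = sets S" by (auto simp: space_prob_algebra)
  then show "space (Q l x) = K" using sets_eq_imp_space_eq[of "Q l x" S] by simp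
qed

lemma measurable_cons [measurable]: "(\<lambda>(x, y). case_nat y x) \<in> H \<Otimes>\<^sub>M S \<rightarrow>\<^sub>M H"
  unfolding hist_space_def
proof (rule measurable_PiM_single')
  show "(\<lambda>p. (case p of (x, y) \<Rightarrow> case_nat y x) i) \<in> PiM UNIV (\<lambda>_. S) \<Otimes>\<^sub>M S \<rightarrow>\<^sub>M S" for i :: nat
    by (cases i) (auto simp: case_prod_unfold)
qed (auto simp: space_pair_measure space_PiM PiE_iff split: nat.splits)

lemma measurable_cons_state: "x \<in> histories K \<Longrightarrow> (\<lambda>y. case_nat y x) \<in> S \<rightarrow>\<^sub>M H"
  using measurable_compose[OF measurable_Pair1'[of x H S] measurable_cons] by (simp add: space_hist_space)

lemma cons_in_histories: "x \<in> histories K \<Longrightarrow> y \<in> K \<Longrightarrow> case_nat y x \<in> histories K"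
  by (auto simp: Pi_iff split: nat.splits)

text \<open>With the entire history as the state the dynamics become Markov; this kernel leads from
  the history at time l to the one at time l + 1. Integration against it, \<open>step_op\<close>, is
  the operator P of the overview.\<close>

definition cons_kernel :: "int \<Rightarrow> (nat \<Rightarrow> 'e) \<Rightarrow> (nat \<Rightarrow> 'e) measure" where
  "cons_kernel l x = distr (Q l x) H (\<lambda>y. case_nat y x)"

lemma measurable_cons_kernel [measurable]: "cons_kernel l \<in> H \<rightarrow>\<^sub>M prob_algebra H"
  unfolding cons_kernel_def[abs_def] by measurable

definition step_op :: "int \<Rightarrow> ((nat \<Rightarrow> 'e) \<Rightarrow> real) \<Rightarrow> (nat \<Rightarrow> 'e) \<Rightarrow> real" where
  "step_op l h x = (\<integral>z. h z \<partial>cons_kernel l x)"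

lemma measurable_step_op [measurable]:
  assumes [measurable]: "h \<in> borel_measurable H"
  shows "step_op l h \<in> borel_measurable H"
  using measurable_compose[OF measurable_prob_algebraD[OF measurable_cons_kernel]
      integral_measurable_subprob_algebra[OF assms]]
  by (simp add: step_op_def[abs_def])

lemma measurable_cons_Q: "x \<in> histories K \<Longrightarrow> (\<lambda>y. case_nat y x) \<in> Q l x \<rightarrow>\<^sub>M H"
  using measurable_cons_state[of x] Q_props(2)[of x l] by (simp cong: measurable_cong_sets)

lemma step_op_eq:
  "h \<in> borel_measurable H \<Longrightarrow> x \<in> histories K \<Longrightarrow> step_op l h x = (\<integral>y. h (case_nat y x) \<partial>Q l x)"
  unfolding step_op_def cons_kernel_def by (rule integral_distr[OF measurable_cons_Q])

lemma extend_hist_in_histories: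
  "x \<in> histories K \<Longrightarrow> (\<And>i. i < n \<Longrightarrow> y i \<in> K) \<Longrightarrow> extend_hist x n y \<in> histories K"
  by (auto simp: extend_hist_def)

lemma measurable_extend_hist:
  assumes "x \<in> histories K" "{..<n} \<subseteq> J"
  shows "extend_hist x n \<in> PiM J (\<lambda>_. S) \<rightarrow>\<^sub>M H"
  unfolding extend_hist_def hist_space_def
proof (intro measurable_PiM_single')
  show "(\<lambda>y. if i < n then y (n - 1 - i) else x (i - n)) \<in> PiM J (\<lambda>_. S) \<rightarrow>\<^sub>M S" for i
    using assms by (cases "i < n") (auto intro!: measurable_component_singleton measurable_const simp: Pi_iff)
qed (use assms in \<open>auto simp: space_PiM PiE_iff Pi_iff subset_iff\<close>)

lemma extend_hist_0 [simp]: "extend_hist x 0 y = x"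
  by (simp add: extend_hist_def)

lemma extend_hist_Suc: "extend_hist x (Suc n) (y(n := z)) = case_nat z (extend_hist x n y)"
  by (auto simp: extend_hist_def fun_eq_iff split: nat.splits)

lemma extend_hist_restrict: "extend_hist x n (restrict y {0..<n}) = extend_hist x n y"
  by (auto simp: extend_hist_def fun_eq_iff)

text \<open>Links the infinite Ionescu-Tulcea measure to its recursively built finite stages, on
  which one-step computations are possible. The starting point \<open>\<lambda>_. undefined\<close>
  is the only element of the empty product.\<close>

lemma distr_future_law:
  assumes x: "x \<in> histories K"
  shows "distr (future_law K Q l x) (PiM {0..<n} (\<lambda>_. S)) (\<lambda>y. restrict y {0..<n})
      = Ionescu_Tulcea.C (step_kernel Q l x) (\<lambda>_. S) 0 n (\<lambda>_. undefined)"
    and sets_future_law: "sets (future_law K Q l x) = sets H"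
proof -
  interpret IT: Ionescu_Tulcea "step_kernel Q l x" "\<lambda>_. S"
    by (rule Ionescu_Tulcea_step_kernel[OF trans x])
  have fl: "future_law K Q l x = IT.PF.lim" by (simp add: future_law_def)
  show sets: "sets (future_law K Q l x) = sets H" by (simp add: fl hist_space_def)
  let ?J = "{0..<n}"
  have C: "sets (IT.C 0 n (\<lambda>_. undefined)) = sets (PiM ?J (\<lambda>_. S))"
    using IT.sets_C[of "\<lambda>_. undefined" 0 n] by (simp add: space_PiM)
  show "distr (future_law K Q l x) (PiM ?J (\<lambda>_. S)) (\<lambda>y. restrict y ?J) = IT.C 0 n (\<lambda>_. undefined)"
  proof (rule measure_eqI)
    fix A assume "A \<in> sets (distr (future_law K Q l x) (PiM ?J (\<lambda>_. S)) (\<lambda>y. restrict y ?J))"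
    then have A: "A \<in> sets (PiM ?J (\<lambda>_. S))" by simp
    have "(\<lambda>y. restrict y ?J) \<in> future_law K Q l x \<rightarrow>\<^sub>M PiM ?J (\<lambda>_. S)"
      unfolding fl by (simp cong: measurable_cong_sets)
    then have "emeasure (distr (future_law K Q l x) (PiM ?J (\<lambda>_. S)) (\<lambda>y. restrict y ?J)) A
        = emeasure (future_law K Q l x) (prod_emb UNIV (\<lambda>_. S) ?J A)"
      using A by (simp add: emeasure_distr prod_emb_eq_restrict_vimage fl)
    also have "\<dots> = emeasure (IT.C 0 n (\<lambda>_. undefined)) (prod_emb ?J (\<lambda>_. S) ?J A)"
      unfolding fl using A by (simp add: IT.lim IT.emeasure_CI)
    also have "prod_emb ?J (\<lambda>_. S) ?J A = A" using sets.sets_into_space[OF A] by (intro prod_emb_id) (simp add: space_PiM)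
    finally show "emeasure (distr (future_law K Q l x) (PiM ?J (\<lambda>_. S)) (\<lambda>y. restrict y ?J)) A
        = emeasure (IT.C 0 n (\<lambda>_. undefined)) A" .
  qed (simp add: C)
qed

lemma space_future_law: "x \<in> histories K \<Longrightarrow> space (future_law K Q l x) = histories K"
  using sets_eq_imp_space_eq[OF sets_future_law] by (simp add: space_hist_space)

lemma measurable_future_restrict:
  "x \<in> histories K \<Longrightarrow> (\<lambda>y. restrict y J) \<in> future_law K Q l x \<rightarrow>\<^sub>M PiM J (\<lambda>_. S)"
  using measurable_restrict_subset[of J UNIV "\<lambda>_. S"] sets_future_law[of x]
  by (simp add: hist_space_def cong: measurable_cong_sets)

lemma prob_space_future_law:
  assumes x: "x \<in> histories K"
  shows "prob_space (future_law K Q l x)"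
proof -
  interpret IT: Ionescu_Tulcea "step_kernel Q l x" "\<lambda>_. S"
    by (rule Ionescu_Tulcea_step_kernel[OF trans x])
  have "prob_space (IT.C 0 0 (\<lambda>_. undefined))" by (rule IT.prob_space_C) (simp add: space_PiM)
  then show ?thesis
    using distr_future_law(1)[OF x, of l 0] prob_space_distrD[OF measurable_future_restrict[OF x]] by metis
qed

lemma measurable_extend_hist_future:
  assumes x: "x \<in> histories K"
  shows "extend_hist x n \<in> future_law K Q l x \<rightarrow>\<^sub>M H"
  using measurable_extend_hist[OF x, of n UNIV] sets_future_law[OF x]
  by (simp add: hist_space_def cong: measurable_cong_sets)

text \<open>This is the product of the operators \<open>step_op\<close> at times l, ..., l + n - 1.
  Defined through \<open>future_law\<close>, it speaks directly about the measures of (RZ) and of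
  the conditional laws in (1); the operator form is recovered by \<open>evolve_Suc\<close>.\<close>

definition evolve :: "int \<Rightarrow> nat \<Rightarrow> ((nat \<Rightarrow> 'e) \<Rightarrow> real) \<Rightarrow> (nat \<Rightarrow> 'e) \<Rightarrow> real" where
  "evolve l n h x = (\<integral>y. h (extend_hist x n y) \<partial>future_law K Q l x)"

lemma evolve_0: "x \<in> histories K \<Longrightarrow> evolve l 0 h x = h x"
  using prob_space.prob_space[OF prob_space_future_law, of x l] by (simp add: evolve_def)

lemma evolve_cong:
  "(\<And>x. x \<in> histories K \<Longrightarrow> h x = h' x) \<Longrightarrow> x \<in> histories K \<Longrightarrow> evolve l n h x = evolve l n h' x"
  unfolding evolve_def
  by (intro Bochner_Integration.integral_cong refl)
    (metis PiE UNIV_I extend_hist_in_histories space_future_law)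

text \<open>The finite stages grow by appending the newest state, so the newest state is integrated
  out first. Hence the operator at the latest time, \<open>l + int n\<close>, acts on h before all
  others.\<close>

lemma evolve_Suc:
  assumes h[measurable]: "h \<in> borel_measurable H" and bnd: "\<And>x. x \<in> histories K \<Longrightarrow> \<bar>h x\<bar> \<le> b"
    and x: "x \<in> histories K"
  shows "evolve l (Suc n) h x = evolve l n (step_op (l + int n) h) x"
proof -
  interpret IT: Ionescu_Tulcea "step_kernel Q l x" "\<lambda>_. S"
    by (rule Ionescu_Tulcea_step_kernel[OF trans x])
  let ?P = "\<lambda>n. PiM {0..<n} (\<lambda>_. S)" and ?u = "\<lambda>_::nat. undefined :: 'e"
  have u: "?u \<in> space (?P 0)" by (simp add: space_PiM)
  have ext: "extend_hist x n \<in> ?P n \<rightarrow>\<^sub>M H" for n by (rule measurable_extend_hist[OF x]) auto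
  have ev: "evolve l n g x = (\<integral>y. g (extend_hist x n y) \<partial>IT.C 0 n ?u)" if g: "g \<in> borel_measurable H" for g n
    unfolding evolve_def distr_future_law[OF x, symmetric]
    using measurable_compose[OF ext g]
    by (subst integral_distr[OF measurable_future_restrict[OF x]]) (simp_all add: extend_hist_restrict)
  have C: "space (IT.C 0 n ?u) = space (?P n)" "sets (IT.C 0 n ?u) = sets (?P n)" for n
    using IT.space_C[OF u, of n] IT.sets_C[OF u, of n] by simp_all
  interpret C: prob_space "IT.C 0 n ?u" by (rule IT.prob_space_C[OF u])
  have ext_in: "extend_hist x n y \<in> histories K" if "y \<in> space (?P n)" for y n
    using measurable_space[OF ext that] by (simp add: space_hist_space)
  have "evolve l (Suc n) h x = (\<integral>y. h (extend_hist x (Suc n) y) \<partial>(IT.C 0 n ?u \<bind> IT.eP n))"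
    by (simp add: ev[OF h])
  also have "\<dots> = (\<integral>y. \<integral>z. h (extend_hist x (Suc n) z) \<partial>IT.eP n y \<partial>IT.C 0 n ?u)"
  proof (rule integral_bind[where K="?P (Suc n)" and B=b and B'=1])
    show "(\<lambda>y. h (extend_hist x (Suc n) y)) \<in> borel_measurable (?P (Suc n))"
      by (rule measurable_compose[OF ext h])
    show "IT.eP n \<in> IT.C 0 n ?u \<rightarrow>\<^sub>M subprob_algebra (?P (Suc n))"
      using IT.measurable_eP C by (simp cong: measurable_cong_sets)
    show "\<bar>h (extend_hist x (Suc n) y)\<bar> \<le> b" if "y \<in> space (?P (Suc n))" for y
      using bnd[OF ext_in[OF that]] .
    show "AE y in IT.C 0 n ?u. emeasure (IT.eP n y) (space (IT.eP n y)) \<le> ennreal 1"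
      using IT.prob_space_eP[THEN prob_space.emeasure_space_1] C by (intro AE_I2) simp
  qed (use C.finite_measure_axioms in auto)
  also have "\<dots> = (\<integral>y. step_op (l + int n) h (extend_hist x n y) \<partial>IT.C 0 n ?u)"
  proof (rule Bochner_Integration.integral_cong[OF refl])
    fix y :: "nat \<Rightarrow> 'e" assume "y \<in> space (IT.C 0 n ?u)"
    then have y: "y \<in> space (?P n)" by (simp add: C)
    have upd: "fun_upd y n \<in> step_kernel Q l x n y \<rightarrow>\<^sub>M ?P (Suc n)"
      by (rule measurable_fun_upd[where J="{0..<n}"]) (use y in \<open>auto simp: atLeast0_lessThan_Suc\<close>)
    show "(\<integral>z. h (extend_hist x (Suc n) z) \<partial>IT.eP n y) = step_op (l + int n) h (extend_hist x n y)"
      unfolding IT.eP_def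
      by (subst integral_distr[OF upd measurable_compose[OF ext h]])
        (simp add: extend_hist_Suc step_op_eq[OF h ext_in[OF y]] step_kernel_def)
  qed
  also have "\<dots> = evolve l n (step_op (l + int n) h) x"
    by (rule ev[symmetric]) measurable
  finally show ?thesis .
qed

lemma prob_space_cons_kernel: "x \<in> histories K \<Longrightarrow> prob_space (cons_kernel l x)"
  unfolding cons_kernel_def by (intro prob_space.prob_space_distr Q_props measurable_cons_Q)

lemma step_op_bound:
  assumes "h \<in> borel_measurable H" "\<And>x. x \<in> histories K \<Longrightarrow> \<bar>h x\<bar> \<le> b" "x \<in> histories K"
  shows "\<bar>step_op l h x\<bar> \<le> b"
proof -
  interpret prob_space "cons_kernel l x" using assms(3) by (rule prob_space_cons_kernel)
  show ?thesis
    unfolding step_op_def using assms(1,2)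
    by (intro abs_integral_le) (auto simp: cons_kernel_def space_hist_space)
qed

text \<open>Chapman-Kolmogorov, by induction on the length of the later stretch.\<close>

lemma evolve_add:
  assumes "h \<in> borel_measurable H" "\<And>x. x \<in> histories K \<Longrightarrow> \<bar>h x\<bar> \<le> b" "x \<in> histories K"
  shows "evolve l (m + n) h x = evolve l m (evolve (l + int m) n h) x"
  using assms
proof (induction n arbitrary: h)
  case 0
  then show ?case by (auto intro!: evolve_cong simp: evolve_0)
next
  case (Suc n)
  have "evolve l (m + Suc n) h x = evolve l (m + n) (step_op (l + int m + int n) h) x"
    using evolve_Suc[OF Suc.prems, of l "m + n"] by (simp add: add.assoc)
  also have "\<dots> = evolve l m (evolve (l + int m) n (step_op (l + int m + int n) h)) x"
    by (intro Suc.IH measurable_step_op step_op_bound Suc.prems)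
  also have "\<dots> = evolve l m (evolve (l + int m) (Suc n) h) x"
    using evolve_Suc[OF Suc.prems(1,2)] Suc.prems(3) by (intro evolve_cong) auto
  finally show ?case .
qed

lemma measurable_evolve:
  assumes "h \<in> borel_measurable H" "\<And>x. x \<in> histories K \<Longrightarrow> \<bar>h x\<bar> \<le> b"
  shows "evolve l n h \<in> borel_measurable H"
  using assms
proof (induction n arbitrary: h)
  case 0
  then show ?case using evolve_0 measurable_cong[of H "evolve l 0 h" h] by (simp add: space_hist_space)
next
  case (Suc n)
  have "evolve l n (step_op (l + int n) h) \<in> borel_measurable H"
    using step_op_bound[OF Suc.prems] by (intro Suc.IH measurable_step_op Suc.prems) auto
  then show ?case
    using measurable_cong[of H "evolve l (Suc n) h" "evolve l n (step_op (l + int n) h)"]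
      evolve_Suc[OF Suc.prems] by (simp add: space_hist_space)
qed

lemma evolve_eq_distr:
  assumes "h \<in> borel_measurable H" "x \<in> histories K"
  shows "evolve l n h x = integral\<^sup>L (distr (future_law K Q l x) H (extend_hist x n)) h"
  unfolding evolve_def using assms by (simp add: integral_distr measurable_extend_hist_future)

section \<open>The metric on histories and quasi-Lipschitz functions\<close>

lemma bounded_diam: obtains D where "D > 0" "\<And>x y. x \<in> K \<Longrightarrow> y \<in> K \<Longrightarrow> norm (x - y) \<le> D"
proof -
  obtain a where a: "a > 0" "\<And>x. x \<in> K \<Longrightarrow> norm x \<le> a"
    using compact_imp_bounded[OF compact] bounded_pos by metis
  have "norm (x - y) \<le> 2 * a" if "x \<in> K" "y \<in> K" for x y
    using a(2)[OF that(1)] a(2)[OF that(2)] norm_triangle_ineq4[of x y] by linarith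
  then show thesis using that[of "2 * a"] a(1) by simp
qed

lemma summable_hist_dist:
  assumes "x \<in> histories K" "y \<in> histories K"
  shows "summable (\<lambda>i. \<alpha> ^ i * norm (x i - y i))"
proof -
  obtain D where D: "D > 0" "\<And>x y. x \<in> K \<Longrightarrow> y \<in> K \<Longrightarrow> norm (x - y) \<le> D" using bounded_diam by blast
  have "summable (\<lambda>i. \<alpha> ^ i * D)" using \<alpha> by (intro summable_mult2 summable_geometric) auto
  then show ?thesis
    by (rule summable_comparison_test'[where N=0]) (use D(2) assms \<alpha> in \<open>auto simp: Pi_iff intro!: mult_left_mono\<close>)
qed

lemma hist_dist_nonneg: "x \<in> histories K \<Longrightarrow> y \<in> histories K \<Longrightarrow> 0 \<le> hist_dist \<alpha> x y"
  unfolding hist_dist_def using \<alpha> by (intro suminf_nonneg summable_hist_dist) auto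

lemma hist_dist_cons:
  assumes "x \<in> histories K" "x' \<in> histories K" "y \<in> K"
  shows "hist_dist \<alpha> (case_nat y x) (case_nat y x') = \<alpha> * hist_dist \<alpha> x x'"
proof -
  have "hist_dist \<alpha> (case_nat y x) (case_nat y x') = (\<Sum>i. \<alpha> ^ Suc i * norm (x i - x' i))"
    unfolding hist_dist_def
    using suminf_split_head[OF summable_hist_dist[OF cons_in_histories cons_in_histories, OF assms(1,3,2,3)]]
    by simp
  also have "\<dots> = \<alpha> * hist_dist \<alpha> x x'"
    unfolding hist_dist_def using suminf_mult[OF summable_hist_dist[OF assms(1,2)], of \<alpha>]
    by (simp add: mult.assoc)
  finally show ?thesis .
qed

text \<open>Recent coordinates contribute a geometric series times \<open>\<delta>\<close>, all
  older ones at most \<open>\<alpha> ^ n\<close> times such a series with the diameter. Thus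
  closeness of finitely many states, which is what (RZ) offers, becomes closeness in the
  metric.\<close>

lemma hist_dist_le:
  assumes x: "x \<in> histories K" "y \<in> histories K"
    and D: "\<And>x y. x \<in> K \<Longrightarrow> y \<in> K \<Longrightarrow> norm (x - y) \<le> D"
    and \<delta>: "\<And>i. i < n \<Longrightarrow> norm (x i - y i) \<le> \<delta>" "0 \<le> \<delta>"
  shows "hist_dist \<alpha> x y \<le> (\<delta> + \<alpha> ^ n * D) / (1 - \<alpha>)"
proof -
  have D0: "0 \<le> D" using D[OF zero zero] by simp
  have geo: "(\<lambda>i. \<alpha> ^ i) sums (1 / (1 - \<alpha>))" using \<alpha> by (intro geometric_sums) auto
  have "hist_dist \<alpha> x y = (\<Sum>i. \<alpha> ^ (i + n) * norm (x (i + n) - y (i + n))) + (\<Sum>i<n. \<alpha> ^ i * norm (x i - y i))"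
    unfolding hist_dist_def by (rule suminf_split_initial_segment[OF summable_hist_dist[OF x]])
  also have "(\<Sum>i. \<alpha> ^ (i + n) * norm (x (i + n) - y (i + n))) \<le> (\<Sum>i. \<alpha> ^ i * (\<alpha> ^ n * D))"
  proof (rule suminf_le)
    show "\<alpha> ^ (i + n) * norm (x (i + n) - y (i + n)) \<le> \<alpha> ^ i * (\<alpha> ^ n * D)" for i
      using \<alpha> D x by (auto simp: Pi_iff power_add mult.assoc intro!: mult_left_mono)
    show "summable (\<lambda>i. \<alpha> ^ (i + n) * norm (x (i + n) - y (i + n)))"
      using summable_hist_dist[OF x] by (rule summable_ignore_initial_segment)
    show "summable (\<lambda>i. \<alpha> ^ i * (\<alpha> ^ n * D))" using geo by (intro summable_mult2) (rule sums_summable)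
  qed
  also have "(\<Sum>i. \<alpha> ^ i * (\<alpha> ^ n * D)) = \<alpha> ^ n * D / (1 - \<alpha>)"
    using sums_unique[OF sums_mult2[OF geo, of "\<alpha> ^ n * D"]] by simp
  also have "(\<Sum>i<n. \<alpha> ^ i * norm (x i - y i)) \<le> (\<Sum>i<n. \<alpha> ^ i * \<delta>)"
    using \<delta> \<alpha> by (intro sum_mono mult_left_mono) auto
  also have "\<dots> \<le> \<delta> / (1 - \<alpha>)"
  proof -
    have "(\<Sum>i<n. \<alpha> ^ i) \<le> 1 / (1 - \<alpha>)"
      using sum_le_suminf[OF sums_summable[OF geo], of "{..<n}"] \<alpha> sums_unique[OF geo] by simp
    from mult_right_mono[OF this \<delta>(2)] show ?thesis by (simp add: sum_distrib_right)
  qed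
  finally show ?thesis by (simp add: add_divide_distrib)
qed

text \<open>Lipschitz except for jumps caused by the last \<open>s\<close> states; \<open>b\<close> bounds the oscillation.
  A bounded measurable function of the last \<open>s\<close> states is of this kind with \<open>L = 0\<close>, which is why
  no regularity is needed once \<open>s\<close> steps have passed.\<close>

definition quasi_Lip :: "nat \<Rightarrow> real \<Rightarrow> real \<Rightarrow> ((nat \<Rightarrow> 'e) \<Rightarrow> real) \<Rightarrow> bool" where
  "quasi_Lip s b L h \<longleftrightarrow> h \<in> borel_measurable H
    \<and> (\<forall>x\<in>histories K. \<forall>y\<in>histories K. \<bar>h x - h y\<bar> \<le> b)
    \<and> (\<forall>x\<in>histories K. \<forall>y\<in>histories K. (\<forall>i<s. x i = y i) \<longrightarrow> \<bar>h x - h y\<bar> \<le> L * hist_dist \<alpha> x y)"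

lemma quasi_LipD:
  assumes "quasi_Lip s b L h"
  shows "h \<in> borel_measurable H"
    and "x \<in> histories K \<Longrightarrow> y \<in> histories K \<Longrightarrow> \<bar>h x - h y\<bar> \<le> b"
    and "x \<in> histories K \<Longrightarrow> y \<in> histories K \<Longrightarrow> (\<And>i. i < s \<Longrightarrow> x i = y i) \<Longrightarrow> \<bar>h x - h y\<bar> \<le> L * hist_dist \<alpha> x y"
  using assms by (auto simp: quasi_Lip_def)

lemma zero_in_histories [simp]: "(\<lambda>_. 0) \<in> histories K"
  using zero by auto

lemma quasi_Lip_bound:
  assumes "quasi_Lip s b L h" "x \<in> histories K" shows "\<bar>h x\<bar> \<le> \<bar>h (\<lambda>_. 0)\<bar> + b"
  using quasi_LipD(2)[OF assms(1,2) zero_in_histories] by auto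

lemma quasi_Lip_mono: "quasi_Lip s b L h \<Longrightarrow> s \<le> s' \<Longrightarrow> b \<le> b' \<Longrightarrow> L \<le> L' \<Longrightarrow> quasi_Lip s' b' L' h"
proof -
  assume h: "quasi_Lip s b L h" and le: "s \<le> s'" "b \<le> b'" "L \<le> L'"
  have "\<bar>h x - h y\<bar> \<le> L' * hist_dist \<alpha> x y"
    if "x \<in> histories K" "y \<in> histories K" "\<forall>i<s'. x i = y i" for x y
  proof -
    have "\<bar>h x - h y\<bar> \<le> L * hist_dist \<alpha> x y" using that le(1) by (intro quasi_LipD(3)[OF h]) auto
    also have "\<dots> \<le> L' * hist_dist \<alpha> x y" using that le(3) by (intro mult_right_mono hist_dist_nonneg)
    finally show ?thesis .
  qed
  then show ?thesis using h le(2) by (force simp: quasi_Lip_def intro: order_trans)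
qed

end

subsection \<open>Exponential loss of memory\<close>

locale mixing_kernels = history_kernels K \<alpha> Q
  for K :: "'e::{real_inner, complete_space, second_countable_topology} set" and \<alpha> Q +
  fixes C :: real
  assumes C: "C > 0"
    and var_le: "\<And>l x x' A. x \<in> histories K \<Longrightarrow> x' \<in> histories K \<Longrightarrow> A \<in> sets (state_space K) \<Longrightarrow>
      \<bar>measure (Q l x) A - measure (Q l x') A\<bar> \<le> C * hist_dist \<alpha> x x'"
    and RZ: "RZ K Q"
begin

text \<open>The integrand and the measure are changed one at a time. Putting the same new state
  before both histories shrinks their distance by \<open>\<alpha>\<close>, and agreement in s - 1
  coordinates becomes agreement in s; this is how one of the s exceptional states disappears.
  Exchanging \<open>Q l x\<close> for \<open>Q l y\<close> costs the oscillation times the variation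
  distance.\<close>

lemma step_op_quasi_Lip:
  assumes h: "quasi_Lip s b L h" and b: "0 \<le> b" and L: "0 \<le> L"
  shows "quasi_Lip (s - 1) b (\<alpha> * L + C * b) (step_op l h)"
  unfolding quasi_Lip_def
proof (intro conjI ballI impI)
  note hD = quasi_LipD[OF h]
  show "step_op l h \<in> borel_measurable H" using hD(1) by (rule measurable_step_op)
  fix x y assume x: "x \<in> histories K" and y: "y \<in> histories K"
  show "\<bar>step_op l h x - step_op l h y\<bar> \<le> b"
    unfolding step_op_def using hD(1,2) x y
    by (intro integral_diff_le_pairwise prob_space_cons_kernel)
      (auto simp: cons_kernel_def space_hist_space)
  assume xy: "\<forall>i<s - 1. x i = y i"
  interpret Qx: prob_space "Q l x" by (rule Q_props[OF x])
  let ?d = "hist_dist \<alpha> x y"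
  have m: "(\<lambda>z. h (case_nat z x)) \<in> borel_measurable (Q l x)" "(\<lambda>z. h (case_nat z y)) \<in> borel_measurable (Q l x)"
    using measurable_compose[OF measurable_cons_state hD(1)] x y Q_props(2)[OF x, of l]
    by (simp_all cong: measurable_cong_sets)
  have z: "\<bar>h (case_nat z x) - h (case_nat z y)\<bar> \<le> \<alpha> * L * ?d" if "z \<in> K" for z
  proof -
    have "case_nat z x i = case_nat z y i" if "i < s" for i
      using xy that by (cases i) auto
    from hD(3)[OF cons_in_histories[OF x \<open>z \<in> K\<close>] cons_in_histories[OF y \<open>z \<in> K\<close>] this]
    show ?thesis by (simp add: hist_dist_cons[OF x y \<open>z \<in> K\<close>] mult_ac)
  qed
  have bnd: "\<bar>h (case_nat z u)\<bar> \<le> \<bar>h (\<lambda>_. 0)\<bar> + b" if "z \<in> K" "u \<in> histories K" for z u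
    by (intro quasi_Lip_bound[OF h] cons_in_histories that)
  have int: "integrable (Q l x) (\<lambda>z. h (case_nat z x))" "integrable (Q l x) (\<lambda>z. h (case_nat z y))"
    using bnd x y m by (auto intro!: Qx.integrable_const_bound[where B="\<bar>h (\<lambda>_. 0)\<bar> + b"] simp: Q_props(3)[OF x])
  have "\<bar>(\<integral>z. h (case_nat z x) \<partial>Q l x) - (\<integral>z. h (case_nat z y) \<partial>Q l x)\<bar> \<le> \<alpha> * L * ?d"
  proof -
    have "\<bar>\<integral>z. h (case_nat z x) - h (case_nat z y) \<partial>Q l x\<bar> \<le> \<alpha> * L * ?d"
      using z m by (intro Qx.abs_integral_le) (auto simp: Q_props(3)[OF x])
    then show ?thesis using int by simp
  qed
  moreover have "\<bar>(\<integral>z. h (case_nat z y) \<partial>Q l x) - (\<integral>z. h (case_nat z y) \<partial>Q l y)\<bar> \<le> b * (C * ?d)"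
    using m(2) hD(2) x y var_le[OF x y] cons_in_histories
    by (intro integral_diff_le_osc Q_props) (auto simp: Q_props)
  ultimately show "\<bar>step_op l h x - step_op l h y\<bar> \<le> (\<alpha> * L + C * b) * ?d"
    unfolding step_op_eq[OF hD(1) x] step_op_eq[OF hD(1) y] by (simp add: algebra_simps)
qed

text \<open>The sum of the geometric series of (SF) contributions: each step adds \<open>C\<close>
  times the oscillation to the Lipschitz constant, and later steps damp it by powers of
  \<open>\<alpha>\<close>.\<close>

definition L0 :: real where "L0 = C / (1 - \<alpha>)"

lemma L0_pos: "L0 > 0" using C \<alpha> by (simp add: L0_def)

text \<open>Averaging never increases the oscillation, so the same b enters every (SF) contribution,
  and their sum stays below \<open>L0 * b\<close> for all n.\<close>

lemma evolve_quasi_Lip: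
  assumes "quasi_Lip s b L h" "0 \<le> b" "0 \<le> L"
  shows "quasi_Lip (s - n) b (\<alpha> ^ n * L + L0 * b) (evolve l n h)"
proof -
  have *: "quasi_Lip (s - n) b (\<alpha> ^ n * L + (\<Sum>i<n. \<alpha> ^ i) * C * b) (evolve l n h)"
    using assms
  proof (induction n arbitrary: h s L)
    case 0
    then show ?case using evolve_0 measurable_cong[of H "evolve l 0 h" h]
      by (simp add: quasi_Lip_def space_hist_space)
  next
    case (Suc n)
    have "quasi_Lip (s - 1 - n) b (\<alpha> ^ n * (\<alpha> * L + C * b) + (\<Sum>i<n. \<alpha> ^ i) * C * b) (evolve l n (step_op (l + int n) h))"
      using C \<alpha> Suc.prems by (intro Suc.IH step_op_quasi_Lip) auto
    moreover have "evolve l (Suc n) h x = evolve l n (step_op (l + int n) h) x" if "x \<in> histories K" for x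
      by (rule evolve_Suc[OF quasi_LipD(1) quasi_Lip_bound that]) (use Suc.prems in blast)+
    ultimately show ?case
      using measurable_cong[of H "evolve l (Suc n) h" "evolve l n (step_op (l + int n) h)"]
      by (simp add: quasi_Lip_def space_hist_space algebra_simps)
  qed
  have "(\<Sum>i<n. \<alpha> ^ i) * C * b \<le> L0 * b"
  proof (rule mult_right_mono)
    have geo: "(\<lambda>i. \<alpha> ^ i) sums (1 / (1 - \<alpha>))" using \<alpha> by (intro geometric_sums) auto
    have "(\<Sum>i<n. \<alpha> ^ i) \<le> 1 / (1 - \<alpha>)"
      using sum_le_suminf[OF sums_summable[OF geo], of "{..<n}"] \<alpha> sums_unique[OF geo] by simp
    from mult_right_mono[OF this, of C] show "(\<Sum>i<n. \<alpha> ^ i) * C \<le> L0" using C by (simp add: L0_def)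
  qed (rule assms(2))
  then show ?thesis by (intro quasi_Lip_mono[OF *]) auto
qed

section \<open>Minorization and contraction\<close>

lemma sets_norm_less: "{z \<in> histories K. \<forall>i<n. norm (z i) < \<delta>} \<in> sets H"
proof -
  have "{z \<in> space H. norm (z i) < \<delta>} \<in> sets H" for i
  proof -
    have "(\<lambda>z. z i) \<in> H \<rightarrow>\<^sub>M S"
      unfolding hist_space_def by (rule measurable_component_singleton) simp
    moreover have "(\<lambda>y. norm y) \<in> borel_measurable S"
      unfolding state_space_def by (intro measurable_restrict_space1 borel_measurable_norm measurable_ident)
    ultimately have "(\<lambda>z. norm (z i)) \<in> borel_measurable H" by (rule measurable_compose)
    then show ?thesis by (rule borel_measurable_less) simp
  qed
  from sets.sets_Collect_finite_All[OF this finite_lessThan, of n]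
  show ?thesis unfolding space_hist_space lessThan_iff Ball_def .
qed

text \<open>(RZ) is read at the end of its window: with m = s + n steps, the n small states are
  exactly the n most recent ones, hence the leading coordinates of the history. The infimum in (RZ)
  is the uniform lower bound p.\<close>

lemma minorization:
  assumes "\<delta> > 0"
  obtains m p B where "m \<ge> n" "p > 0" "B \<in> sets H" "\<And>z i. z \<in> B \<Longrightarrow> i < n \<Longrightarrow> norm (z i) < \<delta>"
    "\<And>l x. x \<in> histories K \<Longrightarrow> p \<le> measure (distr (future_law K Q l x) H (extend_hist x m)) B"
proof -
  define E where "E s l x = measure (future_law K Q l x)
    {y \<in> space (future_law K Q l x). \<forall>j\<in>{s+1..s+n}. norm (y (j - 1)) < \<delta>}" for s l x
  obtain s where s: "(INF l. INF x\<in>histories K. E s l x) > 0"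
    using RZ assms unfolding RZ_def E_def by blast
  let ?p = "INF l. INF x\<in>histories K. E s l x"
  let ?m = "s + n" and ?B = "{z \<in> histories K. \<forall>i<n. norm (z i) < \<delta>}"
  have E0: "0 \<le> E s l x" for l x by (simp add: E_def)
  have inner: "(INF x\<in>histories K. E s l x) \<le> E s l x" if "x \<in> histories K" for l x
    using E0 by (intro cINF_lower that bdd_belowI2[where m=0])
  have "0 \<le> (INF x\<in>histories K. E s l x)" for l
    using E0 zero_in_histories by (intro cINF_greatest) blast+
  then have "?p \<le> (INF x\<in>histories K. E s l x)" for l
    by (intro cINF_lower bdd_belowI2[where m=0]) auto
  then have p: "?p \<le> E s l x" if "x \<in> histories K" for l x
    using inner[OF that, of l] order_trans by blast
  have B: "?B \<in> sets H" by (rule sets_norm_less)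
  have "?p \<le> measure (distr (future_law K Q l x) H (extend_hist x ?m)) ?B" if x: "x \<in> histories K" for l x
  proof -
    have "{y \<in> space (future_law K Q l x). \<forall>j\<in>{s+1..s+n}. norm (y (j - 1)) < \<delta>}
      = extend_hist x ?m -` ?B \<inter> space (future_law K Q l x)" (is "?L = ?R")
    proof (intro set_eqI iffI)
      fix y assume y: "y \<in> ?L"
      then have "extend_hist x ?m y \<in> histories K"
        using x by (intro extend_hist_in_histories) (auto simp: space_future_law)
      moreover have "norm (extend_hist x ?m y i) < \<delta>" if "i < n" for i
      proof -
        \<comment> \<open>Coordinate i of the history after m steps is the state number m - i, and
          the state number j is stored at index j - 1.\<close>
        have "?m - i \<in> {s+1..s+n}" using that by auto
        with y have "norm (y (?m - i - 1)) < \<delta>" by blast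
        moreover have "?m - i - 1 = ?m - 1 - i" by simp
        ultimately show ?thesis using that by (simp add: extend_hist_def)
      qed
      ultimately show "y \<in> ?R" using y by auto
    next
      fix y assume y: "y \<in> ?R"
      have "norm (y (j - 1)) < \<delta>" if j: "j \<in> {s+1..s+n}" for j
      proof -
        have "?m - j < n" "?m - 1 - (?m - j) = j - 1" "?m - j < ?m" using j by auto
        moreover have "norm (extend_hist x ?m y (?m - j)) < \<delta>" using y \<open>?m - j < n\<close> by blast
        ultimately show ?thesis by (simp add: extend_hist_def)
      qed
      with y show "y \<in> ?L" by auto
    qed
    then show ?thesis
      using p[OF x, of l] by (simp add: E_def measure_distr[OF measurable_extend_hist_future[OF x] B])
  qed
  from that[OF le_add2 s B _ this] show thesis by blast
qed

text \<open>The weight \<open>\<beta>\<close> balances the two inequalities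
  \<open>osc (evolve l m h) \<le> (1 - q) osc h + q \<epsilon> Lip h\<close> and \<open>Lip (evolve l m h) \<le> \<alpha>\<^sup>m Lip h + L0 osc h\<close>.\<close>

lemma block_contraction:
  obtains m \<rho> \<beta> where "m > 0" "0 < \<rho>" "\<rho> < 1" "\<beta> > 0"
    "\<And>b L h l. quasi_Lip 0 b L h \<Longrightarrow> 0 \<le> b \<Longrightarrow> 0 \<le> L \<Longrightarrow>
      \<exists>b' L'. 0 \<le> b' \<and> 0 \<le> L' \<and> b' + \<beta> * L' \<le> \<rho> * (b + \<beta> * L) \<and> quasi_Lip 0 b' L' (evolve l m h)"
proof -
  obtain D where D: "D > 0" "\<And>x y. x \<in> K \<Longrightarrow> y \<in> K \<Longrightarrow> norm (x - y) \<le> D" using bounded_diam by blast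
  \<comment> \<open>Chosen so that q epsilon equals \<open>\<beta> / 4\<close> for the weight
    defined below; q cancels, so the value can be fixed before (RZ) is invoked.\<close>
  define \<epsilon> where "\<epsilon> = 1 / (8 * L0)"
  \<comment> \<open>Two histories in the small set differ by at most 2 delta in each of n
    coordinates, which costs epsilon/2 in the metric; the tail beyond n costs the other half. In the
    choice of n, positivity serves to make m positive.\<close>
  define \<delta> where "\<delta> = \<epsilon> * (1 - \<alpha>) / 4"
  have \<epsilon>: "\<epsilon> > 0" using L0_pos by (simp add: \<epsilon>_def)
  then have \<delta>: "\<delta> > 0" using \<alpha> by (simp add: \<delta>_def)
  have "\<forall>\<^sub>F n in sequentially. \<alpha> ^ n * D < \<epsilon> * (1 - \<alpha>) / 2 \<and> \<alpha> ^ n < 1 / 2 \<and> 0 < n"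
  proof (intro eventually_conj eventually_gt_at_top)
    have lim: "(\<lambda>n. \<alpha> ^ n) \<longlonglongrightarrow> 0" using \<alpha> by (intro LIMSEQ_power_zero) auto
    show "\<forall>\<^sub>F n in sequentially. \<alpha> ^ n < 1 / 2" by (rule order_tendstoD[OF lim]) simp
    have "(\<lambda>n. \<alpha> ^ n * D) \<longlonglongrightarrow> 0" using tendsto_mult_right[OF lim, of D] by simp
    then show "\<forall>\<^sub>F n in sequentially. \<alpha> ^ n * D < \<epsilon> * (1 - \<alpha>) / 2"
      using \<epsilon> \<alpha> by (intro order_tendstoD) auto
  qed
  then obtain n where "\<forall>k\<ge>n. \<alpha> ^ k * D < \<epsilon> * (1 - \<alpha>) / 2 \<and> \<alpha> ^ k < 1 / 2 \<and> 0 < k"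
    unfolding eventually_sequentially ..
  from this[rule_format, OF order_refl]
  have n: "\<alpha> ^ n * D < \<epsilon> * (1 - \<alpha>) / 2" "\<alpha> ^ n < 1 / 2" "0 < n" by simp_all
  obtain m p B where m: "m \<ge> n" and B: "B \<in> sets H" "\<And>z i. z \<in> B \<Longrightarrow> i < n \<Longrightarrow> norm (z i) < \<delta>"
    and p: "p > 0" "\<And>l x. x \<in> histories K \<Longrightarrow> p \<le> measure (distr (future_law K Q l x) H (extend_hist x m)) B"
    by (rule minorization[OF \<delta>, of n]) blast
  define q where "q = p\<^sup>2"
  have "p \<le> 1"
    using p(2)[OF zero_in_histories, of 0] prob_space.prob_le_1[OF prob_space.prob_space_distr[OF
      prob_space_future_law[OF zero_in_histories] measurable_extend_hist_future[OF zero_in_histories]]]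
    by (meson order_trans)
  then have q: "0 < q" "q \<le> 1" using p(1) by (simp_all add: q_def power_le_one)
  \<comment> \<open>With this weight \<open>\<beta> * L0 = q / 2\<close>: half of the gain q b in
    oscillation pays for the new Lipschitz constant, leaving the factor 1 - q/2. The Lipschitz part
    keeps the factor 1/4 + 1/2, which explains \<open>\<rho>\<close>.\<close>
  define \<beta> where "\<beta> = q / (2 * L0)"
  define \<rho> where "\<rho> = max (1 - q / 2) (3 / 4)"
  have \<beta>: "\<beta> > 0" using q L0_pos by (simp add: \<beta>_def)
  have \<alpha>m: "\<alpha> ^ m \<le> 1 / 2" using power_decreasing[OF m, of \<alpha>] \<alpha> n(2) by linarith
  have "\<exists>b' L'. 0 \<le> b' \<and> 0 \<le> L' \<and> b' + \<beta> * L' \<le> \<rho> * (b + \<beta> * L) \<and> quasi_Lip 0 b' L' (evolve l m h)"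
    if h: "quasi_Lip 0 b L h" and b: "0 \<le> b" and L: "0 \<le> L" for b L h l
  proof -
    note hD = quasi_LipD[OF h]
    define c where "c = min b (\<epsilon> * L)"
    let ?b = "(1 - q) * b + q * \<epsilon> * L" and ?L = "\<alpha> ^ m * L + L0 * b"
    have oscB: "\<bar>h u - h v\<bar> \<le> c" if "u \<in> B" "v \<in> B" for u v
    proof -
      have u: "u \<in> histories K" and v: "v \<in> histories K"
        using that sets.sets_into_space[OF B(1)] by (auto simp: space_hist_space)
      have "hist_dist \<alpha> u v \<le> (2 * \<delta> + \<alpha> ^ n * D) / (1 - \<alpha>)"
      proof (rule hist_dist_le[OF _ _ D(2)])
        fix i assume "i < n"
        then have "norm (u i) < \<delta>" "norm (v i) < \<delta>" using that B(2) by auto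
        then show "norm (u i - v i) \<le> 2 * \<delta>" using norm_triangle_ineq4[of "u i" "v i"] by linarith
      qed (use u v \<delta> in auto)
      also have "\<dots> \<le> \<epsilon>" using n(1) \<alpha> by (simp add: \<delta>_def divide_le_eq)
      finally have "L * hist_dist \<alpha> u v \<le> L * \<epsilon>" using L by (rule mult_left_mono)
      then show ?thesis using hD(2,3)[of u v] u v by (auto simp: c_def mult.commute)
    qed
    have "\<bar>evolve l m h x - evolve l m h y\<bar> \<le> ?b" if x: "x \<in> histories K" and y: "y \<in> histories K" for x y
    proof -
      have "\<bar>evolve l m h x - evolve l m h y\<bar> \<le> b - (b - c) * p\<^sup>2"
        unfolding evolve_eq_distr[OF hD(1) x] evolve_eq_distr[OF hD(1) y]
        using B(1) oscB p hD(1,2) x y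
        by (intro integral_diff_le_minorized[where B=B] prob_space.prob_space_distr
            prob_space_future_law measurable_extend_hist_future) (auto simp: space_hist_space c_def)
      also have "\<dots> = (1 - q) * b + q * c" by (simp add: q_def algebra_simps)
      also have "\<dots> \<le> ?b" using q by (simp add: c_def mult.assoc)
      finally show ?thesis .
    qed
    then have "quasi_Lip 0 ?b ?L (evolve l m h)"
      using evolve_quasi_Lip[OF h b L, of m l] by (simp add: quasi_Lip_def)
    moreover have "0 \<le> ?b" "0 \<le> ?L" using b L q \<epsilon> L0_pos \<alpha> by simp_all
    moreover have "?b + \<beta> * ?L \<le> \<rho> * (b + \<beta> * L)"
    proof -
      have *: "\<beta> * L0 = q / 2" "q * \<epsilon> = \<beta> / 4" using L0_pos by (simp_all add: \<beta>_def \<epsilon>_def field_simps)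
      have "?b + \<beta> * ?L = (1 - q) * b + (q * \<epsilon>) * L + (\<beta> * \<alpha> ^ m) * L + (\<beta> * L0) * b"
        by (simp add: algebra_simps)
      also have "\<dots> = (1 - q) * b + (\<beta> / 4) * L + (\<beta> * \<alpha> ^ m) * L + (q / 2) * b"
        by (simp only: *)
      also have "\<dots> \<le> (1 - q) * b + (\<beta> / 4) * L + (\<beta> * (1 / 2)) * L + (q / 2) * b"
        using \<alpha>m \<beta> L by (intro add_mono order_refl mult_right_mono mult_left_mono) auto
      also have "\<dots> = (1 - q / 2) * b + (3 / 4) * (\<beta> * L)" by (simp add: algebra_simps)
      also have "\<dots> \<le> \<rho> * b + \<rho> * (\<beta> * L)"
        using b L \<beta> by (intro add_mono mult_right_mono) (auto simp: \<rho>_def)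
      finally show ?thesis by (simp add: algebra_simps)
    qed
    ultimately show ?thesis by blast
  qed
  then show thesis using m n(3) q \<beta> by (intro that[of m \<rho> \<beta>]) (auto simp: \<rho>_def)
qed

text \<open>Write k = j m + r. The last r + s steps only regularize: they remove all s exceptional
  states and give a Lipschitz function with constant at most L + \<open>L0\<close> b. The first j
  blocks then contract. Since s is spent in the regularization alone, the constants do not depend on
  it.\<close>

lemma exponential_loss_of_memory:
  obtains \<gamma> A where "\<gamma> > 0" "A > 0" "\<And>s b L h l k x y. quasi_Lip s b L h \<Longrightarrow> 0 \<le> b \<Longrightarrow> 0 \<le> L \<Longrightarrow>
    x \<in> histories K \<Longrightarrow> y \<in> histories K \<Longrightarrow>
    \<bar>evolve l (k + s) h x - evolve l (k + s) h y\<bar> \<le> A * exp (- \<gamma> * real k) * (b + L)"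
proof -
  obtain m \<rho> \<beta> where m: "m > 0" and \<rho>: "0 < \<rho>" "\<rho> < 1" and \<beta>: "\<beta> > 0"
    and contr: "\<And>b L h l. quasi_Lip 0 b L h \<Longrightarrow> 0 \<le> b \<Longrightarrow> 0 \<le> L \<Longrightarrow>
      \<exists>b' L'. 0 \<le> b' \<and> 0 \<le> L' \<and> b' + \<beta> * L' \<le> \<rho> * (b + \<beta> * L) \<and> quasi_Lip 0 b' L' (evolve l m h)"
    by (rule block_contraction) blast
  have iter: "\<bar>evolve l (j * m) h x - evolve l (j * m) h y\<bar> \<le> \<rho> ^ j * (b + \<beta> * L)"
    if "quasi_Lip 0 b L h" "0 \<le> b" "0 \<le> L" "x \<in> histories K" "y \<in> histories K" for j b L h l x y
    using that
  proof (induction j arbitrary: b L h)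
    case 0
    have "0 \<le> \<beta> * L" using 0 \<beta> by simp
    then show ?case using 0 quasi_LipD(2)[OF 0(1,4,5)] by (simp add: evolve_0)
  next
    case (Suc j)
    obtain b' L' where bL: "0 \<le> b'" "0 \<le> L'" "b' + \<beta> * L' \<le> \<rho> * (b + \<beta> * L)"
      "quasi_Lip 0 b' L' (evolve (l + int (j * m)) m h)"
      using contr[OF Suc.prems(1-3)] by blast
    have "evolve l (Suc j * m) h z = evolve l (j * m) (evolve (l + int (j * m)) m h) z" if "z \<in> histories K" for z
      using evolve_add[OF quasi_LipD(1)[OF Suc.prems(1)] quasi_Lip_bound[OF Suc.prems(1)] that, of l "j * m" m]
      by (simp add: add.commute)
    then have "\<bar>evolve l (Suc j * m) h x - evolve l (Suc j * m) h y\<bar> \<le> \<rho> ^ j * (b' + \<beta> * L')"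
      using Suc.IH[OF bL(4,1,2) Suc.prems(4,5)] Suc.prems(4,5) by simp
    also have "\<dots> \<le> \<rho> ^ j * (\<rho> * (b + \<beta> * L))" using bL(3) \<rho> by (intro mult_left_mono) auto
    finally show ?case by (simp add: mult_ac)
  qed
  \<comment> \<open>One block of m steps contracts by \<open>\<rho>\<close>, that is, exp(- gamma m)
    equals \<open>\<rho>\<close>.\<close>
  define \<gamma> where "\<gamma> = - ln \<rho> / real m"
  \<comment> \<open>The division by \<open>\<rho>\<close> compensates the incomplete block of r
    steps; the numerator is a generous factor bounding b + beta (L + \<open>L0\<close> b) by a
    multiple of b + L.\<close>
  define A where "A = (1 + \<beta> + \<beta> * (1 + L0) * (1 + L0)) / \<rho>"
  have \<gamma>: "\<gamma> > 0" using \<rho> m by (simp add: \<gamma>_def divide_neg_pos)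
  have A: "A > 0" using \<rho> \<beta> L0_pos by (simp add: A_def add_pos_pos)
  have "\<bar>evolve l (k + s) h x - evolve l (k + s) h y\<bar> \<le> A * exp (- \<gamma> * real k) * (b + L)"
    if h: "quasi_Lip s b L h" and b: "0 \<le> b" and L: "0 \<le> L"
      and x: "x \<in> histories K" and y: "y \<in> histories K" for s b L h l k x y
  proof -
    define j where "j = k div m"
    define r where "r = k mod m"
    define g where "g = evolve (l + int (j * m)) (r + s) h"
    have k: "k = j * m + r" by (simp add: j_def r_def)
    have g: "quasi_Lip 0 b (\<alpha> ^ (r + s) * L + L0 * b) g"
      unfolding g_def using evolve_quasi_Lip[OF h b L, of "r + s" "l + int (j * m)"] by simp
    have "\<alpha> ^ (r + s) * L \<le> 1 * L" using \<alpha> L by (intro mult_right_mono power_le_one) auto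
    then have g': "quasi_Lip 0 b (L + L0 * b) g" by (intro quasi_Lip_mono[OF g]) auto
    have ev: "evolve l (k + s) h z = evolve l (j * m) g z" if "z \<in> histories K" for z
      unfolding g_def using evolve_add[OF quasi_LipD(1)[OF h] quasi_Lip_bound[OF h] that, of l "j * m" "r + s"]
      by (simp add: k add.assoc)
    have "\<bar>evolve l (k + s) h x - evolve l (k + s) h y\<bar> \<le> \<rho> ^ j * (b + \<beta> * (L + L0 * b))"
      using iter[OF g' b _ x y, of l j] b L L0_pos by (simp add: ev x y)
    also have "\<dots> \<le> (exp (- \<gamma> * real k) / \<rho>) * ((1 + \<beta> + \<beta> * (1 + L0) * (1 + L0)) * (b + L))"
    proof (rule mult_mono)
      have "real k \<le> real m * (real j + 1)"
      proof -
        have "r < m" using m by (simp add: r_def)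
        then have "k \<le> m * (j + 1)" by (simp add: k algebra_simps)
        then show ?thesis by (metis of_nat_1 of_nat_add of_nat_le_iff of_nat_mult)
      qed
      then have "real j + 1 \<ge> real k / real m" using m by (simp add: field_simps)
      then have "(real j + 1) * ln \<rho> \<le> (real k / real m) * ln \<rho>"
        using \<rho> by (intro mult_right_mono_neg) auto
      then have "exp ((real j + 1) * ln \<rho>) \<le> exp (- \<gamma> * real k)" by (simp add: \<gamma>_def field_simps)
      moreover have "exp ((real j + 1) * ln \<rho>) = \<rho> ^ j * \<rho>"
        using \<rho> by (simp add: distrib_right exp_add exp_of_nat_mult)
      ultimately show "\<rho> ^ j \<le> exp (- \<gamma> * real k) / \<rho>" using \<rho> by (simp add: pos_le_divide_eq)
      have "0 \<le> \<beta> * b" "0 \<le> \<beta> * L0 * b" "0 \<le> \<beta> * L0 * L" "0 \<le> \<beta> * L0 * L0 * b" "0 \<le> \<beta> * L0 * L0 * L" "0 \<le> \<beta> * L"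
        using \<beta> L0_pos b L by simp_all
      then show "b + \<beta> * (L + L0 * b) \<le> (1 + \<beta> + \<beta> * (1 + L0) * (1 + L0)) * (b + L)"
        using L by (simp add: algebra_simps)
      show "0 \<le> b + \<beta> * (L + L0 * b)" using \<beta> L0_pos b L by simp
    qed (use \<rho> in auto)
    finally show ?thesis by (simp add: A_def mult_ac)
  qed
  with \<gamma> A show thesis by (rule that)
qed

end

subsection \<open>Processes with prescribed transitions\<close>

lemma history_Suc: "history \<xi> (k + 1) w = case_nat (\<xi> (k + 1) w) (history \<xi> k w)"
  by (auto simp: history_def fun_eq_iff algebra_simps split: nat.splits)

context history_kernels
begin

lemma measurable_history:
  assumes "random_process K M \<xi>"
  shows "history \<xi> t \<in> M \<rightarrow>\<^sub>M H"
  unfolding hist_space_def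
proof (rule measurable_PiM_single')
  show m: "(\<lambda>w. history \<xi> t w i) \<in> M \<rightarrow>\<^sub>M S" for i
    using assms by (simp add: history_def random_process_def)
  show "history \<xi> t \<in> space M \<rightarrow> (\<Pi>\<^sub>E i\<in>UNIV. space S)"
    using measurable_space[OF m] by auto
qed

lemma prob_space_history:
  assumes "random_process K M \<xi>"
  shows "prob_space (distr M H (history \<xi> t))"
  using assms by (intro prob_space.prob_space_distr measurable_history) (auto simp: random_process_def)

lemma integral_bind_cons_kernel:
  assumes N: "prob_space N" "sets N = sets H"
    and h: "h \<in> borel_measurable H" "\<And>x. x \<in> histories K \<Longrightarrow> \<bar>h x\<bar> \<le> b"
  shows "integral\<^sup>L (N \<bind> cons_kernel k) h = integral\<^sup>L N (step_op k h)"
  unfolding step_op_def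
proof (rule integral_bind[where K=H and B=b and B'=1])
  interpret N: prob_space N by fact
  show "finite_measure N" by unfold_locales
  show "cons_kernel k \<in> N \<rightarrow>\<^sub>M subprob_algebra H"
    using measurable_prob_algebraD[OF measurable_cons_kernel] N(2) by (simp cong: measurable_cong_sets)
  show "AE x in N. emeasure (cons_kernel k x) (space (cons_kernel k x)) \<le> ennreal 1"
    using prob_space_cons_kernel[THEN prob_space.emeasure_space_1] sets_eq_imp_space_eq[OF N(2)]
    by (intro AE_I2) (simp add: space_hist_space)
qed (use h in \<open>auto simp: space_hist_space\<close>)

lemma prob_space_bind_cons_kernel:
  assumes N: "prob_space N" "sets N = sets H"
  shows "prob_space (N \<bind> cons_kernel k)" "sets (N \<bind> cons_kernel k) = sets H"
proof -
  interpret N: prob_space N by fact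
  have sp: "space N = histories K" using sets_eq_imp_space_eq[OF N(2)] by (simp add: space_hist_space)
  have m: "cons_kernel k \<in> N \<rightarrow>\<^sub>M subprob_algebra H"
    using measurable_prob_algebraD[OF measurable_cons_kernel] N(2) by (simp cong: measurable_cong_sets)
  show "prob_space (N \<bind> cons_kernel k)"
    using prob_space_cons_kernel sp by (intro N.prob_space_bind[OF _ m] AE_I2) simp
  show "sets (N \<bind> cons_kernel k) = sets H"
    by (rule sets_bind[OF _ N.not_empty]) (simp add: cons_kernel_def)
qed

text \<open>Rectangles in the pair (newest state, older history). Conditional expectations are
  tested on them, and every finite-dimensional box of histories is one of them.\<close>

definition cons_event :: "'e set \<Rightarrow> (nat \<Rightarrow> 'e) set \<Rightarrow> (nat \<Rightarrow> 'e) set" where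
  "cons_event \<Gamma> B = {z \<in> space H. z 0 \<in> \<Gamma> \<and> (\<lambda>i. z (Suc i)) \<in> B}"

lemma sets_cons_event:
  assumes "\<Gamma> \<in> sets S" "B \<in> sets H"
  shows "cons_event \<Gamma> B \<in> sets H"
proof -
  have 1: "(\<lambda>z. z 0) \<in> H \<rightarrow>\<^sub>M S" unfolding hist_space_def by (rule measurable_component_singleton) simp
  have 2: "(\<lambda>z i. z (Suc i)) \<in> H \<rightarrow>\<^sub>M H"
    unfolding hist_space_def
    by (rule measurable_PiM_single') (auto simp: space_PiM intro!: measurable_component_singleton)
  have "cons_event \<Gamma> B = ((\<lambda>z. z 0) -` \<Gamma> \<inter> space H) \<inter> ((\<lambda>z i. z (Suc i)) -` B \<inter> space H)"
    by (auto simp: cons_event_def)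
  then show ?thesis using measurable_sets[OF 1 assms(1)] measurable_sets[OF 2 assms(2)] by simp
qed

lemma cons_event_iff:
  "x \<in> histories K \<Longrightarrow> y \<in> K \<Longrightarrow> case_nat y x \<in> cons_event \<Gamma> B \<longleftrightarrow> y \<in> \<Gamma> \<and> x \<in> B"
  using cons_in_histories[of x y] by (simp add: cons_event_def space_hist_space)

text \<open>Evaluates on rectangles the two laws to be compared, the actual one at time k + 1 and
  the one produced by the kernel. Equality of the two integrals is the defining property of the
  conditional expectation, which allows passage in both directions.\<close>

lemma measure_next_history:
  assumes P: "random_process K M \<xi>" and \<Gamma>: "\<Gamma> \<in> sets S" and B: "B \<in> sets H"
  shows "measure (distr M H (history \<xi> (k + 1))) (cons_event \<Gamma> B)
      = (\<integral>w. indicator B (history \<xi> k w) * indicator \<Gamma> (\<xi> (k + 1) w) \<partial>M)"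
    and "measure (distr M H (history \<xi> k) \<bind> cons_kernel k) (cons_event \<Gamma> B)
      = (\<integral>w. indicator B (history \<xi> k w) * measure (Q k (history \<xi> k w)) \<Gamma> \<partial>M)"
proof -
  interpret M: prob_space M using P by (simp add: random_process_def)
  let ?G = "cons_event \<Gamma> B"
  have G: "?G \<in> sets H" using \<Gamma> B by (rule sets_cons_event)
  have hist: "history \<xi> t w \<in> histories K" if "w \<in> space M" for t w
    using measurable_space[OF measurable_history[OF P] that] by (simp add: space_hist_space)
  have \<xi>: "\<xi> t w \<in> K" if "w \<in> space M" for t w
    using P that measurable_space[of "\<xi> t" M S w] by (simp add: random_process_def)
  have "measure (distr M H (history \<xi> (k + 1))) ?G = (\<integral>z. indicator ?G z \<partial>distr M H (history \<xi> (k + 1)))"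
    using G sets.sets_into_space[OF G] by (simp add: Int_absorb2)
  also have "\<dots> = (\<integral>w. indicator ?G (history \<xi> (k + 1) w) \<partial>M)"
    using G by (intro integral_distr measurable_history[OF P]) simp
  also have "\<dots> = (\<integral>w. indicator B (history \<xi> k w) * indicator \<Gamma> (\<xi> (k + 1) w) \<partial>M)"
    using cons_event_iff[OF hist \<xi>]
    by (intro Bochner_Integration.integral_cong refl) (auto simp: history_Suc indicator_def)
  finally show "measure (distr M H (history \<xi> (k + 1))) ?G
      = (\<integral>w. indicator B (history \<xi> k w) * indicator \<Gamma> (\<xi> (k + 1) w) \<partial>M)" .
  note N = prob_space_history[OF P, of k]
  note bind = prob_space_bind_cons_kernel[OF N sets_distr, of k]
  have step: "step_op k (indicator ?G) x = indicator B x * measure (Q k x) \<Gamma>" if x: "x \<in> histories K" for x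
  proof -
    interpret Q: prob_space "Q k x" by (rule Q_props[OF x])
    have "step_op k (indicator ?G) x = (\<integral>y. indicator B x * indicator \<Gamma> y \<partial>Q k x)"
      unfolding step_op_eq[OF borel_measurable_indicator[OF G] x] using cons_event_iff[OF x]
      by (intro Bochner_Integration.integral_cong refl) (auto simp: indicator_def Q_props(3)[OF x])
    also have "\<dots> = indicator B x * measure (Q k x) \<Gamma>"
      using \<Gamma> sets.sets_into_space[OF \<Gamma>] by (simp add: Q_props(2,3)[OF x] Int_absorb2)
    finally show ?thesis .
  qed
  have "measure (distr M H (history \<xi> k) \<bind> cons_kernel k) ?G = (\<integral>z. indicator ?G z \<partial>(distr M H (history \<xi> k) \<bind> cons_kernel k))"
    using G sets.sets_into_space[OF G] sets_eq_imp_space_eq[OF bind(2)] by (simp add: Int_absorb2)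
  also have "\<dots> = (\<integral>x. step_op k (indicator ?G) x \<partial>distr M H (history \<xi> k))"
    using G by (intro integral_bind_cons_kernel[where b=1] N) auto
  also have "\<dots> = (\<integral>w. step_op k (indicator ?G) (history \<xi> k w) \<partial>M)"
    using G by (intro integral_distr measurable_history[OF P] measurable_step_op) simp
  also have "\<dots> = (\<integral>w. indicator B (history \<xi> k w) * measure (Q k (history \<xi> k w)) \<Gamma> \<partial>M)"
    using hist step by (intro Bochner_Integration.integral_cong refl) simp
  finally show "measure (distr M H (history \<xi> k) \<bind> cons_kernel k) ?G
      = (\<integral>w. indicator B (history \<xi> k w) * measure (Q k (history \<xi> k w)) \<Gamma> \<partial>M)" .
qed

lemma finite_measure_subalgebra_history:
  assumes P: "random_process K M \<xi>"
  shows "finite_measure_subalgebra M (vimage_algebra (space M) (history \<xi> k) H)"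
proof -
  interpret M: prob_space M using P by (simp add: random_process_def)
  show ?thesis
    using measurable_history[OF P, of k] by unfold_locales (simp add: subalgebra_def measurable_iff_sets)
qed

lemma measurable_Q_measure: "\<Gamma> \<in> sets S \<Longrightarrow> (\<lambda>x. measure (Q k x) \<Gamma>) \<in> borel_measurable H"
  by (rule measurable_compose[OF measurable_prob_algebraD[OF measurable_Q] measurable_measure_subprob_algebra])

text \<open>Every event of the sigma-algebra generated by the history is a preimage of some
  \<open>B\<close>, so equality of laws on rectangles characterizes the conditional
  expectation.\<close>

lemma bind_imp_has_transitions:
  assumes P: "random_process K M \<xi>"
    and bind: "\<And>k. distr M H (history \<xi> (k + 1)) = distr M H (history \<xi> k) \<bind> cons_kernel k"
  shows "has_transitions K Q M \<xi>"
  unfolding has_transitions_def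
proof (intro allI ballI)
  fix k \<Gamma> assume \<Gamma>: "\<Gamma> \<in> sets S"
  interpret M: prob_space M using P by (simp add: random_process_def)
  let ?F = "vimage_algebra (space M) (history \<xi> k) H"
  interpret finite_measure_subalgebra M ?F by (rule finite_measure_subalgebra_history[OF P])
  have hm: "history \<xi> k \<in> M \<rightarrow>\<^sub>M H" by (rule measurable_history[OF P])
  have hF: "history \<xi> k \<in> ?F \<rightarrow>\<^sub>M H" using measurable_space[OF hm] by (intro measurable_vimage_algebra1) auto
  have \<xi>m: "\<xi> (k + 1) \<in> M \<rightarrow>\<^sub>M S" using P by (simp add: random_process_def)
  have hist: "history \<xi> k w \<in> histories K" if "w \<in> space M" for w
    using measurable_space[OF hm that] by (simp add: space_hist_space)
  show "AE w in M. real_cond_exp M ?F (\<lambda>w. indicator \<Gamma> (\<xi> (k + 1) w)) w = measure (Q k (history \<xi> k w)) \<Gamma>"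
  proof (rule real_cond_exp_charact)
    show "(\<lambda>w. measure (Q k (history \<xi> k w)) \<Gamma>) \<in> borel_measurable ?F"
      by (rule measurable_compose[OF hF measurable_Q_measure[OF \<Gamma>]])
    have i: "(\<lambda>w. indicator \<Gamma> (\<xi> (k + 1) w) :: real) \<in> borel_measurable M"
      by (rule measurable_compose[OF \<xi>m borel_measurable_indicator[OF \<Gamma>]])
    show "integrable M (\<lambda>w. indicator \<Gamma> (\<xi> (k + 1) w) :: real)"
      by (rule M.integrable_const_bound[where B=1, OF _ i]) simp
    show "integrable M (\<lambda>w. measure (Q k (history \<xi> k w)) \<Gamma>)"
      using hist Q_props(1)[THEN prob_space.prob_le_1]
      by (intro M.integrable_const_bound[where B=1] AE_I2 measurable_compose[OF hm measurable_Q_measure[OF \<Gamma>]]) auto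
    fix A assume "A \<in> sets ?F"
    then obtain B where B: "B \<in> sets H" "A = history \<xi> k -` B \<inter> space M"
      using measurable_space[OF hm] by (auto simp: sets_vimage_algebra2)
    have "(\<integral>w\<in>A. f w \<partial>M) = (\<integral>w. indicator B (history \<xi> k w) * f w \<partial>M)" for f :: "_ \<Rightarrow> real"
      unfolding set_lebesgue_integral_def B(2)
      by (intro Bochner_Integration.integral_cong refl) (auto simp: indicator_def)
    then show "(\<integral>w\<in>A. indicator \<Gamma> (\<xi> (k + 1) w) \<partial>M) = (\<integral>w\<in>A. measure (Q k (history \<xi> k w)) \<Gamma> \<partial>M)"
      using measure_next_history[OF P \<Gamma> B(1), of k] bind by simp
  qed
qed

lemma hist_measure_eqI:
  assumes N: "prob_space N" "sets N = sets H" and N': "prob_space N'" "sets N' = sets H"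
    and eq: "\<And>J A. finite J \<Longrightarrow> (\<And>i. i \<in> J \<Longrightarrow> A i \<in> sets S) \<Longrightarrow>
      measure N {z \<in> space H. \<forall>i\<in>J. z i \<in> A i} = measure N' {z \<in> space H. \<forall>i\<in>J. z i \<in> A i}"
  shows "N = N'"
proof (rule measure_eqI_PiM_infinite)
  interpret N: prob_space N by fact
  interpret N': prob_space N' by fact
  show "finite_measure N" by unfold_locales
  fix A and J :: "nat set" assume JA: "finite J" "\<And>i. i \<in> J \<Longrightarrow> A i \<in> sets S"
  have "prod_emb UNIV (\<lambda>_. S) J (Pi\<^sub>E J A) = {z \<in> space H. \<forall>i\<in>J. z i \<in> A i}"
    by (auto simp: prod_emb_eq_restrict_vimage hist_space_def)
  then show "emeasure N (prod_emb UNIV (\<lambda>_. S) J (Pi\<^sub>E J A)) = emeasure N' (prod_emb UNIV (\<lambda>_. S) J (Pi\<^sub>E J A))"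
    using eq[OF JA] by (simp add: N.emeasure_eq_measure N'.emeasure_eq_measure)
qed (use N N' in \<open>simp_all add: hist_space_def\<close>)

lemma sets_box:
  assumes "finite J" "\<And>i. i \<in> J \<Longrightarrow> A i \<in> sets S"
  shows "{z \<in> space H. \<forall>i\<in>J. z i \<in> A i} \<in> sets H"
proof -
  have "{z \<in> space H. z i \<in> A i} \<in> sets H" if "i \<in> J" for i
    using measurable_sets[OF measurable_component_singleton[of i UNIV "\<lambda>_. S"] assms(2)[OF that]]
    by (simp add: hist_space_def vimage_def Int_def conj_commute)
  then show ?thesis using assms(1) by (rule sets.sets_Collect_finite_All)
qed

text \<open>Turns almost sure identities, one for each \<open>\<Gamma>\<close>, into a single
  identity of laws that can be iterated. Boxes suffice, as they generate the sigma-algebra and are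
  closed under intersection.\<close>

lemma has_transitions_imp_bind:
  assumes P: "random_process K M \<xi>" and trans: "has_transitions K Q M \<xi>"
  shows "distr M H (history \<xi> (k + 1)) = distr M H (history \<xi> k) \<bind> cons_kernel k"
proof (rule hist_measure_eqI)
  show "prob_space (distr M H (history \<xi> (k + 1)))" by (rule prob_space_history[OF P])
  show "prob_space (distr M H (history \<xi> k) \<bind> cons_kernel k)"
    and "sets (distr M H (history \<xi> k) \<bind> cons_kernel k) = sets H"
    by (rule prob_space_bind_cons_kernel[OF prob_space_history[OF P] sets_distr])+
  fix A and J :: "nat set" assume J: "finite J" and A: "\<And>i. i \<in> J \<Longrightarrow> A i \<in> sets S"
  \<comment> \<open>A box that says nothing about the newest state is a rectangle whose first factor
    is all of \<open>K\<close>.\<close>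
  define \<Gamma> where "\<Gamma> = (if 0 \<in> J then A 0 else K)"
  define B where "B = {z \<in> space H. \<forall>i\<in>Suc -` J. z i \<in> A (Suc i)}"
  have \<Gamma>: "\<Gamma> \<in> sets S" using A sets.top[of S] by (simp add: \<Gamma>_def)
  have B: "B \<in> sets H" unfolding B_def using J A by (intro sets_box finite_vimageI) auto
  have G: "{z \<in> space H. \<forall>i\<in>J. z i \<in> A i} = cons_event \<Gamma> B"
  proof (intro set_eqI)
    fix z
    have "(\<forall>i\<in>J. z i \<in> A i) \<longleftrightarrow> (0 \<in> J \<longrightarrow> z 0 \<in> A 0) \<and> (\<forall>i. Suc i \<in> J \<longrightarrow> z (Suc i) \<in> A (Suc i))"
      by (metis not0_implies_Suc)
    then show "z \<in> {z \<in> space H. \<forall>i\<in>J. z i \<in> A i} \<longleftrightarrow> z \<in> cons_event \<Gamma> B"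
      by (auto simp: cons_event_def \<Gamma>_def B_def space_hist_space)
  qed
  interpret M: prob_space M using P by (simp add: random_process_def)
  let ?F = "vimage_algebra (space M) (history \<xi> k) H"
  interpret finite_measure_subalgebra M ?F by (rule finite_measure_subalgebra_history[OF P])
  have hm: "history \<xi> k \<in> M \<rightarrow>\<^sub>M H" by (rule measurable_history[OF P])
  have hF: "history \<xi> k \<in> ?F \<rightarrow>\<^sub>M H" using measurable_space[OF hm] by (intro measurable_vimage_algebra1) auto
  have \<xi>m: "\<xi> (k + 1) \<in> M \<rightarrow>\<^sub>M S" using P by (simp add: random_process_def)
  let ?f = "\<lambda>w. indicator B (history \<xi> k w) :: real" and ?g = "\<lambda>w. indicator \<Gamma> (\<xi> (k + 1) w) :: real"
  have f: "?f \<in> borel_measurable ?F" by (rule measurable_compose[OF hF borel_measurable_indicator[OF B]])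
  have fM: "?f \<in> borel_measurable M" by (rule measurable_compose[OF hm borel_measurable_indicator[OF B]])
  have g: "?g \<in> borel_measurable M" by (rule measurable_compose[OF \<xi>m borel_measurable_indicator[OF \<Gamma>]])
  have "integrable M (\<lambda>w. ?f w * ?g w)"
    using fM g by (intro M.integrable_const_bound[where B=1] AE_I2 borel_measurable_times) (auto simp: indicator_def)
  then have "(\<integral>w. ?f w * ?g w \<partial>M) = (\<integral>w. ?f w * real_cond_exp M ?F ?g w \<partial>M)"
    by (rule real_cond_exp_intg(2)[OF _ f g, symmetric])
  also have "\<dots> = (\<integral>w. ?f w * measure (Q k (history \<xi> k w)) \<Gamma> \<partial>M)"
  proof (rule integral_cong_AE)
    show "AE w in M. ?f w * real_cond_exp M ?F ?g w = ?f w * measure (Q k (history \<xi> k w)) \<Gamma>"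
      using trans \<Gamma> unfolding has_transitions_def by fastforce
    show "(\<lambda>w. ?f w * real_cond_exp M ?F ?g w) \<in> borel_measurable M"
      using fM by (intro borel_measurable_times borel_measurable_cond_exp2)
    show "(\<lambda>w. ?f w * measure (Q k (history \<xi> k w)) \<Gamma>) \<in> borel_measurable M"
      using fM by (intro borel_measurable_times measurable_compose[OF hm measurable_Q_measure[OF \<Gamma>]])
  qed
  finally show "measure (distr M H (history \<xi> (k + 1))) {z \<in> space H. \<forall>i\<in>J. z i \<in> A i}
      = measure (distr M H (history \<xi> k) \<bind> cons_kernel k) {z \<in> space H. \<forall>i\<in>J. z i \<in> A i}"
    unfolding G measure_next_history[OF P \<Gamma> B] .
qed simp

text \<open>The tower property, one step at a time: \<open>evolve t n h\<close> plays the role of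
  the conditional expectation of h given the history at time t.\<close>

lemma expectation_evolve:
  assumes P: "random_process K M \<xi>" and trans: "has_transitions K Q M \<xi>"
    and h: "h \<in> borel_measurable H" "\<And>x. x \<in> histories K \<Longrightarrow> \<bar>h x\<bar> \<le> b"
  shows "(\<integral>w. h (history \<xi> (t + int n) w) \<partial>M) = (\<integral>w. evolve t n h (history \<xi> t w) \<partial>M)"
  using h
proof (induction n arbitrary: h)
  have hist: "history \<xi> t w \<in> histories K" if "w \<in> space M" for w
    using measurable_space[OF measurable_history[OF P] that] by (simp add: space_hist_space)
  {
    case 0
    then show ?case
      using hist by (intro Bochner_Integration.integral_cong refl) (simp add: evolve_0)
  next
    case (Suc n)
    have "(\<integral>w. h (history \<xi> (t + int (Suc n)) w) \<partial>M) = integral\<^sup>L (distr M H (history \<xi> (t + int n + 1))) h"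
      using integral_distr[OF measurable_history[OF P] Suc.prems(1)] by (simp add: add_ac)
    also have "\<dots> = integral\<^sup>L (distr M H (history \<xi> (t + int n))) (step_op (t + int n) h)"
      unfolding has_transitions_imp_bind[OF P trans]
      by (rule integral_bind_cons_kernel[OF prob_space_history[OF P] sets_distr Suc.prems])
    also have "\<dots> = (\<integral>w. step_op (t + int n) h (history \<xi> (t + int n) w) \<partial>M)"
      using Suc.prems(1) by (intro integral_distr measurable_history[OF P] measurable_step_op)
    also have "\<dots> = (\<integral>w. evolve t n (step_op (t + int n) h) (history \<xi> t w) \<partial>M)"
      using step_op_bound[OF Suc.prems] by (intro Suc.IH measurable_step_op Suc.prems)
    also have "\<dots> = (\<integral>w. evolve t (Suc n) h (history \<xi> t w) \<partial>M)"
      using hist evolve_Suc[OF Suc.prems]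
      by (intro Bochner_Integration.integral_cong refl) simp
    finally show ?case .
  }
qed

lemma measurable_select: "(\<lambda>x. \<lambda>j\<in>J. x (\<sigma> j)) \<in> H \<rightarrow>\<^sub>M PiM J (\<lambda>_. S)"
  unfolding hist_space_def by (intro measurable_restrict measurable_component_singleton) simp

lemma quasi_Lip_select:
  assumes f: "f \<in> borel_measurable (PiM J (\<lambda>_. S))"
    and osc: "\<And>u v. u \<in> space (PiM J (\<lambda>_. S)) \<Longrightarrow> v \<in> space (PiM J (\<lambda>_. S)) \<Longrightarrow> \<bar>f u - f v\<bar> \<le> b"
    and \<sigma>: "\<And>j. j \<in> J \<Longrightarrow> \<sigma> j < s"
  shows "quasi_Lip s b 0 (\<lambda>x. f (\<lambda>j\<in>J. x (\<sigma> j)))"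
  unfolding quasi_Lip_def
proof (intro conjI ballI impI)
  have m: "(\<lambda>x. \<lambda>j\<in>J. x (\<sigma> j)) \<in> H \<rightarrow>\<^sub>M PiM J (\<lambda>_. S)" by (rule measurable_select)
  then show "(\<lambda>x. f (\<lambda>j\<in>J. x (\<sigma> j))) \<in> borel_measurable H" using f by (rule measurable_compose)
  fix x y assume "x \<in> histories K" "y \<in> histories K"
  then show "\<bar>f (\<lambda>j\<in>J. x (\<sigma> j)) - f (\<lambda>j\<in>J. y (\<sigma> j))\<bar> \<le> b"
    using measurable_space[OF m] by (intro osc) (simp_all add: space_hist_space)
  assume "\<forall>i<s. x i = y i"
  then have "(\<lambda>j\<in>J. x (\<sigma> j)) = (\<lambda>j\<in>J. y (\<sigma> j))" using \<sigma> by (auto simp: fun_eq_iff)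
  then show "\<bar>f (\<lambda>j\<in>J. x (\<sigma> j)) - f (\<lambda>j\<in>J. y (\<sigma> j))\<bar> \<le> 0 * hist_dist \<alpha> x y" by simp
qed

end

subsection \<open>Uniqueness and existence\<close>

lemma tendsto_exp_neg_nat:
  fixes \<gamma> c :: real
  assumes "\<gamma> > 0" shows "(\<lambda>k. c * exp (- \<gamma> * real k)) \<longlonglongrightarrow> 0"
proof -
  have "(\<lambda>k. c * exp (- \<gamma>) ^ k) \<longlonglongrightarrow> c * 0"
    using assms by (intro tendsto_intros LIMSEQ_power_zero) simp
  then show ?thesis by (simp add: exp_of_nat2_mult[symmetric] mult.commute)
qed

context mixing_kernels
begin

text \<open>Seen from k + s steps earlier, both expectations average the same function
  \<open>evolve ?l ?n h\<close>, only over different laws of the remote history. Its oscillation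
  tends to 0 as k grows.\<close>

lemma expectation_unique:
  assumes P: "random_process K M \<xi>" "has_transitions K Q M \<xi>"
    and P': "random_process K M' \<xi>'" "has_transitions K Q M' \<xi>'"
    and h: "quasi_Lip s b L h" "0 \<le> b" "0 \<le> L"
  shows "(\<integral>w. h (history \<xi> t w) \<partial>M) = (\<integral>w. h (history \<xi>' t w) \<partial>M')"
proof -
  obtain \<gamma> A where \<gamma>: "\<gamma> > 0" and A: "\<And>s b L h l k x y. quasi_Lip s b L h \<Longrightarrow> 0 \<le> b \<Longrightarrow> 0 \<le> L \<Longrightarrow>
    x \<in> histories K \<Longrightarrow> y \<in> histories K \<Longrightarrow>
    \<bar>evolve l (k + s) h x - evolve l (k + s) h y\<bar> \<le> A * exp (- \<gamma> * real k) * (b + L)"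
    by (rule exponential_loss_of_memory) blast
  note hb = quasi_LipD(1)[OF h(1)] quasi_Lip_bound[OF h(1)]
  let ?d = "\<bar>(\<integral>w. h (history \<xi> t w) \<partial>M) - (\<integral>w. h (history \<xi>' t w) \<partial>M')\<bar>"
  have "?d \<le> (A * (b + L)) * exp (- \<gamma> * real k)" for k
  proof -
    let ?l = "t - int (k + s)" and ?n = "k + s"
    have t: "t = ?l + int ?n" by simp
    have ev: "evolve ?l ?n h \<in> borel_measurable H" by (rule measurable_evolve[OF hb])
    have "(\<integral>w. h (history \<xi> t w) \<partial>M) = (\<integral>w. evolve ?l ?n h (history \<xi> ?l w) \<partial>M)"
      using expectation_evolve[OF P hb, of ?l ?n] t by simp
    moreover have "(\<integral>w. h (history \<xi>' t w) \<partial>M') = (\<integral>w. evolve ?l ?n h (history \<xi>' ?l w) \<partial>M')"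
      using expectation_evolve[OF P' hb, of ?l ?n] t by simp
    moreover have "\<bar>(\<integral>w. evolve ?l ?n h (history \<xi> ?l w) \<partial>M) - (\<integral>w. evolve ?l ?n h (history \<xi>' ?l w) \<partial>M')\<bar>
        \<le> A * exp (- \<gamma> * real k) * (b + L)"
    proof (rule integral_diff_le_pairwise)
      show "prob_space M" "prob_space M'" using P(1) P'(1) by (simp_all add: random_process_def)
      show "(\<lambda>w. evolve ?l ?n h (history \<xi> ?l w)) \<in> borel_measurable M"
        by (rule measurable_compose[OF measurable_history[OF P(1)] ev])
      show "(\<lambda>w. evolve ?l ?n h (history \<xi>' ?l w)) \<in> borel_measurable M'"
        by (rule measurable_compose[OF measurable_history[OF P'(1)] ev])
      fix u v assume "u \<in> space M" "v \<in> space M'"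
      then show "\<bar>evolve ?l ?n h (history \<xi> ?l u) - evolve ?l ?n h (history \<xi>' ?l v)\<bar> \<le> A * exp (- \<gamma> * real k) * (b + L)"
        using measurable_space[OF measurable_history[OF P(1)]] measurable_space[OF measurable_history[OF P'(1)]]
        by (intro A h) (simp_all add: space_hist_space)
    qed
    ultimately show ?thesis by (simp add: mult_ac)
  qed
  then have "?d \<le> 0" by (intro LIMSEQ_le_const[OF tendsto_exp_neg_nat[OF \<gamma>]]) blast
  then show ?thesis by simp
qed

lemma process_law_unique:
  assumes P: "random_process K M \<xi>" "has_transitions K Q M \<xi>"
    and P': "random_process K M' \<xi>'" "has_transitions K Q M' \<xi>'"
  shows "process_law K M \<xi> = process_law K M' \<xi>'"
proof -
  let ?S = "\<lambda>_::int. S"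
  have law: "measure (process_law K N \<zeta>) (prod_emb UNIV ?S J X)
      = (\<integral>w. indicator X (\<lambda>j\<in>J. history \<zeta> t w (nat (t - j))) \<partial>N)" and prob: "prob_space (process_law K N \<zeta>)"
    if R: "random_process K N \<zeta>" and J: "J \<subseteq> {..t}" and X: "X \<in> sets (PiM J ?S)"
    for N :: "'x measure" and \<zeta> t J X
  proof -
    interpret N: prob_space N using R by (simp add: random_process_def)
    have \<zeta>: "\<zeta> k \<in> N \<rightarrow>\<^sub>M S" for k using R by (simp add: random_process_def)
    have m: "(\<lambda>w k. \<zeta> k w) \<in> N \<rightarrow>\<^sub>M PiM UNIV ?S"
      using measurable_space[OF \<zeta>] by (intro measurable_PiM_single' \<zeta>) auto
    then show "prob_space (process_law K N \<zeta>)" unfolding process_law_def by (rule N.prob_space_distr)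
    have emb: "prod_emb UNIV ?S J X \<in> sets (PiM UNIV ?S)" using X by (intro measurable_prod_emb) auto
    have "measure (process_law K N \<zeta>) (prod_emb UNIV ?S J X)
        = (\<integral>z. indicator (prod_emb UNIV ?S J X) z \<partial>process_law K N \<zeta>)"
      using emb sets.sets_into_space[OF emb] by (simp add: process_law_def Int_absorb2)
    also have "\<dots> = (\<integral>w. indicator (prod_emb UNIV ?S J X) (\<lambda>k. \<zeta> k w) \<partial>N)"
      unfolding process_law_def using m emb by (intro integral_distr) simp_all
    also have "\<dots> = (\<integral>w. indicator X (\<lambda>j\<in>J. history \<zeta> t w (nat (t - j))) \<partial>N)"
    proof (rule Bochner_Integration.integral_cong[OF refl])
      fix w assume w: "w \<in> space N"
      have "(\<lambda>j\<in>J. history \<zeta> t w (nat (t - j))) = restrict (\<lambda>k. \<zeta> k w) J"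
        using J by (auto simp: history_def fun_eq_iff)
      moreover have "(\<lambda>k. \<zeta> k w) \<in> space (PiM UNIV ?S)" using measurable_space[OF m w] .
      ultimately show "indicator (prod_emb UNIV ?S J X) (\<lambda>k. \<zeta> k w)
          = (indicator X (\<lambda>j\<in>J. history \<zeta> t w (nat (t - j))) :: real)"
        by (simp add: indicator_def prod_emb_eq_restrict_vimage)
    qed
    finally show "measure (process_law K N \<zeta>) (prod_emb UNIV ?S J X)
      = (\<integral>w. indicator X (\<lambda>j\<in>J. history \<zeta> t w (nat (t - j))) \<partial>N)" .
  qed
  have pM: "prob_space (process_law K M \<xi>)" "prob_space (process_law K M' \<xi>')"
    using prob[OF P(1), of "{}" 0 "{}"] prob[OF P'(1), of "{}" 0 "{}"] by simp_all
  show ?thesis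
  proof (rule measure_eqI_PiM_infinite)
    interpret N: prob_space "process_law K M \<xi>" by fact
    interpret N': prob_space "process_law K M' \<xi>'" by fact
    show "finite_measure (process_law K M \<xi>)" by unfold_locales
    show "sets (process_law K M \<xi>) = sets (PiM UNIV ?S)" "sets (process_law K M' \<xi>') = sets (PiM UNIV ?S)"
      by (simp_all add: process_law_def)
    fix A and J :: "int set" assume J: "finite J" and A: "\<And>i. i \<in> J \<Longrightarrow> A i \<in> sets S"
    \<comment> \<open>All times of \<open>J\<close> are seen from the common time t as lags below s,
      so the cylinder event becomes an event of the last s states; the inserted 0 covers empty
      \<open>J\<close>.\<close>
    define t where "t = Max (insert 0 J)"
    have t: "j \<le> t" if "j \<in> J" for j using J that by (simp add: t_def)
    define s where "s = Suc (Max (insert 0 ((\<lambda>j. nat (t - j)) ` J)))"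
    have s: "nat (t - j) < s" if "j \<in> J" for j
      using J that by (simp add: s_def less_Suc_eq_le)
    have X: "Pi\<^sub>E J A \<in> sets (PiM J ?S)" using J A by (intro sets_PiM_I_finite) auto
    have h: "quasi_Lip s 1 0 (\<lambda>x. indicator (Pi\<^sub>E J A) (\<lambda>j\<in>J. x (nat (t - j))))"
      using X s by (intro quasi_Lip_select) (auto simp: indicator_def)
    have "J \<subseteq> {..t}" using t by auto
    with expectation_unique[OF P P' h, of t]
    have "measure (process_law K M \<xi>) (prod_emb UNIV ?S J (Pi\<^sub>E J A)) = measure (process_law K M' \<xi>') (prod_emb UNIV ?S J (Pi\<^sub>E J A))"
      by (simp add: law[OF P(1) _ X] law[OF P'(1) _ X])
    then show "emeasure (process_law K M \<xi>) (prod_emb UNIV ?S J (Pi\<^sub>E J A)) = emeasure (process_law K M' \<xi>') (prod_emb UNIV ?S J (Pi\<^sub>E J A))"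
      by (simp add: N.emeasure_eq_measure N'.emeasure_eq_measure)
  qed
qed

text \<open>The process started at time \<open>-n\<close> from the history that is constantly \<open>0\<close>.\<close>

definition started_path :: "nat \<Rightarrow> (nat \<Rightarrow> 'e) \<Rightarrow> int \<Rightarrow> 'e" where
  "started_path n y i = (if i > - int n then y (nat (i + int n - 1)) else 0)"

definition started_law :: "nat \<Rightarrow> (int \<Rightarrow> 'e) measure" where
  "started_law n = distr (future_law K Q (- int n) (\<lambda>_. 0)) (PiM UNIV (\<lambda>_. S)) (started_path n)"

lemma measurable_started_path:
  "started_path n \<in> future_law K Q (- int n) (\<lambda>_. 0) \<rightarrow>\<^sub>M PiM UNIV (\<lambda>_. S)"
proof -
  have "started_path n \<in> PiM UNIV (\<lambda>_. S) \<rightarrow>\<^sub>M PiM UNIV (\<lambda>_. S)"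
    unfolding started_path_def
  proof (rule measurable_PiM_single')
    show "(\<lambda>y. if i > - int n then y (nat (i + int n - 1)) else 0) \<in> PiM UNIV (\<lambda>_. S) \<rightarrow>\<^sub>M S" for i
      using zero by (cases "i > - int n") (auto intro: measurable_component_singleton)
  qed (use zero in \<open>auto simp: space_PiM\<close>)
  then show ?thesis using sets_future_law[OF zero_in_histories, of "- int n"]
    by (simp add: hist_space_def cong: measurable_cong_sets)
qed

lemma prob_space_started_law: "prob_space (started_law n)"
  unfolding started_law_def
  by (intro prob_space.prob_space_distr prob_space_future_law measurable_started_path) simp

lemma sets_started_law: "sets (started_law n) = sets (PiM UNIV (\<lambda>_. S))"
  by (simp add: started_law_def)

lemma history_started_path:
  assumes "- int n \<le> t"
  shows "history (\<lambda>i w. w i) t (started_path n y) = extend_hist (\<lambda>_. 0) (nat (t + int n)) y"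
proof
  fix i
  show "history (\<lambda>i w. w i) t (started_path n y) i = extend_hist (\<lambda>_. 0) (nat (t + int n)) y i"
  proof (cases "i < nat (t + int n)")
    case True
    then have "nat (t - int i + int n - 1) = nat (t + int n) - 1 - i" "t - int i > - int n" by linarith+
    with True show ?thesis by (simp add: history_def started_path_def extend_hist_def)
  next
    case False
    then have "\<not> t - int i > - int n" by linarith
    with False show ?thesis by (simp add: history_def started_path_def extend_hist_def)
  qed
qed

lemma random_process_coordinates:
  assumes "prob_space M" "sets M = sets (PiM UNIV (\<lambda>_. S))"
  shows "random_process K M (\<lambda>i w. w i)"
proof -
  have "(\<lambda>w. w i) \<in> M \<rightarrow>\<^sub>M S" for i :: int
    using measurable_component_singleton[of i UNIV "\<lambda>_. S"] assms(2) by (simp cong: measurable_cong_sets)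
  then show ?thesis using assms(1) by (simp add: random_process_def)
qed

lemma expectation_started_law:
  assumes h: "h \<in> borel_measurable H" and t: "- int n \<le> t"
  shows "(\<integral>w. h (history (\<lambda>i w. w i) t w) \<partial>started_law n) = evolve (- int n) (nat (t + int n)) h (\<lambda>_. 0)"
proof -
  note R = random_process_coordinates[OF prob_space_started_law sets_started_law, of n]
  have "(\<lambda>w. h (history (\<lambda>i w. w i) t w)) \<in> borel_measurable (started_law n)"
    by (rule measurable_compose[OF measurable_history[OF R] h])
  then have "(\<integral>w. h (history (\<lambda>i w. w i) t w) \<partial>started_law n)
    = (\<integral>y. h (history (\<lambda>i w. w i) t (started_path n y)) \<partial>future_law K Q (- int n) (\<lambda>_. 0))"
    unfolding started_law_def by (intro integral_distr measurable_started_path) simp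
  then show ?thesis by (simp add: history_started_path[OF t] evolve_def)
qed

lemma evolve_near:
  assumes g: "g \<in> borel_measurable H" and x: "x \<in> histories K"
    and near: "\<And>y. y \<in> histories K \<Longrightarrow> \<bar>g y - c\<bar> \<le> b"
  shows "\<bar>evolve l n g x - c\<bar> \<le> b"
proof -
  let ?D = "distr (future_law K Q l x) H (extend_hist x n)"
  interpret D: prob_space ?D
    by (intro prob_space.prob_space_distr prob_space_future_law measurable_extend_hist_future x)
  have "c - b \<le> g y" "g y \<le> c + b" if "y \<in> space ?D" for y
    using near[of y] that by (auto simp: space_hist_space)
  moreover have "g \<in> borel_measurable ?D" using g by simp
  ultimately have "c - b \<le> integral\<^sup>L ?D g" "integral\<^sup>L ?D g \<le> c + b"
    using D.integral_between(1,2) by blast+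
  then show ?thesis by (auto simp: evolve_eq_distr[OF g x])
qed

text \<open>At time -n the process started at -m has some random history, and the other one has the
  history 0. From there on both are governed by the same function \<open>?g\<close>, which hardly
  depends on the history.\<close>

lemma started_law_cauchy:
  obtains \<gamma> A where "\<gamma> > 0" "\<And>s b L h t m n. quasi_Lip s b L h \<Longrightarrow> 0 \<le> b \<Longrightarrow> 0 \<le> L \<Longrightarrow> n \<le> m \<Longrightarrow>
    int s \<le> t + int n \<Longrightarrow>
    \<bar>(\<integral>w. h (history (\<lambda>i w. w i) t w) \<partial>started_law m) - (\<integral>w. h (history (\<lambda>i w. w i) t w) \<partial>started_law n)\<bar>
      \<le> A * exp (- \<gamma> * real (nat (t + int n) - s)) * (b + L)"
proof -
  obtain \<gamma> A where \<gamma>: "\<gamma> > 0" and A: "\<And>s b L h l k x y. quasi_Lip s b L h \<Longrightarrow> 0 \<le> b \<Longrightarrow> 0 \<le> L \<Longrightarrow>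
    x \<in> histories K \<Longrightarrow> y \<in> histories K \<Longrightarrow>
    \<bar>evolve l (k + s) h x - evolve l (k + s) h y\<bar> \<le> A * exp (- \<gamma> * real k) * (b + L)"
    by (rule exponential_loss_of_memory) blast
  have "\<bar>(\<integral>w. h (history (\<lambda>i w. w i) t w) \<partial>started_law m) - (\<integral>w. h (history (\<lambda>i w. w i) t w) \<partial>started_law n)\<bar>
      \<le> A * exp (- \<gamma> * real (nat (t + int n) - s)) * (b + L)"
    if h: "quasi_Lip s b L h" "0 \<le> b" "0 \<le> L" and nm: "n \<le> m" and s: "int s \<le> t + int n" for s b L h t m n
  proof -
    note hb = quasi_LipD(1)[OF h(1)] quasi_Lip_bound[OF h(1)]
    define k where "k = nat (t + int n) - s"
    let ?g = "evolve (- int n) (k + s) h"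
    have k: "nat (t + int n) = k + s" using s by (simp add: k_def)
    have m: "nat (t + int m) = (m - n) + (k + s)" "- int m + int (m - n) = - int n" using s nm k by linarith+
    have t: "- int n \<le> t" "- int m \<le> t" using s nm by linarith+
    have "evolve (- int m) (nat (t + int m)) h (\<lambda>_. 0) = evolve (- int m) (m - n) ?g (\<lambda>_. 0)"
      using evolve_add[OF hb zero_in_histories, of "- int m" "m - n" "k + s"] by (simp only: m)
    moreover have "\<bar>evolve (- int m) (m - n) ?g (\<lambda>_. 0) - ?g (\<lambda>_. 0)\<bar> \<le> A * exp (- \<gamma> * real k) * (b + L)"
      by (intro evolve_near measurable_evolve[OF hb] A h) simp_all
    ultimately show ?thesis
      unfolding expectation_started_law[OF hb(1) t(1)] expectation_started_law[OF hb(1) t(2)] k k_def[symmetric]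
      by simp
  qed
  with \<gamma> show thesis by (rule that)
qed

text \<open>Replacing the remote past by 0 leaves a function of j states, accessible to
  finite-dimensional convergence. With \<open>s \<le> j\<close> the states at which h may jump are
  left alone.\<close>

lemma quasi_Lip_truncate:
  assumes h: "quasi_Lip s b L h" and L: "0 \<le> L"
    and D: "\<And>x y. x \<in> K \<Longrightarrow> y \<in> K \<Longrightarrow> norm (x - y) \<le> D"
    and x: "x \<in> histories K" and s: "s \<le> j"
  shows "\<bar>h x - h (\<lambda>i. if i < j then x i else 0)\<bar> \<le> L * (\<alpha> ^ j * D / (1 - \<alpha>))"
proof -
  let ?x = "\<lambda>i. if i < j then x i else 0"
  have x': "?x \<in> histories K" using x zero by (auto simp: Pi_iff)
  have "\<bar>h x - h ?x\<bar> \<le> L * hist_dist \<alpha> x ?x" using s by (intro quasi_LipD(3)[OF h x x']) auto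
  also have "hist_dist \<alpha> x ?x \<le> (0 + \<alpha> ^ j * D) / (1 - \<alpha>)" by (rule hist_dist_le[OF x x' D]) auto
  finally show ?thesis using L by (simp add: mult_left_mono)
qed

lemma prob_emb_integral:
  assumes N: "prob_space N" "sets N = sets (PiM UNIV (\<lambda>_::int. S))" and J: "J \<subseteq> {..t}"
    and X: "X \<in> sets (PiM J (\<lambda>_. S))"
  shows "measure N (prod_emb UNIV (\<lambda>_. S) J X)
    = (\<integral>w. indicator X (\<lambda>j\<in>J. history (\<lambda>i w. w i) t w (nat (t - j))) \<partial>N)"
proof -
  interpret N: prob_space N by fact
  have emb: "prod_emb UNIV (\<lambda>_. S) J X \<in> sets N" unfolding N(2) using X by (intro measurable_prod_emb) auto
  have sp: "space N = space (PiM UNIV (\<lambda>_. S))" using N(2) by (rule sets_eq_imp_space_eq)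
  have eq: "(\<lambda>j\<in>J. history (\<lambda>i w. w i) t w (nat (t - j))) = restrict w J" for w :: "int \<Rightarrow> 'e"
    using J by (auto simp: history_def fun_eq_iff)
  have "measure N (prod_emb UNIV (\<lambda>_. S) J X) = (\<integral>w. indicator (prod_emb UNIV (\<lambda>_. S) J X) w \<partial>N)"
    using sets.sets_into_space[OF emb] by (simp add: Int_absorb2)
  also have "\<dots> = (\<integral>w. indicator X (restrict w J) \<partial>N)"
    by (intro Bochner_Integration.integral_cong refl) (simp add: indicator_def prod_emb_eq_restrict_vimage sp)
  finally show ?thesis by (simp only: eq)
qed

text \<open>Convergence for functions of the whole history, as \<open>process_exists\<close> applies
  it to \<open>step_op k h\<close>. Three errors below e/3: truncation under the approximating law,
  comparison of the marginals on j states, truncation under the limit.\<close>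

lemma limit_process:
  obtains P where "prob_space P" "sets P = sets (PiM UNIV (\<lambda>_::int. S))"
    "\<And>s b L h t. quasi_Lip s b L h \<Longrightarrow> 0 \<le> b \<Longrightarrow> 0 \<le> L \<Longrightarrow>
      (\<lambda>n. \<integral>w. h (history (\<lambda>i w. w i) t w) \<partial>started_law n) \<longlonglongrightarrow> (\<integral>w. h (history (\<lambda>i w. w i) t w) \<partial>P)"
proof -
  let ?S = "\<lambda>_::int. S" and ?emb = "prod_emb UNIV (\<lambda>_::int. S)"
  let ?hist = "history (\<lambda>i w. w i) :: int \<Rightarrow> (int \<Rightarrow> 'e) \<Rightarrow> nat \<Rightarrow> 'e"
  obtain \<gamma> A where \<gamma>: "\<gamma> > 0" and A: "\<And>s b L h t m n. quasi_Lip s b L h \<Longrightarrow> 0 \<le> b \<Longrightarrow> 0 \<le> L \<Longrightarrow> n \<le> m \<Longrightarrow>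
    int s \<le> t + int n \<Longrightarrow>
    \<bar>(\<integral>w. h (?hist t w) \<partial>started_law m) - (\<integral>w. h (?hist t w) \<partial>started_law n)\<bar>
      \<le> A * exp (- \<gamma> * real (nat (t + int n) - s)) * (b + L)"
    by (rule started_law_cauchy) blast
  note prob = prob_space_started_law and sets = sets_started_law
  have cauchy: "\<exists>n0. \<forall>m\<ge>n0. \<forall>n\<ge>n0. \<forall>X\<in>sets (PiM J ?S).
      \<bar>measure (started_law m) (?emb J X) - measure (started_law n) (?emb J X)\<bar> < e"
    if J: "finite J" and e: "e > 0" for J e
  proof -
    \<comment> \<open>The inserted 0 also makes t nonnegative, so that \<open>s \<le> n\<close>
      already gives \<open>int s \<le> t + int n\<close>.\<close>
    define t where "t = Max (insert 0 J)"
    have t: "j \<le> t" if "j \<in> J" for j using J that by (simp add: t_def)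
    then have Jt: "J \<subseteq> {..t}" by auto
    have t0: "0 \<le> t" using J by (simp add: t_def)
    define s where "s = Suc (Max (insert 0 ((\<lambda>j. nat (t - j)) ` J)))"
    have s: "nat (t - j) < s" if "j \<in> J" for j
      using J that by (simp add: s_def less_Suc_eq_le)
    obtain k0 where k0: "\<And>k. k \<ge> k0 \<Longrightarrow> norm (A * exp (- \<gamma> * real k) - 0) < e"
      using LIMSEQ_D[OF tendsto_exp_neg_nat[OF \<gamma>] e] by blast
    have *: "\<bar>measure (started_law m) (?emb J X) - measure (started_law n) (?emb J X)\<bar> < e"
      if n: "s + k0 \<le> n" and nm: "n \<le> m" and X: "X \<in> sets (PiM J ?S)" for m n X
    proof -
      have h: "quasi_Lip s 1 0 (\<lambda>x. indicator X (\<lambda>j\<in>J. x (nat (t - j))))"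
        using X s by (intro quasi_Lip_select) (auto simp: indicator_def)
      have sn: "int s \<le> t + int n" and k: "k0 \<le> nat (t + int n) - s" using n t0 by linarith+
      have "\<bar>measure (started_law m) (?emb J X) - measure (started_law n) (?emb J X)\<bar>
          \<le> A * exp (- \<gamma> * real (nat (t + int n) - s))"
        using A[OF h _ _ nm sn]
        unfolding prob_emb_integral[OF prob sets Jt X] by simp
      also have "\<dots> < e" using k0[OF k] by simp
      finally show ?thesis .
    qed
    have "\<bar>measure (started_law m) (?emb J X) - measure (started_law n) (?emb J X)\<bar> < e"
      if "s + k0 \<le> n" "s + k0 \<le> m" "X \<in> sets (PiM J ?S)" for m n X
      using *[OF that(1) _ that(3), of m] *[OF that(2) _ that(3), of n]
      by (cases "n \<le> m") (simp_all add: abs_minus_commute)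
    then show ?thesis by blast
  qed
  obtain P where P: "prob_space P" "sets P = sets (PiM UNIV ?S)"
    and lim: "\<And>J X. finite J \<Longrightarrow> X \<in> sets (PiM J ?S) \<Longrightarrow>
      (\<lambda>n. measure (started_law n) (?emb J X)) \<longlonglongrightarrow> measure P (?emb J X)"
    by (rule process_uniform_limit[OF compact_imp_closed[OF compact] zero prob sets cauchy]) blast+
  \<comment> \<open>Letting one index tend to infinity in the Cauchy estimate keeps it uniform over
    the events; this is the variation bound required for integrating merely measurable
    functions.\<close>
  have uniform: "\<exists>n0. \<forall>n\<ge>n0. \<forall>X\<in>sets (PiM J ?S).
      \<bar>measure (started_law n) (?emb J X) - measure P (?emb J X)\<bar> \<le> e" if J: "finite J" and e: "e > 0" for J e
  proof -
    obtain n0 where n0: "\<And>m n X. m \<ge> n0 \<Longrightarrow> n \<ge> n0 \<Longrightarrow> X \<in> sets (PiM J ?S) \<Longrightarrow>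
      \<bar>measure (started_law m) (?emb J X) - measure (started_law n) (?emb J X)\<bar> < e"
      using cauchy[OF J e] by blast
    have "\<bar>measure (started_law n) (?emb J X) - measure P (?emb J X)\<bar> \<le> e"
      if n: "n \<ge> n0" and X: "X \<in> sets (PiM J ?S)" for n X
    proof (rule LIMSEQ_le_const2)
      show "(\<lambda>m. \<bar>measure (started_law n) (?emb J X) - measure (started_law m) (?emb J X)\<bar>)
          \<longlonglongrightarrow> \<bar>measure (started_law n) (?emb J X) - measure P (?emb J X)\<bar>"
        by (intro tendsto_intros lim J X)
      show "\<exists>N. \<forall>m\<ge>N. \<bar>measure (started_law n) (?emb J X) - measure (started_law m) (?emb J X)\<bar> \<le> e"
        using n0[OF n _ X] less_imp_le by blast
    qed
    then show ?thesis by blast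
  qed
  have "(\<lambda>n. \<integral>w. h (?hist t w) \<partial>started_law n) \<longlonglongrightarrow> (\<integral>w. h (?hist t w) \<partial>P)"
    if h: "quasi_Lip s b L h" and b: "0 \<le> b" and L: "0 \<le> L" for s b L h t
  proof (rule LIMSEQ_I)
    fix e :: real assume e: "0 < e"
    obtain D where D: "D > 0" "\<And>x y. x \<in> K \<Longrightarrow> y \<in> K \<Longrightarrow> norm (x - y) \<le> D" using bounded_diam by blast
    note hb = quasi_LipD(1)[OF h] quasi_Lip_bound[OF h]
    have "(\<lambda>j. L * (\<alpha> ^ j * D / (1 - \<alpha>))) \<longlonglongrightarrow> L * (0 * D / (1 - \<alpha>))"
      using \<alpha> by (intro tendsto_intros LIMSEQ_power_zero) auto
    then have "\<forall>\<^sub>F j in sequentially. L * (\<alpha> ^ j * D / (1 - \<alpha>)) < e / 3"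
      using e by (intro order_tendstoD(2)) auto
    then obtain j0 where j0: "\<And>j. j \<ge> j0 \<Longrightarrow> L * (\<alpha> ^ j * D / (1 - \<alpha>)) < e / 3"
      unfolding eventually_sequentially by blast
    define j where "j = max j0 s"
    define c where "c = L * (\<alpha> ^ j * D / (1 - \<alpha>))"
    have c: "c < e / 3" using j0[of j] by (simp add: c_def j_def)
    let ?J = "{t - int j<..t}"
    define ext where "ext u = (\<lambda>i. if i < j then u (t - int i) else 0)" for u :: "int \<Rightarrow> 'e"
    let ?f = "\<lambda>u. h (ext u)"
    have ext: "ext \<in> PiM ?J ?S \<rightarrow>\<^sub>M H"
      unfolding hist_space_def ext_def
    proof (rule measurable_PiM_single')
      show "(\<lambda>u. if i < j then u (t - int i) else 0) \<in> PiM ?J ?S \<rightarrow>\<^sub>M S" for i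
        using zero by (cases "i < j") (auto intro!: measurable_component_singleton)
    qed (use zero in \<open>auto simp: space_PiM PiE_iff\<close>)
    have f: "?f \<in> borel_measurable (PiM ?J ?S)" by (rule measurable_compose[OF ext hb(1)])
    have trunc: "\<bar>h (?hist t w) - ?f (restrict w ?J)\<bar> \<le> c" if "w \<in> space (PiM UNIV ?S)" for w
    proof -
      have "?hist t w \<in> histories K" using that by (auto simp: history_def space_PiM)
      moreover have "ext (restrict w ?J) = (\<lambda>i. if i < j then ?hist t w i else 0)"
        by (auto simp: ext_def history_def)
      ultimately show ?thesis
        using quasi_Lip_truncate[OF h L D(2), of "?hist t w" j] by (simp add: c_def j_def)
    qed
    have restr: "(\<lambda>w. restrict w ?J) \<in> N \<rightarrow>\<^sub>M PiM ?J ?S" if "sets N = sets (PiM UNIV ?S)" for N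
      using measurable_restrict_subset[of ?J UNIV ?S] that by (simp cong: measurable_cong_sets)
    have near: "\<bar>(\<integral>w. h (?hist t w) \<partial>N) - (\<integral>u. ?f u \<partial>distr N (PiM ?J ?S) (\<lambda>w. restrict w ?J))\<bar> \<le> c"
      if N: "prob_space N" "sets N = sets (PiM UNIV ?S)" for N
    proof -
      interpret N: prob_space N by fact
      note RN = random_process_coordinates[OF N]
      have sp: "space N = space (PiM UNIV ?S)" using N(2) by (rule sets_eq_imp_space_eq)
      have m: "(\<lambda>w. h (?hist t w)) \<in> borel_measurable N" "(\<lambda>w. ?f (restrict w ?J)) \<in> borel_measurable N"
        by (rule measurable_compose[OF measurable_history[OF RN] hb(1)] measurable_compose[OF restr[OF N(2)] f])+
      have in_hist: "?hist t w \<in> histories K" "ext (restrict w ?J) \<in> histories K" if "w \<in> space N" for w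
        using measurable_space[OF measurable_history[OF RN] that]
          measurable_space[OF ext measurable_space[OF restr[OF N(2)] that]] by (simp_all add: space_hist_space)
      have int: "integrable N (\<lambda>w. h (?hist t w))" "integrable N (\<lambda>w. ?f (restrict w ?J))"
        using hb(2) in_hist m
        by (auto intro!: N.integrable_const_bound[where B="\<bar>h (\<lambda>_. 0)\<bar> + b"] AE_I2)
      have "\<bar>\<integral>w. h (?hist t w) - ?f (restrict w ?J) \<partial>N\<bar> \<le> c"
        using m trunc sp by (intro N.abs_integral_le borel_measurable_diff) auto
      then show ?thesis using int by (simp add: integral_distr[OF restr[OF N(2)] f])
    qed
    \<comment> \<open>The 1 added to b keeps the denominator positive when b = 0.\<close>
    define e' where "e' = e / (3 * (b + 1))"
    have e': "e' > 0" "b * e' < e / 3" using e b by (simp_all add: e'_def field_simps)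
    obtain n0 where n0: "\<And>n X. n \<ge> n0 \<Longrightarrow> X \<in> sets (PiM ?J ?S) \<Longrightarrow>
        \<bar>measure (started_law n) (?emb ?J X) - measure P (?emb ?J X)\<bar> \<le> e'"
      using uniform[of ?J e'] e'(1) by auto
    have "norm ((\<integral>w. h (?hist t w) \<partial>started_law n) - (\<integral>w. h (?hist t w) \<partial>P)) < e" if n: "n \<ge> n0" for n
    proof -
      let ?marg = "\<lambda>N. distr N (PiM ?J ?S) (\<lambda>w. restrict w ?J)"
      have marg: "measure (?marg N) X = measure N (?emb ?J X)"
        if "sets N = sets (PiM UNIV ?S)" "X \<in> sets (PiM ?J ?S)" for N X
        using that sets_eq_imp_space_eq[OF that(1)]
        by (simp add: measure_distr[OF restr[OF that(1)]] prod_emb_eq_restrict_vimage)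
      have "\<bar>integral\<^sup>L (?marg (started_law n)) ?f - integral\<^sup>L (?marg P) ?f\<bar> \<le> b * e'"
      proof (rule integral_diff_le_osc)
        show "prob_space (?marg (started_law n))" "prob_space (?marg P)"
          using prob P(1) by (intro prob_space.prob_space_distr restr sets P(2); simp)+
        show "?f \<in> borel_measurable (?marg (started_law n))" using f by simp
        fix u v assume "u \<in> space (?marg (started_law n))" "v \<in> space (?marg (started_law n))"
        then have "ext u \<in> histories K" "ext v \<in> histories K"
          using measurable_space[OF ext] by (simp_all add: space_hist_space)
        then show "\<bar>h (ext u) - h (ext v)\<bar> \<le> b" by (rule quasi_LipD(2)[OF h])
      qed (use n0[OF n] in \<open>simp_all add: marg sets P(2)\<close>)
      then show ?thesis
        using near[OF prob sets, of n] near[OF P] c e'(2) unfolding real_norm_def by linarith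
    qed
    then show "\<exists>n0. \<forall>n\<ge>n0. norm ((\<integral>w. h (?hist t w) \<partial>started_law n) - (\<integral>w. h (?hist t w) \<partial>P)) < e"
      by blast
  qed
  with P show thesis by (rule that)
qed

text \<open>For the process started at -n the transition identity at time k is exact once -n is at
  most k. Both h and \<open>step_op k h\<close> are quasi-Lipschitz, so the two sides converge;
  indicators of boxes as h then identify the laws.\<close>

lemma process_exists:
  obtains P where "random_process K P (\<lambda>i (w :: int \<Rightarrow> 'e). w i)" "has_transitions K Q P (\<lambda>i w. w i)"
proof -
  let ?hist = "history (\<lambda>i w. w i) :: int \<Rightarrow> (int \<Rightarrow> 'e) \<Rightarrow> nat \<Rightarrow> 'e"
  obtain P where P: "prob_space P" "sets P = sets (PiM UNIV (\<lambda>_::int. S))"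
    and lim: "\<And>s b L h t. quasi_Lip s b L h \<Longrightarrow> 0 \<le> b \<Longrightarrow> 0 \<le> L \<Longrightarrow>
      (\<lambda>n. \<integral>w. h (?hist t w) \<partial>started_law n) \<longlonglongrightarrow> (\<integral>w. h (?hist t w) \<partial>P)"
    by (rule limit_process) blast
  have R: "random_process K P (\<lambda>i w. w i)" by (rule random_process_coordinates[OF P])
  have step: "(\<integral>w. h (?hist (k + 1) w) \<partial>P) = (\<integral>w. step_op k h (?hist k w) \<partial>P)"
    if h: "quasi_Lip s b L h" "0 \<le> b" "0 \<le> L" for h s b L k
  proof (rule LIMSEQ_unique)
    note hb = quasi_LipD(1)[OF h(1)] quasi_Lip_bound[OF h(1)]
    show "(\<lambda>n. \<integral>w. h (?hist (k + 1) w) \<partial>started_law n) \<longlonglongrightarrow> (\<integral>w. h (?hist (k + 1) w) \<partial>P)"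
      by (rule lim[OF h])
    have "(\<integral>w. step_op k h (?hist k w) \<partial>started_law n) = (\<integral>w. h (?hist (k + 1) w) \<partial>started_law n)"
      if n: "nat (- k) \<le> n" for n
    proof -
      have k: "- int n \<le> k" "- int n \<le> k + 1" "nat (k + 1 + int n) = Suc (nat (k + int n))"
        "- int n + int (nat (k + int n)) = k" using n by linarith+
      show ?thesis
        unfolding expectation_started_law[OF hb(1) k(2)] expectation_started_law[OF measurable_step_op[OF hb(1)] k(1)]
        using evolve_Suc[OF hb zero_in_histories, of "- int n" "nat (k + int n)"] by (simp only: k(3,4))
    qed
    then have "\<forall>\<^sub>F n in sequentially. (\<integral>w. step_op k h (?hist k w) \<partial>started_law n) = (\<integral>w. h (?hist (k + 1) w) \<partial>started_law n)"
      unfolding eventually_sequentially by blast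
    moreover have "(\<lambda>n. \<integral>w. step_op k h (?hist k w) \<partial>started_law n) \<longlonglongrightarrow> (\<integral>w. step_op k h (?hist k w) \<partial>P)"
      using h C \<alpha> by (intro lim[OF step_op_quasi_Lip[OF h]]) auto
    ultimately show "(\<lambda>n. \<integral>w. h (?hist (k + 1) w) \<partial>started_law n) \<longlonglongrightarrow> (\<integral>w. step_op k h (?hist k w) \<partial>P)"
      by (rule Lim_transform_eventually[rotated])
  qed
  have "distr P H (?hist (k + 1)) = distr P H (?hist k) \<bind> cons_kernel k" for k
  proof (rule hist_measure_eqI)
    note N = prob_space_history[OF R, of k]
    show "prob_space (distr P H (?hist (k + 1)))" by (rule prob_space_history[OF R])
    show "prob_space (distr P H (?hist k) \<bind> cons_kernel k)"
      and sets: "sets (distr P H (?hist k) \<bind> cons_kernel k) = sets H"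
      by (rule prob_space_bind_cons_kernel[OF N sets_distr])+
    fix A and J :: "nat set" assume JA: "finite J" "\<And>i. i \<in> J \<Longrightarrow> A i \<in> sets S"
    define B where "B = {z \<in> space H. \<forall>i\<in>J. z i \<in> A i}"
    have B: "B \<in> sets H" unfolding B_def by (rule sets_box[OF JA])
    have mB: "measure N B = (\<integral>z. indicator B z \<partial>N)" if "sets N = sets H" for N
      using sets.sets_into_space[OF B] sets_eq_imp_space_eq[OF that] by (simp add: Int_absorb2)
    have iB: "indicator B \<in> borel_measurable H" using B by simp
    define s where "s = Suc (Max (insert 0 J))"
    have s: "i < s" if "i \<in> J" for i using JA(1) that by (simp add: s_def less_Suc_eq_le)
    have h: "quasi_Lip s 1 0 (indicator B)"
      unfolding quasi_Lip_def using iB s by (auto simp: B_def indicator_def space_hist_space)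
    have "measure (distr P H (?hist (k + 1))) B = (\<integral>w. indicator B (?hist (k + 1) w) \<partial>P)"
      unfolding mB[OF sets_distr] by (rule integral_distr[OF measurable_history[OF R] iB])
    also have "\<dots> = (\<integral>w. step_op k (indicator B) (?hist k w) \<partial>P)" by (rule step[OF h]) simp_all
    also have "\<dots> = integral\<^sup>L (distr P H (?hist k)) (step_op k (indicator B))"
      by (rule integral_distr[OF measurable_history[OF R] measurable_step_op[OF iB], symmetric])
    also have "\<dots> = measure (distr P H (?hist k) \<bind> cons_kernel k) B"
      unfolding mB[OF sets] by (rule integral_bind_cons_kernel[OF N sets_distr iB, where b=1, symmetric]) simp
    finally show "measure (distr P H (?hist (k + 1))) {z \<in> space H. \<forall>i\<in>J. z i \<in> A i}
      = measure (distr P H (?hist k) \<bind> cons_kernel k) {z \<in> space H. \<forall>i\<in>J. z i \<in> A i}"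
      unfolding B_def .
  qed simp
  then have "has_transitions K Q P (\<lambda>i w. w i)" by (rule bind_imp_has_transitions[OF R])
  with R show thesis by (rule that)
qed

end

subsection \<open>Mixing\<close>

text \<open>At distance 0 the quotient in \<open>Lip\<close> is 0 and carries no information; there
  the bound comes from the last assumption.\<close>

lemma Lip_le_oneD:
  assumes Lip: "Lip X d f \<le> 1" and u: "u \<in> X" and v: "v \<in> X"
    and d: "0 \<le> d u v" "d u v = 0 \<Longrightarrow> f u = f v"
  shows "\<bar>f u - f v\<bar> \<le> d u v"
proof (cases "d u v = 0")
  case False
  have "ennreal (\<bar>f u - f v\<bar> / d u v) \<le> Lip X d f"
    unfolding Lip_def using u v by (auto intro: SUP_upper2)
  also note Lip
  finally have "\<bar>f u - f v\<bar> / d u v \<le> 1" by simp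
  with False d(1) show ?thesis by (simp add: divide_le_eq)
qed (simp add: d(2))

lemma product_metric_nonneg: "0 \<le> product_metric s u v"
  by (simp add: product_metric_def sum_nonneg)

lemma product_metric_eq_0:
  assumes "u \<in> space (prod_space K s)" "v \<in> space (prod_space K s)" "product_metric s u v = 0"
  shows "u = v"
proof
  fix i
  show "u i = v i"
  proof (cases "i < s")
    case True
    then show ?thesis using assms(3) by (auto simp: product_metric_def sum_nonneg_eq_0_iff)
  next
    case False
    then show ?thesis using assms(1,2) by (auto simp: prod_space_def space_PiM PiE_iff extensional_def)
  qed
qed

lemma Lip_prod_spaceD:
  assumes "Lip (space (prod_space K s)) (product_metric s) f \<le> 1"
    and "u \<in> space (prod_space K s)" "v \<in> space (prod_space K s)"
  shows "\<bar>f u - f v\<bar> \<le> product_metric s u v"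
  using product_metric_eq_0[OF assms(2,3)]
  by (intro Lip_le_oneD[where d="product_metric s", OF assms] product_metric_nonneg) auto

lemma measurable_state_borel: "(\<lambda>x. x) \<in> state_space K \<rightarrow>\<^sub>M borel"
  unfolding state_space_def by (rule measurable_restrict_space1) simp

lemma borel_measurable_product_metric:
  fixes K :: "'e::{real_normed_vector, second_countable_topology} set"
  shows "(\<lambda>u. product_metric s u v) \<in> borel_measurable (prod_space K s)"
proof -
  have "(\<lambda>u. norm (u i - v i)) \<in> borel_measurable (prod_space K s)" if "i \<in> {..<s}" for i
  proof -
    have "(\<lambda>u. u i) \<in> prod_space K s \<rightarrow>\<^sub>M state_space K"
      unfolding prod_space_def using that by (rule measurable_component_singleton)
    then have "(\<lambda>u. u i) \<in> borel_measurable (prod_space K s)"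
      by (rule measurable_compose[OF _ measurable_state_borel])
    then show ?thesis by measurable
  qed
  then show ?thesis unfolding product_metric_def by (rule borel_measurable_sum)
qed

text \<open>One point is picked from each basic open set that meets \<open>K\<close>, inside
  \<open>K\<close>; a dense set of the whole space could miss \<open>K\<close>.\<close>

lemma countable_dense_subset:
  fixes K :: "'a::{metric_space, second_countable_topology} set"
  obtains T where "countable T" "T \<subseteq> K" "\<And>x e. x \<in> K \<Longrightarrow> 0 < e \<Longrightarrow> \<exists>y\<in>T. dist y x < e"
proof -
  obtain B :: "'a set set" where B: "countable B" "topological_basis B"
    using ex_countable_basis by blast
  define p where "p U = (SOME x. x \<in> U \<inter> K)" for U
  have p: "p U \<in> U \<inter> K" if "x \<in> U \<inter> K" for U x
    unfolding p_def using that by (rule someI)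
  let ?T = "p ` {U \<in> B. U \<inter> K \<noteq> {}}"
  show thesis
  proof (rule that)
    show "countable ?T" using B(1) by (intro countable_image) auto
    show "?T \<subseteq> K" using p by blast
    fix x e assume x: "x \<in> K" and e: "(0::real) < e"
    obtain U where U: "U \<in> B" "x \<in> U" "U \<subseteq> ball x e"
      using topological_basisE[OF B(2) open_ball, of x x e] e by auto
    then have "p U \<in> U" using p[of x U] x by blast
    then have "dist (p U) x < e" using U(3) by (auto simp: dist_commute)
    then show "\<exists>y\<in>?T. dist y x < e" using U x by blast
  qed
qed

text \<open>Such an f is the infimum of \<open>f v + product_metric s u v\<close> over a countable
  dense set of v, and each of these functions of u is measurable. This supplies the measurability of
  the test functions in (1) and of g in (2), which are given by norm bounds alone.\<close>

lemma Lip_imp_borel_measurable: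
  fixes K :: "'e::{real_normed_vector, second_countable_topology} set"
  assumes f: "\<And>u v. u \<in> space (prod_space K s) \<Longrightarrow> v \<in> space (prod_space K s) \<Longrightarrow>
    \<bar>f u - f v\<bar> \<le> product_metric s u v"
  shows "f \<in> borel_measurable (prod_space K s)"
  unfolding borel_measurable_iff_less
proof
  fix a :: real
  let ?X = "space (prod_space K s)"
  have X: "?X = (\<Pi>\<^sub>E i\<in>{..<s}. K)" by (simp add: prod_space_def space_PiM)
  obtain T where T: "countable T" "T \<subseteq> K" "\<And>x e. x \<in> K \<Longrightarrow> 0 < e \<Longrightarrow> \<exists>y\<in>T. dist y x < e"
    using countable_dense_subset[of K] by blast
  define E where "E = (\<Pi>\<^sub>E i\<in>{..<s}. T)"
  have E: "countable E" "E \<subseteq> ?X"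
    unfolding E_def X using T(1,2) by (auto intro!: countable_PiE PiE_mono)
  have dense: "\<exists>v\<in>E. product_metric s u v < e" if u: "u \<in> ?X" and e: "0 < e" for u e
  proof -
    define d where "d = e / real (Suc s)"
    have d: "0 < d" using e by (simp add: d_def)
    have "\<forall>i\<in>{..<s}. \<exists>y\<in>T. dist y (u i) < d" using u T(3)[OF _ d] by (auto simp: X)
    then obtain y where y: "\<And>i. i < s \<Longrightarrow> y i \<in> T \<and> dist (y i) (u i) < d"
      by (metis lessThan_iff)
    have "product_metric s u (restrict y {..<s}) \<le> (\<Sum>i<s. d)"
      unfolding product_metric_def using y by (intro sum_mono) (force simp: dist_norm norm_minus_commute)
    also have "\<dots> < e" using e by (simp add: d_def field_simps)
    finally show ?thesis using y by (intro bexI[of _ "restrict y {..<s}"]) (auto simp: E_def)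
  qed
  \<comment> \<open>the product sigma-algebra is not the Borel algebra of the metric by definition, so the
    sublevel sets are written as countable unions\<close>
  have "{u \<in> ?X. f u < a} = (\<Union>v\<in>E. {u \<in> ?X. f v + product_metric s u v < a})"
  proof (intro set_eqI iffI)
    fix u assume u: "u \<in> {u \<in> ?X. f u < a}"
    \<comment> \<open>Half the margin, because the distance is paid twice: once in replacing f u by
      f v, once as the added term.\<close>
    then obtain v where v: "v \<in> E" "product_metric s u v < (a - f u) / 2"
      using dense[of u "(a - f u) / 2"] by auto
    then have "f v + product_metric s u v < a" using f[of u v] u E(2) by auto
    with u v(1) show "u \<in> (\<Union>v\<in>E. {u \<in> ?X. f v + product_metric s u v < a})" by auto
  next
    fix u assume "u \<in> (\<Union>v\<in>E. {u \<in> ?X. f v + product_metric s u v < a})"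
    then obtain v where v: "v \<in> E" "u \<in> ?X" "f v + product_metric s u v < a" by auto
    then show "u \<in> {u \<in> ?X. f u < a}" using f[of u v] E(2) by auto
  qed
  moreover have "{u \<in> ?X. f v + product_metric s u v < a} \<in> sets (prod_space K s)" for v
    by (intro borel_measurable_less borel_measurable_add borel_measurable_const borel_measurable_product_metric)
  ultimately show "{u \<in> ?X. f u < a} \<in> sets (prod_space K s)"
    using E(1) by (auto intro!: sets.countable_UN')
qed

section \<open>The two mixing estimates\<close>

context mixing_kernels
begin

text \<open>Blocks run forward in time, histories backward: entry i of a block of length s is
  coordinate s - 1 - i of the history at the last time of the block.\<close>

lemma block_future_eq:
  assumes "s \<ge> 1"
  shows "block \<xi> (\<tau> + int k + 1) s w = (\<lambda>i\<in>{..<s}. history \<xi> (\<tau> + int (k + s)) w (s - 1 - i))"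
  by (auto simp: block_def history_def fun_eq_iff of_nat_diff algebra_simps)

lemma block_past_eq:
  assumes "N \<ge> 1"
  shows "block \<xi> (\<tau> - int N + 1) N w = (\<lambda>i\<in>{..<N}. history \<xi> \<tau> w (N - 1 - i))"
  by (auto simp: block_def history_def fun_eq_iff of_nat_diff algebra_simps)

lemma extend_hist_block:
  assumes "s \<ge> 1"
  shows "(\<lambda>i\<in>{..<s}. extend_hist x (k + s) y (s - 1 - i)) = (\<lambda>i\<in>{..<s}. y (k + i))"
proof
  fix i
  have "k + s - 1 - (s - 1 - i) = k + i" "s - 1 - i < k + s" if "i < s" using that by linarith+
  then show "(\<lambda>i\<in>{..<s}. extend_hist x (k + s) y (s - 1 - i)) i = (\<lambda>i\<in>{..<s}. y (k + i)) i"
    by (simp add: extend_hist_def)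
qed

text \<open>States at least n steps old belong to the initial history, so a factor depending on them
  leaves the integral defining \<open>evolve\<close> as a constant.\<close>

lemma extend_hist_older: "extend_hist x n y (i + n) = x i"
  by (simp add: extend_hist_def)

lemma quasi_Lip_block:
  assumes "f \<in> borel_measurable (prod_space K s)" "s \<ge> 1"
    and "\<And>u. u \<in> space (prod_space K s) \<Longrightarrow> \<bar>f u\<bar> \<le> 1"
  shows "quasi_Lip s 2 0 (\<lambda>x. f (\<lambda>i\<in>{..<s}. x (s - 1 - i)))"
proof (rule quasi_Lip_select)
  fix u v assume "u \<in> space (PiM {..<s} (\<lambda>_. S))" "v \<in> space (PiM {..<s} (\<lambda>_. S))"
  then show "\<bar>f u - f v\<bar> \<le> 2"
    using assms(3)[of u] assms(3)[of v] by (auto simp: prod_space_def)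
qed (use assms in \<open>auto simp: prod_space_def\<close>)

text \<open>For g on the future block, its \<open>evolve\<close> image is nearly constant in the
  history at time \<open>\<tau>\<close>, hence close to its mean; this is (1). For (2), the factor f
  of the past is pulled out by \<open>extend_hist_older\<close>, and the covariance is that of f
  with a nearly constant function.\<close>

lemma feeble_mixing:
  assumes R: "random_process K M \<xi>" and trans: "has_transitions K Q M \<xi>"
  obtains \<gamma> A where "\<gamma> > 0" "A > 0"
    "\<And>\<tau> k s \<eta>. \<eta> \<in> histories K \<Longrightarrow> s \<ge> 1 \<Longrightarrow>
      dual_Lip_dist (product_metric s) (cond_block_law K Q \<tau> \<eta> k s) (block_law K M \<xi> (\<tau> + int k + 1) s)
        \<le> A * exp (- \<gamma> * real k)"
    "\<And>\<tau> k N s f g. f \<in> borel_measurable (prod_space K N) \<Longrightarrow> N \<ge> 1 \<Longrightarrow> s \<ge> 1 \<Longrightarrow>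
      (\<And>u. u \<in> space (prod_space K N) \<Longrightarrow> \<bar>f u\<bar> \<le> 1) \<Longrightarrow>
      (\<And>v. v \<in> space (prod_space K s) \<Longrightarrow> \<bar>g v\<bar> \<le> 1) \<Longrightarrow>
      Lip (space (prod_space K s)) (product_metric s) g \<le> 1 \<Longrightarrow>
      \<bar>(\<integral>w. f (block \<xi> (\<tau> - int N + 1) N w) * g (block \<xi> (\<tau> + int k + 1) s w) \<partial>M)
        - (\<integral>w. f (block \<xi> (\<tau> - int N + 1) N w) \<partial>M) * (\<integral>w. g (block \<xi> (\<tau> + int k + 1) s w) \<partial>M)\<bar>
        \<le> A * exp (- \<gamma> * real k)"
proof -
  obtain \<gamma> A where \<gamma>: "\<gamma> > 0" and A0: "A > 0" and A: "\<And>s b L h l k x y. quasi_Lip s b L h \<Longrightarrow> 0 \<le> b \<Longrightarrow> 0 \<le> L \<Longrightarrow>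
    x \<in> histories K \<Longrightarrow> y \<in> histories K \<Longrightarrow>
    \<bar>evolve l (k + s) h x - evolve l (k + s) h y\<bar> \<le> A * exp (- \<gamma> * real k) * (b + L)"
    by (rule exponential_loss_of_memory) blast
  interpret M: prob_space M using R by (simp add: random_process_def)
  have hm: "history \<xi> t \<in> M \<rightarrow>\<^sub>M H" for t by (rule measurable_history[OF R])
  have hist: "history \<xi> t w \<in> histories K" if "w \<in> space M" for t w
    using measurable_space[OF hm that] by (simp add: space_hist_space)
  \<comment> \<open>The factor 2 is the oscillation of a function bounded by 1.\<close>
  have close: "\<bar>evolve \<tau> (k + s) h x - (\<integral>w. evolve \<tau> (k + s) h (history \<xi> \<tau> w) \<partial>M)\<bar> \<le> 2 * A * exp (- \<gamma> * real k)"
    if h: "quasi_Lip s 2 0 h" and x: "x \<in> histories K" for h s k \<tau> x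
  proof -
    let ?g = "evolve \<tau> (k + s) h"
    have m: "(\<lambda>w. ?g (history \<xi> \<tau> w)) \<in> borel_measurable M"
      by (rule measurable_compose[OF hm measurable_evolve[OF quasi_LipD(1)[OF h] quasi_Lip_bound[OF h]]])
    have "\<bar>(\<integral>w. ?g x \<partial>M) - (\<integral>w. ?g (history \<xi> \<tau> w) \<partial>M)\<bar> \<le> A * exp (- \<gamma> * real k) * (2 + 0)"
      using m by (intro integral_diff_le_pairwise M.prob_space_axioms A h x hist) auto
    then show ?thesis by (simp add: M.prob_space mult_ac)
  qed
  have 1: "dual_Lip_dist (product_metric s) (cond_block_law K Q \<tau> \<eta> k s) (block_law K M \<xi> (\<tau> + int k + 1) s)
        \<le> (2 * A) * exp (- \<gamma> * real k)" if \<eta>: "\<eta> \<in> histories K" and s: "s \<ge> 1" for \<tau> k s \<eta>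
    unfolding dual_Lip_dist_def
  proof (rule cSUP_least)
    let ?X = "space (prod_space K s)"
    have X: "space (cond_block_law K Q \<tau> \<eta> k s) = ?X" by (simp add: cond_block_law_def)
    \<comment> \<open>The zero function is a witness that the supremum runs over a nonempty
      set.\<close>
    have "(\<lambda>_. 0) \<in> {f. sup_norm (space (cond_block_law K Q \<tau> \<eta> k s)) f
        + Lip (space (cond_block_law K Q \<tau> \<eta> k s)) (product_metric s) f \<le> 1}"
      by (simp add: sup_norm_def Lip_def bot_ennreal SUP_constant)
    then show "{f. sup_norm (space (cond_block_law K Q \<tau> \<eta> k s)) f
        + Lip (space (cond_block_law K Q \<tau> \<eta> k s)) (product_metric s) f \<le> 1} \<noteq> {}" by blast
    fix f assume "f \<in> {f. sup_norm (space (cond_block_law K Q \<tau> \<eta> k s)) f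
        + Lip (space (cond_block_law K Q \<tau> \<eta> k s)) (product_metric s) f \<le> 1}"
    then have sum: "sup_norm ?X f + Lip ?X (product_metric s) f \<le> 1" by (simp add: X)
    have sup: "sup_norm ?X f \<le> 1" and Lip: "Lip ?X (product_metric s) f \<le> 1"
      by (rule order_trans[OF _ sum], simp)+
    have f1: "\<bar>f u\<bar> \<le> 1" if "u \<in> ?X" for u
    proof -
      have "ennreal \<bar>f u\<bar> \<le> sup_norm ?X f" unfolding sup_norm_def using that by (rule SUP_upper)
      also note sup
      finally show ?thesis by simp
    qed
    have f: "f \<in> borel_measurable (prod_space K s)"
      using Lip_prod_spaceD[OF Lip] by (rule Lip_imp_borel_measurable)
    let ?h = "\<lambda>x. f (\<lambda>i\<in>{..<s}. x (s - 1 - i))"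
    have h: "quasi_Lip s 2 0 ?h" by (rule quasi_Lip_block[OF f s f1])
    have "(\<lambda>y. \<lambda>i\<in>{..<s}. y (k + i)) \<in> future_law K Q \<tau> \<eta> \<rightarrow>\<^sub>M prod_space K s"
      using measurable_select[where J="{..<s}" and \<sigma>="\<lambda>i. k + i"] sets_future_law[OF \<eta>, of \<tau>]
      by (simp add: prod_space_def cong: measurable_cong_sets)
    then have "integral\<^sup>L (cond_block_law K Q \<tau> \<eta> k s) f = evolve \<tau> (k + s) ?h \<eta>"
      unfolding cond_block_law_def evolve_def extend_hist_block[OF s] using f by (rule integral_distr)
    moreover have "integral\<^sup>L (block_law K M \<xi> (\<tau> + int k + 1) s) f = (\<integral>w. evolve \<tau> (k + s) ?h (history \<xi> \<tau> w) \<partial>M)"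
    proof -
      have "block \<xi> (\<tau> + int k + 1) s \<in> M \<rightarrow>\<^sub>M prod_space K s"
        unfolding block_def[abs_def] prod_space_def
        using R by (intro measurable_restrict) (simp add: random_process_def)
      then have "integral\<^sup>L (block_law K M \<xi> (\<tau> + int k + 1) s) f = (\<integral>w. f (block \<xi> (\<tau> + int k + 1) s w) \<partial>M)"
        unfolding block_law_def using f by (rule integral_distr)
      also have "\<dots> = (\<integral>w. evolve \<tau> (k + s) ?h (history \<xi> \<tau> w) \<partial>M)"
        unfolding block_future_eq[OF s]
        by (rule expectation_evolve[OF R trans quasi_LipD(1)[OF h] quasi_Lip_bound[OF h]])
      finally show ?thesis .
    qed
    ultimately show "\<bar>integral\<^sup>L (cond_block_law K Q \<tau> \<eta> k s) f - integral\<^sup>L (block_law K M \<xi> (\<tau> + int k + 1) s) f\<bar>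
        \<le> (2 * A) * exp (- \<gamma> * real k)"
      using close[OF h \<eta>, of \<tau> k] by simp
  qed
  have 2: "\<bar>(\<integral>w. f (block \<xi> (\<tau> - int N + 1) N w) * g (block \<xi> (\<tau> + int k + 1) s w) \<partial>M)
        - (\<integral>w. f (block \<xi> (\<tau> - int N + 1) N w) \<partial>M) * (\<integral>w. g (block \<xi> (\<tau> + int k + 1) s w) \<partial>M)\<bar>
        \<le> (2 * A) * exp (- \<gamma> * real k)"
    if f: "f \<in> borel_measurable (prod_space K N)" and N: "N \<ge> 1" and s: "s \<ge> 1"
      and f1: "\<And>u. u \<in> space (prod_space K N) \<Longrightarrow> \<bar>f u\<bar> \<le> 1"
      and g1: "\<And>v. v \<in> space (prod_space K s) \<Longrightarrow> \<bar>g v\<bar> \<le> 1"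
      and Lip: "Lip (space (prod_space K s)) (product_metric s) g \<le> 1"
    for \<tau> k N s f g
  proof -
    have g: "g \<in> borel_measurable (prod_space K s)"
      using Lip_prod_spaceD[OF Lip] by (rule Lip_imp_borel_measurable)
    let ?n = "k + s"
    let ?F = "\<lambda>x. f (\<lambda>i\<in>{..<N}. x (N - 1 - i))" and ?G = "\<lambda>x. g (\<lambda>i\<in>{..<s}. x (s - 1 - i))"
    \<comment> \<open>Recovers the history at time \<open>\<tau>\<close> from the one at time
      \<open>\<tau> + int ?n\<close>, so that f and g become functions of a single history.\<close>
    let ?shift = "\<lambda>x i. x (i + ?n) :: 'e"
    note h = quasi_Lip_block[OF g s g1]
    have sel: "(\<lambda>x. \<lambda>i\<in>{..<m}. x (m - 1 - i)) \<in> H \<rightarrow>\<^sub>M prod_space K m" for m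
      unfolding prod_space_def by (rule measurable_select)
    have F: "?F \<in> borel_measurable H" "\<And>x. x \<in> histories K \<Longrightarrow> \<bar>?F x\<bar> \<le> 1"
      and G: "?G \<in> borel_measurable H" "\<And>x. x \<in> histories K \<Longrightarrow> \<bar>?G x\<bar> \<le> 1"
      using measurable_compose[OF sel f] measurable_compose[OF sel g] f1 g1
        measurable_space[OF sel] by (auto simp: space_hist_space)
    have shift: "?shift \<in> H \<rightarrow>\<^sub>M H"
      unfolding hist_space_def
      by (rule measurable_PiM_single') (auto simp: space_PiM intro!: measurable_component_singleton)
    have FG: "(\<lambda>x. ?F (?shift x) * ?G x) \<in> borel_measurable H"
      by (intro borel_measurable_times measurable_compose[OF shift F(1)] G(1))
    have FG1: "\<bar>?F (?shift x) * ?G x\<bar> \<le> 1" if "x \<in> histories K" for x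
      using F(2)[of "?shift x"] G(2)[of x] that by (auto simp: abs_mult Pi_iff intro!: mult_le_one)
    let ?E = "evolve \<tau> ?n ?G"
    have "(\<integral>w. f (block \<xi> (\<tau> - int N + 1) N w) * g (block \<xi> (\<tau> + int k + 1) s w) \<partial>M)
      = (\<integral>w. ?F (?shift (history \<xi> (\<tau> + int ?n) w)) * ?G (history \<xi> (\<tau> + int ?n) w) \<partial>M)"
    proof -
      have "history \<xi> (\<tau> + int ?n) w (i + ?n) = history \<xi> \<tau> w i" for w i
        by (simp add: history_def)
      then show ?thesis by (simp only: block_future_eq[OF s] block_past_eq[OF N])
    qed
    also have "\<dots> = (\<integral>w. evolve \<tau> ?n (\<lambda>x. ?F (?shift x) * ?G x) (history \<xi> \<tau> w) \<partial>M)"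
      by (rule expectation_evolve[OF R trans FG FG1])
    also have "\<dots> = (\<integral>w. ?F (history \<xi> \<tau> w) * ?E (history \<xi> \<tau> w) \<partial>M)"
      by (simp only: evolve_def extend_hist_older integral_mult_right_zero)
    finally have FGE: "(\<integral>w. f (block \<xi> (\<tau> - int N + 1) N w) * g (block \<xi> (\<tau> + int k + 1) s w) \<partial>M)
      = (\<integral>w. ?F (history \<xi> \<tau> w) * ?E (history \<xi> \<tau> w) \<partial>M)" .
    have GE: "(\<integral>w. g (block \<xi> (\<tau> + int k + 1) s w) \<partial>M) = (\<integral>w. ?E (history \<xi> \<tau> w) \<partial>M)"
      unfolding block_future_eq[OF s] by (rule expectation_evolve[OF R trans G])
    let ?c = "\<integral>w. ?E (history \<xi> \<tau> w) \<partial>M" and ?e = "(2 * A) * exp (- \<gamma> * real k)"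
    have mF: "(\<lambda>w. ?F (history \<xi> \<tau> w)) \<in> borel_measurable M" by (rule measurable_compose[OF hm F(1)])
    have mE: "(\<lambda>w. ?E (history \<xi> \<tau> w)) \<in> borel_measurable M"
      by (rule measurable_compose[OF hm measurable_evolve[OF G]])
    have F1: "\<bar>?F (history \<xi> \<tau> w)\<bar> \<le> 1" if "w \<in> space M" for w by (rule F(2)[OF hist[OF that]])
    have Ec: "\<bar>?E (history \<xi> \<tau> w) - ?c\<bar> \<le> ?e" if "w \<in> space M" for w
      using close[OF h hist[OF that]] by simp
    have le: "\<bar>?F (history \<xi> \<tau> w) * (?E (history \<xi> \<tau> w) - ?c)\<bar> \<le> ?e" if "w \<in> space M" for w
      using mult_mono[OF F1[OF that] Ec[OF that]] by (simp add: abs_mult)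
    have mFE: "(\<lambda>w. ?F (history \<xi> \<tau> w) * (?E (history \<xi> \<tau> w) - ?c)) \<in> borel_measurable M"
      using mF mE by (intro borel_measurable_times borel_measurable_diff borel_measurable_const)
    have intF: "integrable M (\<lambda>w. ?F (history \<xi> \<tau> w))"
      using F1 mF by (intro M.integrable_const_bound[where B=1] AE_I2) auto
    have intFE: "integrable M (\<lambda>w. ?F (history \<xi> \<tau> w) * (?E (history \<xi> \<tau> w) - ?c))"
      using le mFE by (intro M.integrable_const_bound[where B="?e"] AE_I2) auto
    \<comment> \<open>Subtracting the mean \<open>?c\<close> writes the covariance as the integral
      of F times a deviation of size at most \<open>?e\<close>.\<close>
    have "(\<integral>w. ?F (history \<xi> \<tau> w) * ?E (history \<xi> \<tau> w) \<partial>M)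
        = (\<integral>w. ?F (history \<xi> \<tau> w) * (?E (history \<xi> \<tau> w) - ?c) + ?F (history \<xi> \<tau> w) * ?c \<partial>M)"
      by (intro Bochner_Integration.integral_cong refl) (simp add: algebra_simps)
    also have "\<dots> = (\<integral>w. ?F (history \<xi> \<tau> w) * (?E (history \<xi> \<tau> w) - ?c) \<partial>M) + (\<integral>w. ?F (history \<xi> \<tau> w) \<partial>M) * ?c"
      using intF by (subst Bochner_Integration.integral_add[OF intFE]) auto
    finally have "(\<integral>w. ?F (history \<xi> \<tau> w) * ?E (history \<xi> \<tau> w) \<partial>M) - (\<integral>w. ?F (history \<xi> \<tau> w) \<partial>M) * ?c
      = (\<integral>w. ?F (history \<xi> \<tau> w) * (?E (history \<xi> \<tau> w) - ?c) \<partial>M)" by simp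
    with M.abs_integral_le[OF mFE le] show ?thesis
      unfolding FGE GE unfolding block_past_eq[OF N] by simp
  qed
  show thesis using \<gamma> A0 1 2 by (intro that[of \<gamma> "2 * A"]) simp_all
qed

end

text \<open>All differences of probabilities are at most 1, so the real supremum in
  \<open>var_dist\<close> is over a bounded set and dominates each event.\<close>

lemma var_le_of_SF:
  assumes trans: "\<And>l. transition_probability K (Q l)"
    and SF: "\<And>x x' l. x \<in> histories K \<Longrightarrow> x' \<in> histories K \<Longrightarrow> var_dist (Q l x) (Q l x') \<le> C * hist_dist \<alpha> x x'"
    and x: "x \<in> histories K" "x' \<in> histories K" and A: "A \<in> sets (state_space K)"
  shows "\<bar>measure (Q l x) A - measure (Q l x') A\<bar> \<le> C * hist_dist \<alpha> x x'"
proof -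
  have Q: "prob_space (Q l x)" "sets (Q l x) = sets (state_space K)" if "x \<in> histories K" for x
    using measurable_space[OF trans[of l, unfolded transition_probability_def], of x] that
    by (auto simp: space_hist_space space_prob_algebra)
  interpret M: prob_space "Q l x" by (rule Q[OF x(1)])
  interpret N: prob_space "Q l x'" by (rule Q[OF x(2)])
  have "\<bar>measure (Q l x) A - measure (Q l x') A\<bar> \<le> var_dist (Q l x) (Q l x')"
    unfolding var_dist_def
  proof (rule cSUP_upper)
    show "A \<in> sets (Q l x)" using A Q(2)[OF x(1)] by simp
    show "bdd_above ((\<lambda>\<Gamma>. \<bar>measure (Q l x) \<Gamma> - measure (Q l x') \<Gamma>\<bar>) ` sets (Q l x))"
    proof (intro bdd_aboveI2)
      fix B
      show "\<bar>measure (Q l x) B - measure (Q l x') B\<bar> \<le> 1"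
        using M.prob_le_1[of B] N.prob_le_1[of B] measure_nonneg[of "Q l x" B] measure_nonneg[of "Q l x'" B]
        by linarith
    qed
  qed
  also have "\<dots> \<le> C * hist_dist \<alpha> x x'" by (rule SF[OF x])
  finally show ?thesis .
qed

theorem corollary3p7:
  fixes K :: "'e::{real_inner, complete_space, second_countable_topology} set"
    and \<alpha> :: real
    and Q :: "int \<Rightarrow> (nat \<Rightarrow> 'e) \<Rightarrow> 'e measure"
  assumes "compact K" and "0 \<in> K"
    and "0 < \<alpha>" and "\<alpha> < 1"
    and "\<And>l. transition_probability K (Q l)"
    and "SF K \<alpha> Q"
    and "RZ K Q"
  shows "\<exists>(M :: (int \<Rightarrow> 'e) measure) (\<xi> :: int \<Rightarrow> (int \<Rightarrow> 'e) \<Rightarrow> 'e).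
      random_process K M \<xi> \<and> has_transitions K Q M \<xi> \<and>
      (\<forall>(M' :: 'w measure) \<xi>'. random_process K M' \<xi>' \<and> has_transitions K Q M' \<xi>' \<longrightarrow>
          process_law K M' \<xi>' = process_law K M \<xi>) \<and>
      (\<exists>\<gamma>>0. \<exists>C :: nat \<Rightarrow> real. (\<forall>s\<ge>1. C s > 0) \<and>
        (\<forall>\<tau> (k::nat) s. \<forall>\<eta>\<in>histories K. s \<ge> 1 \<longrightarrow>
          dual_Lip_dist (product_metric s) (cond_block_law K Q \<tau> \<eta> k s)
              (block_law K M \<xi> (\<tau> + int k + 1) s)
            \<le> C s * exp (- \<gamma> * real k)) \<and>
        (\<forall>\<tau> (k::nat) N s. \<forall>f\<in>borel_measurable (prod_space K N). \<forall>g.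
          N \<ge> 1 \<and> s \<ge> 1 \<and> (\<forall>u\<in>space (prod_space K N). \<bar>f u\<bar> \<le> 1) \<and>
          (\<forall>v\<in>space (prod_space K s). \<bar>g v\<bar> \<le> 1) \<and>
          Lip (space (prod_space K s)) (product_metric s) g \<le> 1 \<longrightarrow>
          \<bar>prob_space.expectation M (\<lambda>w. f (block \<xi> (\<tau> - int N + 1) N w)
                * g (block \<xi> (\<tau> + int k + 1) s w))
            - prob_space.expectation M (\<lambda>w. f (block \<xi> (\<tau> - int N + 1) N w))
              * prob_space.expectation M (\<lambda>w. g (block \<xi> (\<tau> + int k + 1) s w))\<bar>
            \<le> C s * exp (- \<gamma> * real k)))"
proof -
  obtain C where C: "C > 0" "\<And>x x' l. x \<in> histories K \<Longrightarrow> x' \<in> histories K \<Longrightarrow>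
      var_dist (Q l x) (Q l x') \<le> C * hist_dist \<alpha> x x'"
    using \<open>SF K \<alpha> Q\<close> unfolding SF_def by blast
  interpret mixing_kernels K \<alpha> Q C
    using assms C(1) var_le_of_SF[of K Q C \<alpha>, OF assms(5) C(2)] by unfold_locales
  obtain P where R: "random_process K P (\<lambda>i (w :: int \<Rightarrow> 'e). w i)" "has_transitions K Q P (\<lambda>i w. w i)"
    by (rule process_exists) blast
  obtain \<gamma> A where mix: "\<gamma> > 0" "A > 0"
    "\<And>\<tau> k s \<eta>. \<eta> \<in> histories K \<Longrightarrow> s \<ge> 1 \<Longrightarrow>
      dual_Lip_dist (product_metric s) (cond_block_law K Q \<tau> \<eta> k s) (block_law K P (\<lambda>i w. w i) (\<tau> + int k + 1) s)
        \<le> A * exp (- \<gamma> * real k)"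
    "\<And>\<tau> k N s f g. f \<in> borel_measurable (prod_space K N) \<Longrightarrow> N \<ge> 1 \<Longrightarrow> s \<ge> 1 \<Longrightarrow>
      (\<And>u. u \<in> space (prod_space K N) \<Longrightarrow> \<bar>f u\<bar> \<le> 1) \<Longrightarrow>
      (\<And>v. v \<in> space (prod_space K s) \<Longrightarrow> \<bar>g v\<bar> \<le> 1) \<Longrightarrow>
      Lip (space (prod_space K s)) (product_metric s) g \<le> 1 \<Longrightarrow>
      \<bar>(\<integral>w. f (block (\<lambda>i w. w i) (\<tau> - int N + 1) N w) * g (block (\<lambda>i w. w i) (\<tau> + int k + 1) s w) \<partial>P)
        - (\<integral>w. f (block (\<lambda>i w. w i) (\<tau> - int N + 1) N w) \<partial>P) * (\<integral>w. g (block (\<lambda>i w. w i) (\<tau> + int k + 1) s w) \<partial>P)\<bar>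
        \<le> A * exp (- \<gamma> * real k)"
    by (rule feeble_mixing[OF R]) blast
  show ?thesis
  proof (rule exI[of _ P], rule exI[of _ "\<lambda>i w. w i"], intro conjI)
    show "random_process K P (\<lambda>i w. w i)" "has_transitions K Q P (\<lambda>i w. w i)" by (rule R)+
    show "\<forall>(M' :: 'w measure) \<xi>'. random_process K M' \<xi>' \<and> has_transitions K Q M' \<xi>' \<longrightarrow>
          process_law K M' \<xi>' = process_law K P (\<lambda>i w. w i)"
      using process_law_unique R by blast
  \<comment> \<open>The same \<open>A\<close> serves as the constant for every s, since the decay in
    k was obtained uniformly in s.\<close>
  qed (rule exI[of _ \<gamma>], intro conjI mix(1), rule exI[of _ "\<lambda>_. A"],
      use mix(2-4) in \<open>intro conjI allI ballI impI; (elim conjE)?; simp\<close>)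
qed

end
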